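(* There exists a divergence-free velocity field $u \in L^\infty((0,\infty); W^{1,\infty}(\mathbb{T}^3;\mathbb{R}^3))$ which is a $\limsup$ fast dynamo on $\mathbb{T}^3$. That is, there exists a family of initial data $\{B^\varepsilon_{\mathrm{in}}\}_{\varepsilon\in(0,1)} \subset L^2(\mathbb{T}^3;\mathbb{R}^3)$ such that, denoting by $B^\varepsilon$ the solution of the kinematic dynamo equation with velocity $u$, magnetic diffusivity $\varepsilon$ and initial datum $B^\varepsilon_{\mathrm{in}}$, $$\liminf_{\varepsilon\to 0}\ \limsup_{t\to\infty} \frac{1}{t}\log \|B^\varepsilon(t)\|_{L^2(\mathbb{T}^3)} > 0 .$$
   Context: $\mathbb{T}^3 = (\mathbb{R}/2\pi\mathbb{Z})^3$. For a bounded, Lipschitz, divergence-free velocity field $u:(0,\infty)\times\mathbb{T}^3\to\mathbb{R}^3$ and $\varepsilon>0$, the kinematic dynamo equation is $\partial_t B^\varepsilon + u\cdot\nabla B^\varepsilon - B^\varepsilon\cdot\nabla u = \varepsilon \Delta B^\varepsilon$, $\nabla\cdot B^\varepsilon = 0$, for $(t,x)\in(0,\infty)\times\mathbb{T}^3$, with initial datum $B^\varepsilon(0)=B^\varepsilon_{\mathrm{in}}$. The quantity $\limsup_{t\to\infty}\frac1t\log\|B^\varepsilon(t)\|_{L^2}$ is called the $\limsup$ dynamo growth rate, and $u$ is called a $\limsup$ fast dynamo if some family of initial data makes the $\liminf$ as $\varepsilon\to0$ of this rate strictly positive. *)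

theory Defs
  imports "HOL-Analysis.Analysis"
begin

text \<open>The torus T^3 = (R/2 pi Z)^3 is represented by 2 pi-periodic functions on R^3;
  integrals over T^3 are integrals over the fundamental box [0, 2 pi]^3.\<close>

definition torus_box :: "(real^3) set" where
  "torus_box = cbox 0 (\<chi> i. 2 * pi)"

definition periodic3 :: "(real^3 \<Rightarrow> 'b) \<Rightarrow> bool" where
  "periodic3 f \<longleftrightarrow> (\<forall>x i. f (x + (2 * pi) *\<^sub>R axis i 1) = f x)"

definition int_vec :: "real^3 \<Rightarrow> bool" where
  "int_vec k \<longleftrightarrow> (\<forall>i. k $ i \<in> \<int>)"

definition L2_field :: "(real^3 \<Rightarrow> real^3) \<Rightarrow> bool" where
  "L2_field f \<longleftrightarrow> periodic3 f \<and> f \<in> borel_measurable lborel \<and>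
     set_integrable lborel torus_box (\<lambda>x. (norm (f x))\<^sup>2)"

definition L2norm :: "(real^3 \<Rightarrow> real^3) \<Rightarrow> real" where
  "L2norm f = sqrt (LINT x:torus_box|lborel. (norm (f x))\<^sup>2)"

text \<open>Weak divergence-freeness on T^3, tested against the real Fourier modes
  psi(x) = cos(k.x + theta), k in Z^3 (grad psi = - sin(k.x+theta) k).\<close>
definition div_free :: "(real^3 \<Rightarrow> real^3) \<Rightarrow> bool" where
  "div_free f \<longleftrightarrow> (\<forall>k \<theta>. int_vec k \<longrightarrow>
     (LINT x:torus_box|lborel. (f x \<bullet> k) * sin (k \<bullet> x + \<theta>)) = 0)"

text \<open>Bounded, Lipschitz (uniformly in time), divergence-free periodic velocity field:
  u in L^infty((0,infty); W^{1,infty}(T^3;R^3)), div u = 0.\<close>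
definition velocity_field :: "(real \<Rightarrow> real^3 \<Rightarrow> real^3) \<Rightarrow> bool" where
  "velocity_field u \<longleftrightarrow>
     (\<lambda>p. u (fst p) (snd p)) \<in> borel_measurable borel \<and>
     (\<exists>M. \<forall>t>0. \<forall>x. norm (u t x) \<le> M) \<and>
     (\<exists>L. \<forall>t>0. \<forall>x y. norm (u t x - u t y) \<le> L * norm (x - y)) \<and>
     (\<forall>t>0. periodic3 (u t) \<and> div_free (u t))"

text \<open>Weak solution B in C([0,infty); L^2(T^3)) of the kinematic dynamo equation
  d_t B + u.grad B - B.grad u = eps Lap B, div B = 0, B(0) = B0.
  Since div u = div B = 0 the equation reads d_t B_i + sum_j d_j (u_j B_i - B_j u_i) = eps Lap B_i;
  it is tested against the real Fourier modes w(x) = cos(k.x + theta) a (k in Z^3, a in R^3),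
  for which d_j w_i = - a_i k_j sin(k.x+theta) and Lap w = -|k|^2 w.\<close>
definition dynamo_flux ::
  "(real \<Rightarrow> real^3 \<Rightarrow> real^3) \<Rightarrow> real \<Rightarrow> (real \<Rightarrow> real^3 \<Rightarrow> real^3) \<Rightarrow> real^3 \<Rightarrow> real^3 \<Rightarrow> real \<Rightarrow> real \<Rightarrow> real"
  where
  "dynamo_flux u \<epsilon> B k a \<theta> s =
     (LINT x:torus_box|lborel.
        (\<Sum>i\<in>UNIV. \<Sum>j\<in>UNIV. (u s x $ j * B s x $ i - B s x $ j * u s x $ i)
              * (- a $ i * k $ j * sin (k \<bullet> x + \<theta>)))
        + \<epsilon> * (B s x \<bullet> ((- (norm k)\<^sup>2 * cos (k \<bullet> x + \<theta>)) *\<^sub>R a)))"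

definition dynamo_solution ::
  "(real \<Rightarrow> real^3 \<Rightarrow> real^3) \<Rightarrow> real \<Rightarrow> (real^3 \<Rightarrow> real^3) \<Rightarrow> (real \<Rightarrow> real^3 \<Rightarrow> real^3) \<Rightarrow> bool"
  where
  "dynamo_solution u \<epsilon> B0 B \<longleftrightarrow>
     (\<forall>t\<ge>0. L2_field (B t) \<and> div_free (B t)) \<and>
     (\<forall>t0\<ge>0. ((\<lambda>t. L2norm (\<lambda>x. B t x - B t0 x)) \<longlongrightarrow> 0) (at t0 within {0..})) \<and>
     (\<forall>t\<ge>0. \<forall>k a \<theta>. int_vec k \<longrightarrow>
        set_integrable lborel {0..t} (dynamo_flux u \<epsilon> B k a \<theta>) \<and>
        (LINT x:torus_box|lborel. B t x \<bullet> (cos (k \<bullet> x + \<theta>) *\<^sub>R a))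
          - (LINT x:torus_box|lborel. B0 x \<bullet> (cos (k \<bullet> x + \<theta>) *\<^sub>R a))
        = (LINT s:{0..t}|lborel. dynamo_flux u \<epsilon> B k a \<theta> s))"

definition growth_rate :: "(real \<Rightarrow> real^3 \<Rightarrow> real^3) \<Rightarrow> ereal" where
  "growth_rate B = Limsup at_top (\<lambda>t. if L2norm (B t) = 0 then - \<infinity>
                                       else ereal (ln (L2norm (B t)) / t))"

end

theory Submission
  imports Defs "HOL-Library.Nat_Bijection"
begin

text \<open>A velocity field (1/m) V(m x) acts at diffusivity \<epsilon> on scale 1/m exactly as V acts at
  diffusivity \<epsilon> m^2 on scale 1.  Hence it suffices to have one cellular flow V that is a dynamo for
  every diffusivity in [1,2]: for each small \<epsilon> some integer m puts \<epsilon> m^2 in that range.  V is a Roberts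
  flow of tiny amplitude; a mean field of wave number kap induces fluctuations of relative size O(del),
  whose mean electromotive force (the alpha effect) amplifies one circular polarisation of the mean
  field at rate del^2 kap up to constants.

  The velocity runs through epochs of rapidly growing length, and every scale recurs in infinitely
  many of them.  An epoch rests until diffusion has removed every mode except the spatial mean, which
  is conserved; then a z-dependent shear turns the mean e_z into the amplified polarisation at the
  right scale; then the cellular flow runs for a fixed fraction of the elapsed time.  All estimates
  hold for an arbitrary weak solution and use only the supremum over Fourier modes, because
  Duhamel's formula closes in that norm: the factor |k| of the induction term is absorbed by
  \<epsilon> |k|^2 plus a large constant.  The same contraction gives existence.\<close>

section \<open>Fourier coefficients on the torus\<close>

text \<open>The obstacle is that one velocity with one Lipschitz bound must serve every small
  \<epsilon>. The factor 1/m in (1/m) V(m x) keeps gradients independent of m, and the limsup in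
  time lets the scales take turns. Growth gained at one scale may be lost later, so no lower bound
  is carried across epochs: each restarts from the conserved mean, whose amplitude is known, and
  only a crude upper bound on the other modes is inherited. A single Fourier coefficient bounds the
  L2 norm from below. Origin of the constants: in cell units the alpha effect acts at rate
  \<open>del\<close>^2 \<open>kap\<close> / \<eta> and diffusion of the mean at rate \<eta>
  \<open>kap\<close>^2. With \<eta> \<le> 2 and \<open>kap\<close> = \<open>del\<close>^2 / 16 the
  gain is at least four times the loss. The defect in slaving the fluctuations to the mean is at
  most 520 \<open>del\<close> relative to \<open>del\<close>^2 \<open>kap\<close>, which calls for
  \<open>del\<close> as small as 1/10000. Working with the supremum over infinitely many modes
  requires that it be finite beforehand; for a weak solution this comes from continuity in L2 on
  compact time intervals.\<close>

lemma sets_torus_box [measurable, simp]: "torus_box \<in> sets lborel" "torus_box \<in> sets borel"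
  by (auto simp: torus_box_def)

lemma emeasure_torus_box: "emeasure lborel torus_box = ennreal ((2 * pi) ^ 3)"
proof -
  have "emeasure lborel torus_box = ennreal (\<Prod>b\<in>(Basis :: (real^3) set). (((\<chi> i. 2 * pi) - 0) :: real^3) \<bullet> b)"
    unfolding torus_box_def
    by (rule emeasure_lborel_cbox) (auto simp: Basis_vec_def inner_axis)
  also have "(\<Prod>b\<in>(Basis :: (real^3) set). (((\<chi> i. 2 * pi) - 0) :: real^3) \<bullet> b) = (\<Prod>b\<in>(Basis :: (real^3) set). 2 * pi)"
    by (rule prod.cong) (auto simp: Basis_vec_def inner_axis)
  finally show ?thesis by simp
qed

lemma set_integrable_torus_bounded:
  fixes f :: "real^3 \<Rightarrow> 'b :: {banach, second_countable_topology}"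
  assumes "f \<in> borel_measurable lborel" "\<And>x. norm (f x) \<le> C"
  shows "set_integrable lborel torus_box f"
  unfolding set_integrable_def
proof (rule Bochner_Integration.integrable_bound)
  show "integrable lborel (\<lambda>x. C *\<^sub>R indicator torus_box x :: real)"
    by (intro integrable_scaleR_right) (auto simp: emeasure_torus_box)
  show "(\<lambda>x. indicator torus_box x *\<^sub>R f x) \<in> borel_measurable lborel"
    using assms(1) by measurable
  show "AE x in lborel. norm (indicator torus_box x *\<^sub>R f x) \<le> norm (C *\<^sub>R indicator torus_box x :: real)"
    using order_trans[OF assms(2) abs_ge_self] by (auto simp: indicator_def)
qed

lemma integral_cis_interval:
  fixes n :: real
  assumes "n \<in> \<int>"
  shows "(LINT t|lborel. indicator {0..2*pi} t *\<^sub>R cis (n * t)) = (if n = 0 then of_real (2 * pi) else 0)"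
proof (cases "n = 0")
  case True
  then show ?thesis by (simp add: scaleR_conv_of_real)
next
  case False
  have "(LINT t|lborel. indicator {0..2*pi} t *\<^sub>R cis (n * t)) = cis (n * (2 * pi)) / (\<i> * n) - cis (n * 0) / (\<i> * n)"
  proof (rule integral_FTC_Icc[where f = "\<lambda>t. cis (n * t)"])
    show "((\<lambda>x. cis (n * x) / (\<i> * complex_of_real n)) has_vector_derivative cis (n * x)) (at x within {0..2 * pi})" for x
      unfolding cis_conv_exp using False
      by (auto intro!: derivative_eq_intros has_vector_derivative_real_field simp: field_simps)
    show "continuous_on {0..2 * pi} (\<lambda>x. cis (n * x))"
      by (intro continuous_intros)
  qed simp
  moreover have "cis (n * (2 * pi)) = 1"
    using assms by (metis cis_multiple_2pi mult.commute)
  ultimately show ?thesis using False by simp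
qed

text \<open>Lebesgue measure on R^3 is the image of a product measure, and both the indicator of the
  box and the exponential factor over the coordinates. The integral becomes a product of three
  one-dimensional ones, and a single nonzero component of k makes it vanish.\<close>

lemma integral_torus_cis:
  assumes "int_vec k"
  shows "(LINT x:torus_box|lborel. cis (k \<bullet> x)) = (if k = 0 then of_real ((2 * pi) ^ 3) else 0)"
proof -
  interpret product_sigma_finite "\<lambda>b::real^3. lborel :: real measure"
    by standard
  let ?T = "\<lambda>f::real^3 \<Rightarrow> real. \<Sum>b\<in>Basis. f b *\<^sub>R b"
  have coord: "?T f \<bullet> b = f b" if "b \<in> Basis" for f and b :: "real^3"
    using that by simp
  have fin: "finite (Basis :: (real^3) set)" by simp
  have box: "x \<in> torus_box \<longleftrightarrow> (\<forall>b\<in>Basis. x \<bullet> b \<in> {0..2*pi})" for x :: "real^3"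
    unfolding torus_box_def mem_box by (auto simp: Basis_vec_def inner_axis)
  have "(LINT x:torus_box|lborel. cis (k \<bullet> x)) =
     (LINT x|distr (\<Pi>\<^sub>M b\<in>Basis. lborel) borel ?T. indicator torus_box x *\<^sub>R cis (k \<bullet> x))"
    unfolding set_lebesgue_integral_def lborel_eq[symmetric] by simp
  also have "\<dots> = (LINT f|(\<Pi>\<^sub>M b\<in>Basis. lborel). indicator torus_box (?T f) *\<^sub>R cis (k \<bullet> ?T f))"
  proof (rule integral_distr)
    show "?T \<in> (\<Pi>\<^sub>M b\<in>Basis. lborel) \<rightarrow>\<^sub>M borel" by measurable
    have "(\<lambda>x. cis (k \<bullet> x)) \<in> borel_measurable borel"
      by (intro borel_measurable_continuous_onI continuous_intros)
    then show "(\<lambda>x. indicat_real torus_box x *\<^sub>R cis (k \<bullet> x)) \<in> borel_measurable borel"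
      by measurable
  qed
  also have "\<dots> = (LINT f|(\<Pi>\<^sub>M b\<in>Basis. lborel). (\<Prod>b\<in>Basis. indicator {0..2*pi} (f b) *\<^sub>R cis ((k \<bullet> b) * f b)))"
  proof (rule Bochner_Integration.integral_cong[OF refl])
    fix f :: "real^3 \<Rightarrow> real"
    have ind: "indicator torus_box (?T f) = (\<Prod>b\<in>(Basis::(real^3) set). indicator {0..2*pi} (f b) :: real)"
    proof (cases "?T f \<in> torus_box")
      case True
      then show ?thesis using box[of "?T f"] coord by (auto simp: indicator_def)
    next
      case False
      then obtain b where "b \<in> Basis" "f b \<notin> {0..2*pi}"
        using box[of "?T f"] coord by auto
      then have "(\<Prod>b\<in>(Basis::(real^3) set). indicator {0..2*pi} (f b) :: real) = 0"
        by (auto simp: indicator_def)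
      then show ?thesis using False by simp
    qed
    have prodcis: "(\<Prod>b\<in>S. cis (g b)) = cis (\<Sum>b\<in>S. g b)" if "finite S" for S and g :: "real^3 \<Rightarrow> real"
      using that by induction (auto simp: cis_mult)
    have "k \<bullet> ?T f = (\<Sum>b\<in>Basis. (k \<bullet> b) * f b)"
      by (simp add: inner_sum_right mult.commute)
    then have "cis (k \<bullet> ?T f) = (\<Prod>b\<in>Basis. cis ((k \<bullet> b) * f b))"
      by (simp add: prodcis)
    moreover have "(\<Prod>b\<in>S. r b *\<^sub>R z b) = (\<Prod>b\<in>S. r b) *\<^sub>R (\<Prod>b\<in>S. z b)"
      for S and r :: "real^3 \<Rightarrow> real" and z :: "real^3 \<Rightarrow> complex"
      by (simp add: scaleR_conv_of_real prod.distrib)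
    ultimately show "indicator torus_box (?T f) *\<^sub>R cis (k \<bullet> ?T f) = (\<Prod>b\<in>Basis. indicator {0..2*pi} (f b) *\<^sub>R cis ((k \<bullet> b) * f b))"
      by (simp only: ind)
  qed
  also have "\<dots> = (\<Prod>b\<in>Basis. LINT t|lborel. indicator {0..2*pi} t *\<^sub>R cis ((k \<bullet> b) * t))"
  proof (rule product_integral_prod[OF fin])
    fix b :: "real^3"
    have "set_integrable lborel {0..2*pi} (\<lambda>t. cis ((k \<bullet> b) * t))"
      by (intro borel_integrable_atLeastAtMost' continuous_intros)
    then show "integrable lborel (\<lambda>t. indicat_real {0..2 * pi} t *\<^sub>R cis ((k \<bullet> b) * t))"
      by (simp add: set_integrable_def)
  qed
  also have "\<dots> = (\<Prod>b\<in>(Basis::(real^3) set). if k \<bullet> b = 0 then of_real (2 * pi) else 0)"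
  proof (rule prod.cong[OF refl])
    fix b :: "real^3" assume "b \<in> Basis"
    then have "k \<bullet> b \<in> \<int>" using assms by (auto simp: Basis_vec_def int_vec_def inner_axis)
    then show "(LINT t|lborel. indicator {0..2*pi} t *\<^sub>R cis ((k \<bullet> b) * t)) = (if k \<bullet> b = 0 then of_real (2 * pi) else 0)"
      by (rule integral_cis_interval)
  qed
  also have "\<dots> = (if k = 0 then of_real ((2 * pi) ^ 3) else 0)"
  proof (cases "k = 0")
    case False
    then obtain b where "b \<in> Basis" "k \<bullet> b \<noteq> 0" by (metis euclidean_all_zero_iff)
    then have "(\<Prod>b\<in>(Basis::(real^3) set). if k \<bullet> b = 0 then complex_of_real (2 * pi) else 0) = 0"
      by (intro prod_zero) auto
    then show ?thesis using False by simp
  qed simp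
  finally show ?thesis .
qed

section \<open>Coefficients of square-integrable fields and their control by the L2 norm\<close>

definition fcoeff :: "(real^3 \<Rightarrow> real) \<Rightarrow> real^3 \<Rightarrow> complex" where
  "fcoeff f k = (LINT x:torus_box|lborel. of_real (f x) * cis (- (k \<bullet> x)))"

text \<open>The pointwise bound |f| \<le> 1 + |f|^2 suffices because the box has finite
  measure.\<close>

lemma L2_field_integrable:
  assumes "L2_field f"
  shows "set_integrable lborel torus_box f"
  unfolding set_integrable_def
proof (rule Bochner_Integration.integrable_bound)
  have "f \<in> borel_measurable lborel" using assms by (simp add: L2_field_def)
  then show "(\<lambda>x. indicator torus_box x *\<^sub>R f x) \<in> borel_measurable lborel" by measurable
  have "integrable lborel (\<lambda>x. indicator torus_box x *\<^sub>R (norm (f x))\<^sup>2)"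
    using assms by (simp add: L2_field_def set_integrable_def)
  then show "integrable lborel (\<lambda>x. indicator torus_box x + indicator torus_box x *\<^sub>R (norm (f x))\<^sup>2 :: real)"
    by (intro Bochner_Integration.integrable_add) (auto simp: emeasure_torus_box)
  have "a \<le> 1 + a\<^sup>2" for a :: real
    by (smt (verit) power2_eq_square self_le_power zero_le_power2 pos2 mult_nonneg_nonneg)
  then show "AE x in lborel. norm (indicator torus_box x *\<^sub>R f x)
     \<le> norm (indicator torus_box x + indicator torus_box x *\<^sub>R (norm (f x))\<^sup>2 :: real)"
    by (auto simp: indicator_def)
qed

lemma set_integrable_mult_bounded:
  fixes f g :: "real^3 \<Rightarrow> complex"
  assumes "set_integrable lborel torus_box f" "g \<in> borel_measurable lborel" "\<And>x. norm (g x) \<le> C"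
  shows "set_integrable lborel torus_box (\<lambda>x. f x * g x)"
proof -
  have i: "integrable lborel (\<lambda>x. C *\<^sub>R norm (indicator torus_box x *\<^sub>R f x))"
    using assms(1) unfolding set_integrable_def by (intro integrable_scaleR_right integrable_norm)
  have "(\<lambda>x. indicator torus_box x *\<^sub>R f x) \<in> borel_measurable lborel"
    using assms(1) unfolding set_integrable_def by (rule borel_measurable_integrable)
  then have "(\<lambda>x. (indicator torus_box x *\<^sub>R f x) * g x) \<in> borel_measurable lborel"
    using assms(2) by measurable
  then have m: "(\<lambda>x. indicator torus_box x *\<^sub>R (f x * g x)) \<in> borel_measurable lborel" by simp
  have b: "norm (indicator torus_box x *\<^sub>R (f x * g x)) \<le> norm (C *\<^sub>R norm (indicator torus_box x *\<^sub>R f x))" for x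
    using assms(3)[of x] norm_ge_zero[of "g x"]
    by (auto simp: norm_mult indicator_def mult.commute[of C] intro!: mult_left_mono order_trans[OF _ abs_ge_self])
  show ?thesis unfolding set_integrable_def
    by (rule Bochner_Integration.integrable_bound[OF i m]) (intro always_eventually allI b)
qed

lemma cis_inner_measurable [measurable]: "(\<lambda>x::real^3. cis (k \<bullet> x)) \<in> borel_measurable borel"
  by (intro borel_measurable_continuous_onI continuous_intros)

lemma cis_inner_measurable' [measurable]: "(\<lambda>x::real^3. cis (- (k \<bullet> x))) \<in> borel_measurable borel"
  by (intro borel_measurable_continuous_onI continuous_intros)

lemma L2_field_component_integrable:
  assumes "L2_field f"
  shows "set_integrable lborel torus_box (\<lambda>x. f x $ i)"
  using integrable_inner_left[OF L2_field_integrable[OF assms, unfolded set_integrable_def], of "axis i 1"]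
  by (simp add: set_integrable_def inner_axis)

lemma integrable_fcoeff:
  assumes "set_integrable lborel torus_box f"
  shows "set_integrable lborel torus_box (\<lambda>x. of_real (f x) * cis (- (k \<bullet> x)))"
proof (rule set_integrable_mult_bounded[where C = 1])
  show "set_integrable lborel torus_box (\<lambda>x. complex_of_real (f x))"
    using integrable_of_real[OF assms[unfolded set_integrable_def], where 'a = complex]
    unfolding set_integrable_def by (simp add: scaleR_conv_of_real)
qed auto

lemma L2norm_nonneg [simp]: "0 \<le> L2norm f"
  unfolding L2norm_def set_lebesgue_integral_def by (intro real_sqrt_ge_zero Bochner_Integration.integral_nonneg) auto

text \<open>Cauchy--Schwarz against the constant function, via the pointwise bound
  |f| <= (c + |f|^2 / c) / 2 with the optimal c.\<close>
lemma norm_fcoeff_le: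
  assumes "L2_field f"
  shows "norm (fcoeff (\<lambda>x. f x $ i) k) \<le> sqrt ((2 * pi) ^ 3) * L2norm f"
proof -
  define V where "V = (2 * pi) ^ 3"
  define J where "J = (LINT x:torus_box|lborel. (norm (f x))\<^sup>2)"
  have V: "V > 0" by (simp add: V_def)
  have sq: "set_integrable lborel torus_box (\<lambda>x. (norm (f x))\<^sup>2)"
    using assms by (simp add: L2_field_def)
  have J0: "J \<ge> 0" unfolding J_def set_lebesgue_integral_def by (intro Bochner_Integration.integral_nonneg) auto
  have ni: "set_integrable lborel torus_box (\<lambda>x. norm (f x))"
    using integrable_norm[OF L2_field_integrable[OF assms, unfolded set_integrable_def]]
    by (simp add: set_integrable_def)
  define K where "K = (LINT x:torus_box|lborel. norm (f x))"
  have le: "K \<le> (c * V + J / c) / 2" if c: "c > 0" for c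
  proof -
    have one: "set_integrable lborel torus_box (\<lambda>x. c)"
      by (rule set_integrable_torus_bounded[where C = c]) (use c in auto)
    have "K \<le> (LINT x:torus_box|lborel. (c + (norm (f x))\<^sup>2 / c) / 2)"
      unfolding K_def
    proof (rule set_integral_mono[OF ni])
      show "set_integrable lborel torus_box (\<lambda>x. (c + (norm (f x))\<^sup>2 / c) / 2)"
        using one sq by (intro set_integrable_divide set_integral_add)
      fix x
      have "0 \<le> (c - norm (f x))\<^sup>2" by simp
      then show "norm (f x) \<le> (c + (norm (f x))\<^sup>2 / c) / 2"
        using c by (simp add: field_simps power2_eq_square)
    qed
    also have "\<dots> = ((LINT x:torus_box|lborel. c) + J / c) / 2"
      using one sq by (simp add: J_def set_integral_add)
    also have "(LINT x:torus_box|lborel. c) = c * V"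
      by (simp add: set_lebesgue_integral_def V_def measure_def emeasure_torus_box)
    finally show ?thesis by simp
  qed
  have "K \<le> sqrt V * sqrt J"
  proof (rule field_le_epsilon)
    fix e :: real assume e: "e > 0"
    \<comment> \<open>The optimal c is sqrt J / sqrt V, which is 0 when J = 0. Adding h keeps c
      positive, and h is scaled so that the loss is exactly e.\<close>
    define h where "h = e / sqrt V"
    have h: "h > 0" using e V by (simp add: h_def)
    define c where "c = (sqrt J + h) / sqrt V"
    have c: "c > 0" using h J0 V by (simp add: c_def add_nonneg_pos)
    have r: "sqrt V * sqrt V = V" "sqrt J * sqrt J = J" using V J0 by auto
    have sJ: "sqrt J \<ge> 0" "sqrt V > 0" using J0 V by auto
    have cV: "c * V = sqrt V * (sqrt J + h)"
      using r sJ by (simp add: c_def field_simps)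
    have "J / c = sqrt V * (sqrt J * sqrt J / (sqrt J + h))"
      using r sJ by (simp add: c_def field_simps)
    also have "\<dots> \<le> sqrt V * (sqrt J + h)"
    proof -
      have "sqrt J * sqrt J \<le> (sqrt J + h) * (sqrt J + h)"
        using sJ h by (intro mult_mono) auto
      then have "sqrt J * sqrt J / (sqrt J + h) \<le> sqrt J + h"
        using add_nonneg_pos[OF sJ(1) h] by (simp add: divide_le_eq)
      then show ?thesis using sJ by (intro mult_left_mono) auto
    qed
    finally have "K \<le> sqrt V * (sqrt J + h)" using le[OF c] cV by simp
    also have "\<dots> = sqrt V * sqrt J + e" using V by (simp add: h_def field_simps)
    finally show "K \<le> sqrt V * sqrt J + e" .
  qed
  moreover have "norm (fcoeff (\<lambda>x. f x $ i) k) \<le> K"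
  proof -
    have "norm (fcoeff (\<lambda>x. f x $ i) k) \<le> (LINT x:torus_box|lborel. norm (of_real (f x $ i) * cis (- (k \<bullet> x))))"
      unfolding fcoeff_def
      by (rule set_integral_norm_bound)
         (intro integrable_fcoeff L2_field_component_integrable assms)
    also have "\<dots> \<le> K" unfolding K_def
    proof (rule set_integral_mono[OF _ ni])
      show "set_integrable lborel torus_box (\<lambda>x. norm (complex_of_real (f x $ i) * cis (- (k \<bullet> x))))"
        using integrable_norm[OF integrable_fcoeff[OF L2_field_component_integrable[OF assms], unfolded set_integrable_def]]
        by (simp add: set_integrable_def norm_mult)
    qed (auto simp: norm_mult component_le_norm_cart)
    finally show ?thesis .
  qed
  ultimately show ?thesis by (simp add: V_def J_def L2norm_def)
qed

lemma L2_field_diff: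
  assumes "L2_field f" "L2_field g"
  shows "L2_field (\<lambda>x. f x - g x)"
  unfolding L2_field_def
proof (intro conjI)
  show "periodic3 (\<lambda>x. f x - g x)" using assms by (simp add: L2_field_def periodic3_def)
  have m: "f \<in> borel_measurable lborel" "g \<in> borel_measurable lborel" using assms by (auto simp: L2_field_def)
  then show d: "(\<lambda>x. f x - g x) \<in> borel_measurable lborel" by measurable
  show "set_integrable lborel torus_box (\<lambda>x. (norm (f x - g x))\<^sup>2)"
    unfolding set_integrable_def
  proof (rule Bochner_Integration.integrable_bound)
    have "set_integrable lborel torus_box (\<lambda>x. 2 * (norm (f x))\<^sup>2 + 2 * (norm (g x))\<^sup>2)"
      using assms by (intro set_integral_add set_integrable_mult_right) (auto simp: L2_field_def)
    then show "integrable lborel (\<lambda>x. indicator torus_box x *\<^sub>R (2 * (norm (f x))\<^sup>2 + 2 * (norm (g x))\<^sup>2))"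
      by (simp add: set_integrable_def)
    show "(\<lambda>x. indicator torus_box x *\<^sub>R (norm (f x - g x))\<^sup>2) \<in> borel_measurable lborel"
      using d by measurable
    have "(norm (f x - g x))\<^sup>2 \<le> 2 * (norm (f x))\<^sup>2 + 2 * (norm (g x))\<^sup>2" for x
    proof -
      have "(norm (f x - g x))\<^sup>2 \<le> (norm (f x) + norm (g x))\<^sup>2"
        by (intro power_mono norm_triangle_ineq4) auto
      also have "\<dots> \<le> 2 * (norm (f x))\<^sup>2 + 2 * (norm (g x))\<^sup>2"
        using zero_le_power2[of "norm (f x) - norm (g x)"] by (simp add: power2_eq_square algebra_simps)
      finally show ?thesis .
    qed
    then show "AE x in lborel. norm (indicator torus_box x *\<^sub>R (norm (f x - g x))\<^sup>2)
       \<le> norm (indicator torus_box x *\<^sub>R (2 * (norm (f x))\<^sup>2 + 2 * (norm (g x))\<^sup>2))"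
      by (auto simp: indicator_def)
  qed
qed

section \<open>The weak formulation in Fourier space\<close>

text \<open>Waves in the three coordinate directions; divergence-free when A l and S l are orthogonal to axis l.\<close>

definition shear_vel :: "real \<Rightarrow> (3 \<Rightarrow> real^3) \<Rightarrow> (3 \<Rightarrow> real^3) \<Rightarrow> real^3 \<Rightarrow> real^3" where
  "shear_vel q A S x = (\<Sum>l\<in>UNIV. cos (q * x $ l) *\<^sub>R A l + sin (q * x $ l) *\<^sub>R S l)"

text \<open>The coefficient (A - i S)/2 of e^(i q x_l) in the wave cos(q x_l) A + sin(q x_l) S; the
  conjugate belongs to e^(-i q x_l).\<close>

definition fourier_amp :: "(3 \<Rightarrow> real^3) \<Rightarrow> (3 \<Rightarrow> real^3) \<Rightarrow> 3 \<Rightarrow> 3 \<Rightarrow> complex" where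
  "fourier_amp A S l j = Complex (A l $ j / 2) (- (S l $ j) / 2)"

definition shift :: "real \<Rightarrow> 3 \<Rightarrow> real^3" where
  "shift q l = q *\<^sub>R axis l 1"

text \<open>The coefficient at k of curl(u \<times> B) = - sum_j d_j (u_j B_i - B_j u_i). Since u
  consists of the modes +- q e_l, the convolution is a finite sum over the neighbours of k.\<close>

definition induction_term :: "real \<Rightarrow> (3 \<Rightarrow> real^3) \<Rightarrow> (3 \<Rightarrow> real^3) \<Rightarrow> (real^3 \<Rightarrow> 3 \<Rightarrow> complex) \<Rightarrow> real^3 \<Rightarrow> 3 \<Rightarrow> complex" where
  "induction_term q A S c k i = - \<i> * (\<Sum>l\<in>UNIV. \<Sum>j\<in>UNIV. of_real (k $ j) *
      (fourier_amp A S l j * c (k - shift q l) i - fourier_amp A S l i * c (k - shift q l) j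
       + (cnj (fourier_amp A S l j) * c (k + shift q l) i - cnj (fourier_amp A S l i) * c (k + shift q l) j)))"

lemma shear_vel_fourier:
  "of_real (shear_vel q A S x $ j) * cis (- (k \<bullet> x)) =
     (\<Sum>l\<in>UNIV. fourier_amp A S l j * cis (- ((k - shift q l) \<bullet> x)) + cnj (fourier_amp A S l j) * cis (- ((k + shift q l) \<bullet> x)))"
proof -
  have "of_real (cos (q * x $ l) * A l $ j + sin (q * x $ l) * S l $ j) * cis (- (k \<bullet> x)) =
     fourier_amp A S l j * cis (- ((k - shift q l) \<bullet> x)) + cnj (fourier_amp A S l j) * cis (- ((k + shift q l) \<bullet> x))" for l
  proof -
    have "(shift q l) \<bullet> x = q * x $ l" by (simp add: shift_def inner_axis')
    then have e: "cis (- ((k - shift q l) \<bullet> x)) = cis (q * x $ l) * cis (- (k \<bullet> x))"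
      "cis (- ((k + shift q l) \<bullet> x)) = cis (- (q * x $ l)) * cis (- (k \<bullet> x))"
      by (simp_all add: cis_mult inner_diff_left inner_add_left algebra_simps)
    have "of_real (cos (q * x $ l) * A l $ j + sin (q * x $ l) * S l $ j) =
      fourier_amp A S l j * cis (q * x $ l) + cnj (fourier_amp A S l j) * cis (- (q * x $ l))"
      by (simp add: fourier_amp_def complex_eq_iff field_simps)
    then show ?thesis unfolding e by (simp add: algebra_simps)
  qed
  then show ?thesis
    by (simp add: shear_vel_def sum_distrib_right)
qed

lemma has_bochner_integral_fcoeff:
  assumes "L2_field f"
  shows "has_bochner_integral lborel
     (\<lambda>x. indicator torus_box x *\<^sub>R (of_real (f x $ i) * cis (- (k \<bullet> x)))) (fcoeff (\<lambda>x. f x $ i) k)"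
  using integrable_fcoeff[OF L2_field_component_integrable[OF assms], of i k]
  unfolding set_integrable_def fcoeff_def set_lebesgue_integral_def has_bochner_integral_iff by simp

text \<open>As f and a are real, cos(k.x + \<theta>) = Re (e^(-i \<theta>) e^(-i k.x)) extracts the
  real part of a rotated coefficient. Letting \<theta> vary recovers the complex
  coefficient.\<close>

lemma test_fcoeff:
  assumes "L2_field f"
  shows "(LINT x:torus_box|lborel. f x \<bullet> (cos (k \<bullet> x + \<theta>) *\<^sub>R a)) =
     Re (cis (- \<theta>) * (\<Sum>i\<in>UNIV. of_real (a $ i) * fcoeff (\<lambda>x. f x $ i) k))"
proof -
  define G where "G i x = indicator torus_box x *\<^sub>R (of_real (f x $ i) * cis (- (k \<bullet> x)))" for i x
  have "has_bochner_integral lborel (\<lambda>x. Re (cis (- \<theta>) * (\<Sum>i\<in>UNIV. of_real (a $ i) * G i x)))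
     (Re (cis (- \<theta>) * (\<Sum>i\<in>UNIV. of_real (a $ i) * fcoeff (\<lambda>x. f x $ i) k)))"
    unfolding G_def
    by (intro has_bochner_integral_Re has_bochner_integral_mult_right has_bochner_integral_sum
        has_bochner_integral_fcoeff assms)
  moreover have "Re (cis (- \<theta>) * (\<Sum>i\<in>UNIV. of_real (a $ i) * G i x)) =
     indicator torus_box x *\<^sub>R (f x \<bullet> (cos (k \<bullet> x + \<theta>) *\<^sub>R a))" for x
  proof (cases "x \<in> torus_box")
    case True
    have "(\<Sum>i\<in>UNIV. of_real (a $ i) * G i x) = of_real (f x \<bullet> a) * cis (- (k \<bullet> x))"
      using True by (simp add: G_def inner_vec_def[of "f x"] sum_3 algebra_simps)
    then have "cis (- \<theta>) * (\<Sum>i\<in>UNIV. of_real (a $ i) * G i x) =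
      of_real (f x \<bullet> a) * (cis (- \<theta>) * cis (- (k \<bullet> x)))"
      by (simp only: mult.left_commute)
    also have "cis (- \<theta>) * cis (- (k \<bullet> x)) = cis (- (k \<bullet> x + \<theta>))"
      unfolding cis_mult by (rule arg_cong[where f = cis]) simp
    finally have "cis (- \<theta>) * (\<Sum>i\<in>UNIV. of_real (a $ i) * G i x) =
      of_real (f x \<bullet> a) * cis (- (k \<bullet> x + \<theta>))" .
    then show ?thesis using True by (simp del: minus_add_distrib)
  qed (simp add: G_def)
  ultimately show ?thesis
    unfolding set_lebesgue_integral_def by (simp add: has_bochner_integral_iff)
qed

definition field_coeffs :: "(real \<Rightarrow> real^3 \<Rightarrow> real^3) \<Rightarrow> real \<Rightarrow> real^3 \<Rightarrow> 3 \<Rightarrow> complex" where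
  "field_coeffs B t k i = fcoeff (\<lambda>x. B t x $ i) k"

definition mode_rhs :: "real \<Rightarrow> real \<Rightarrow> (3 \<Rightarrow> real^3) \<Rightarrow> (3 \<Rightarrow> real^3) \<Rightarrow> (real^3 \<Rightarrow> 3 \<Rightarrow> complex) \<Rightarrow> real^3 \<Rightarrow> 3 \<Rightarrow> complex" where
  "mode_rhs \<epsilon> q A S c k i = induction_term q A S c k i - of_real (\<epsilon> * (norm k)\<^sup>2) * c k i"

text \<open>\<open>mode_rhs\<close> is linear in the coefficients, so it may be applied to the
  integrands G i k x before integrating. What remains is a pointwise identity, in which
  \<open>shear_vel_fourier\<close> turns the shifted phase factors back into a product with the
  velocity.\<close>

lemma dynamo_flux_eq:
  assumes L: "L2_field (B s)" and u: "u s = shear_vel q A S"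
  shows "dynamo_flux u \<epsilon> B k a \<theta> s = Re (cis (- \<theta>) * (\<Sum>i\<in>UNIV. of_real (a $ i) * mode_rhs \<epsilon> q A S (field_coeffs B s) k i))"
proof -
  define G where "G i k x = indicator torus_box x *\<^sub>R (of_real (B s x $ i) * cis (- (k \<bullet> x)))" for i k x
  have *: "has_bochner_integral lborel (G i k) (field_coeffs B s k i)" for i k
    unfolding G_def field_coeffs_def by (rule has_bochner_integral_fcoeff[OF L])
  have "has_bochner_integral lborel (\<lambda>x. Re (cis (- \<theta>) * (\<Sum>i\<in>UNIV. of_real (a $ i) * mode_rhs \<epsilon> q A S (\<lambda>k i. G i k x) k i)))
     (Re (cis (- \<theta>) * (\<Sum>i\<in>UNIV. of_real (a $ i) * mode_rhs \<epsilon> q A S (field_coeffs B s) k i)))"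
    unfolding mode_rhs_def induction_term_def
    by (intro has_bochner_integral_Re has_bochner_integral_mult_right has_bochner_integral_sum
        has_bochner_integral_diff has_bochner_integral_add *)
  moreover have "Re (cis (- \<theta>) * (\<Sum>i\<in>UNIV. of_real (a $ i) * mode_rhs \<epsilon> q A S (\<lambda>k i. G i k x) k i)) =
     indicator torus_box x *\<^sub>R ((\<Sum>i\<in>UNIV. \<Sum>j\<in>UNIV. (u s x $ j * B s x $ i - B s x $ j * u s x $ i)
              * (- a $ i * k $ j * sin (k \<bullet> x + \<theta>)))
        + \<epsilon> * (B s x \<bullet> ((- (norm k)\<^sup>2 * cos (k \<bullet> x + \<theta>)) *\<^sub>R a)))" for x
  proof (cases "x \<in> torus_box")
    case True
    define b where "b = B s x"
    define v where "v = u s x"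
    define e where "e = cis (- (k \<bullet> x))"
    have Ge: "G i k x = of_real (b $ i) * cis (- (k \<bullet> x))" for i k
      using True by (simp add: G_def b_def)
    have "(\<Sum>l\<in>UNIV. (fourier_amp A S l j * G i (k - shift q l) x + cnj (fourier_amp A S l j) * G i (k + shift q l) x))
      = of_real (v $ j) * of_real (b $ i) * e" for i j
    proof -
      have "of_real (v $ j) * of_real (b $ i) * e = of_real (b $ i) * (of_real (shear_vel q A S x $ j) * cis (- (k \<bullet> x)))"
        by (simp add: v_def u e_def)
      also have "\<dots> = (\<Sum>l\<in>UNIV. of_real (b $ i) * (fourier_amp A S l j * cis (- ((k - shift q l) \<bullet> x)) + cnj (fourier_amp A S l j) * cis (- ((k + shift q l) \<bullet> x))))"
        unfolding shear_vel_fourier by (rule sum_distrib_left)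
      finally show ?thesis by (simp add: Ge algebra_simps)
    qed
    note aux = this
    have "induction_term q A S (\<lambda>k i. G i k x) k i = - \<i> * (\<Sum>j\<in>UNIV. of_real (k $ j) *
       ((\<Sum>l\<in>UNIV. (fourier_amp A S l j * G i (k - shift q l) x + cnj (fourier_amp A S l j) * G i (k + shift q l) x))
        - (\<Sum>l\<in>UNIV. (fourier_amp A S l i * G j (k - shift q l) x + cnj (fourier_amp A S l i) * G j (k + shift q l) x))))" for i
      unfolding induction_term_def
      by (subst sum.swap, rule arg_cong[where f = "\<lambda>z. - \<i> * z"], rule sum.cong[OF refl])
         (simp only: sum_distrib_left[symmetric] sum_subtractf[symmetric] add_diff_add diff_diff_add)
    then have it: "induction_term q A S (\<lambda>k i. G i k x) k i = - \<i> * (\<Sum>j\<in>UNIV. of_real (k $ j * (v $ j * b $ i - b $ j * v $ i))) * e" for i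
      unfolding aux by (simp add: sum_3 algebra_simps)
    have ce: "cis (- \<theta>) * e = cis (- (k \<bullet> x + \<theta>))"
      unfolding e_def cis_mult by (rule arg_cong[where f = cis]) simp
    define P where "P = (\<Sum>i\<in>UNIV. a $ i * (\<Sum>j\<in>UNIV. k $ j * (v $ j * b $ i - b $ j * v $ i)))"
    have "cis (- \<theta>) * (\<Sum>i\<in>UNIV. of_real (a $ i) * mode_rhs \<epsilon> q A S (\<lambda>k i. G i k x) k i) =
      (- \<i> * of_real P - of_real (\<epsilon> * (norm k)\<^sup>2 * (b \<bullet> a))) * (cis (- \<theta>) * e)"
      unfolding mode_rhs_def it
      unfolding Ge e_def[symmetric] P_def inner_vec_def[of b]
      by (simp add: sum_3 algebra_simps)
    also have "Re \<dots> = - P * sin (k \<bullet> x + \<theta>) - \<epsilon> * (norm k)\<^sup>2 * (b \<bullet> a) * cos (k \<bullet> x + \<theta>)"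
      unfolding ce by (simp del: minus_add_distrib)
    also have "- P * sin (k \<bullet> x + \<theta>) = (\<Sum>i\<in>UNIV. \<Sum>j\<in>UNIV. (v $ j * b $ i - b $ j * v $ i)
              * (- a $ i * k $ j * sin (k \<bullet> x + \<theta>)))"
      unfolding P_def by (simp add: sum_3 algebra_simps)
    finally show ?thesis using True by (simp add: b_def v_def)
  qed (simp add: G_def mode_rhs_def induction_term_def)
  ultimately show ?thesis
    unfolding set_lebesgue_integral_def dynamo_flux_def by (simp add: has_bochner_integral_iff)
qed

lemma complex_integral_eqI:
  assumes "set_integrable lborel I (\<lambda>s. Re (g s))" "set_integrable lborel I (\<lambda>s. Im (g s))"
  shows "set_integrable lborel I g" 
    "Re (LINT s:I|lborel. g s) = (LINT s:I|lborel. Re (g s))"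
    "Im (LINT s:I|lborel. g s) = (LINT s:I|lborel. Im (g s))"
proof -
  have "integrable lborel (\<lambda>s. of_real (indicator I s *\<^sub>R Re (g s)) + \<i> * of_real (indicator I s *\<^sub>R Im (g s)))"
    using assms unfolding set_integrable_def
    by (intro Bochner_Integration.integrable_add integrable_mult_right integrable_of_real)
  moreover have "of_real (indicator I s *\<^sub>R Re (g s)) + \<i> * of_real (indicator I s *\<^sub>R Im (g s)) = indicator I s *\<^sub>R g s" for s
    by (simp add: complex_eq_iff)
  ultimately show 1: "set_integrable lborel I g" by (simp add: set_integrable_def)
  show "Re (LINT s:I|lborel. g s) = (LINT s:I|lborel. Re (g s))"
    "Im (LINT s:I|lborel. g s) = (LINT s:I|lborel. Im (g s))"
    using integral_Re[OF 1[unfolded set_integrable_def]] integral_Im[OF 1[unfolded set_integrable_def]]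
    unfolding set_lebesgue_integral_def by simp_all
qed

text \<open>A coordinate vector for a isolates one component; the phases \<theta> = 0 and \<theta> =
  pi/2 give the real and imaginary parts of its equation, and likewise integrability in
  time.\<close>

lemma weak_form_imp_coeff:
  assumes L: "\<And>s. s \<in> {0..t} \<Longrightarrow> L2_field (B s)" and L0: "L2_field B0" and t: "t \<ge> 0"
    and u: "\<And>s. u s = shear_vel (q s) (A s) (S s)"
    and weak: "\<And>a \<theta>. set_integrable lborel {0..t} (dynamo_flux u \<epsilon> B k a \<theta>) \<and>
        (LINT x:torus_box|lborel. B t x \<bullet> (cos (k \<bullet> x + \<theta>) *\<^sub>R a))
          - (LINT x:torus_box|lborel. B0 x \<bullet> (cos (k \<bullet> x + \<theta>) *\<^sub>R a))
        = (LINT s:{0..t}|lborel. dynamo_flux u \<epsilon> B k a \<theta> s)"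
  shows "set_integrable lborel {0..t} (\<lambda>s. mode_rhs \<epsilon> (q s) (A s) (S s) (field_coeffs B s) k i)"
    and "field_coeffs B t k i - fcoeff (\<lambda>x. B0 x $ i) k = (LINT s:{0..t}|lborel. mode_rhs \<epsilon> (q s) (A s) (S s) (field_coeffs B s) k i)"
proof -
  let ?R = "\<lambda>s. mode_rhs \<epsilon> (q s) (A s) (S s) (field_coeffs B s) k i"
  have fl: "dynamo_flux u \<epsilon> B k (axis i 1) \<theta> s = Re (cis (- \<theta>) * ?R s)" if "s \<in> {0..t}" for \<theta> s
    unfolding dynamo_flux_eq[where B = B and s = s, OF L[OF that] u] by (simp add: axis_def if_distrib if_distribR cong: if_cong)
  have te: "(LINT x:torus_box|lborel. f x \<bullet> (cos (k \<bullet> x + \<theta>) *\<^sub>R axis i 1)) = Re (cis (- \<theta>) * fcoeff (\<lambda>x. f x $ i) k)"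
    if "L2_field f" for f \<theta>
    unfolding test_fcoeff[OF that] by (simp add: axis_def if_distrib if_distribR cong: if_cong)
  have LB: "L2_field (B t)" using L t by simp
  have A: "set_integrable lborel {0..t} (\<lambda>s. Re (cis (- \<theta>) * ?R s))" 
    and B: "Re (cis (- \<theta>) * (field_coeffs B t k i - fcoeff (\<lambda>x. B0 x $ i) k)) = (LINT s:{0..t}|lborel. Re (cis (- \<theta>) * ?R s))" for \<theta>
  proof -
    have "set_integrable lborel {0..t} (dynamo_flux u \<epsilon> B k (axis i 1) \<theta>)" using weak by blast
    then show "set_integrable lborel {0..t} (\<lambda>s. Re (cis (- \<theta>) * ?R s))"
      by (rule set_integrable_cong[THEN iffD1, rotated -1]) (use fl in auto)
    have "(LINT s:{0..t}|lborel. dynamo_flux u \<epsilon> B k (axis i 1) \<theta> s) = (LINT s:{0..t}|lborel. Re (cis (- \<theta>) * ?R s))"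
      by (rule set_lebesgue_integral_cong) (use fl in auto)
    then show "Re (cis (- \<theta>) * (field_coeffs B t k i - fcoeff (\<lambda>x. B0 x $ i) k)) = (LINT s:{0..t}|lborel. Re (cis (- \<theta>) * ?R s))"
      using weak[of "axis i 1" \<theta>] unfolding te[OF LB] te[OF L0] by (simp add: field_coeffs_def right_diff_distrib)
  qed
  have re: "set_integrable lborel {0..t} (\<lambda>s. Re (?R s))" using A[of 0] by simp
  have cis_q: "cis (- (pi / 2)) = - \<i>" by (simp add: complex_eq_iff)
  have im: "set_integrable lborel {0..t} (\<lambda>s. Im (?R s))" using A[of "pi / 2"] by (simp add: cis_q)
  show "set_integrable lborel {0..t} ?R" using complex_integral_eqI(1)[OF re im] .
  show "field_coeffs B t k i - fcoeff (\<lambda>x. B0 x $ i) k = (LINT s:{0..t}|lborel. ?R s)"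
  proof (rule complex_eqI)
    show "Re (field_coeffs B t k i - fcoeff (\<lambda>x. B0 x $ i) k) = Re (LINT s:{0..t}|lborel. ?R s)"
      unfolding complex_integral_eqI(2)[OF re im] using B[of 0] by simp
    show "Im (field_coeffs B t k i - fcoeff (\<lambda>x. B0 x $ i) k) = Im (LINT s:{0..t}|lborel. ?R s)"
      unfolding complex_integral_eqI(3)[OF re im] using B[of "pi / 2"] by (simp add: cis_q)
  qed
qed

text \<open>The tested identity is the real part of a linear combination of the coefficient
  equations, with weights a_i e^(-i \<theta>).\<close>

lemma coeff_imp_weak_form:
  assumes L: "\<And>s. s \<in> {0..t} \<Longrightarrow> L2_field (B s)" and L0: "L2_field B0" and t: "t \<ge> 0"
    and u: "\<And>s. u s = shear_vel (q s) (A s) (S s)"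
    and int: "\<And>i. set_integrable lborel {0..t} (\<lambda>s. mode_rhs \<epsilon> (q s) (A s) (S s) (field_coeffs B s) k i)"
    and eq: "\<And>i. field_coeffs B t k i - fcoeff (\<lambda>x. B0 x $ i) k = (LINT s:{0..t}|lborel. mode_rhs \<epsilon> (q s) (A s) (S s) (field_coeffs B s) k i)"
  shows "set_integrable lborel {0..t} (dynamo_flux u \<epsilon> B k a \<theta>) \<and>
        (LINT x:torus_box|lborel. B t x \<bullet> (cos (k \<bullet> x + \<theta>) *\<^sub>R a))
          - (LINT x:torus_box|lborel. B0 x \<bullet> (cos (k \<bullet> x + \<theta>) *\<^sub>R a))
        = (LINT s:{0..t}|lborel. dynamo_flux u \<epsilon> B k a \<theta> s)"
proof -
  let ?R = "\<lambda>i s. mode_rhs \<epsilon> (q s) (A s) (S s) (field_coeffs B s) k i"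
  have fl: "dynamo_flux u \<epsilon> B k a \<theta> s = Re (cis (- \<theta>) * (\<Sum>i\<in>UNIV. of_real (a $ i) * ?R i s))" if "s \<in> {0..t}" for s
    by (rule dynamo_flux_eq[where B = B and s = s, OF L[OF that] u])
  have hb: "has_bochner_integral lborel (\<lambda>s. indicator {0..t} s *\<^sub>R ?R i s) (field_coeffs B t k i - fcoeff (\<lambda>x. B0 x $ i) k)" for i
    using int[of i] eq[of i] by (simp add: has_bochner_integral_iff set_integrable_def set_lebesgue_integral_def)
  have "has_bochner_integral lborel (\<lambda>s. Re (cis (- \<theta>) * (\<Sum>i\<in>UNIV. of_real (a $ i) * (indicator {0..t} s *\<^sub>R ?R i s))))
     (Re (cis (- \<theta>) * (\<Sum>i\<in>UNIV. of_real (a $ i) * (field_coeffs B t k i - fcoeff (\<lambda>x. B0 x $ i) k))))"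
    by (intro has_bochner_integral_Re has_bochner_integral_mult_right has_bochner_integral_sum hb)
  moreover have "Re (cis (- \<theta>) * (\<Sum>i\<in>UNIV. of_real (a $ i) * (indicator {0..t} s *\<^sub>R ?R i s))) =
     indicator {0..t} s *\<^sub>R dynamo_flux u \<epsilon> B k a \<theta> s" for s
    by (cases "s \<in> {0..t}") (use fl in simp_all)
  moreover have "L2_field (B t)" using L t by simp
  ultimately show ?thesis
    unfolding test_fcoeff[OF L0] test_fcoeff[OF \<open>L2_field (B t)\<close>]
    by (simp add: has_bochner_integral_iff set_integrable_def set_lebesgue_integral_def field_coeffs_def sum_subtractf algebra_simps)
qed

section \<open>Linear ODE estimates and the fluctuations\<close>

text \<open>Variation of constants for y' = \<nu> y + f, covering growth and decay alike: (exp(\<nu>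
  (t - a)) - 1) / \<nu> is the integral of the propagator and is nonnegative for either sign of
  \<nu>.\<close>

lemma linear_ode_bound:
  fixes y :: "real \<Rightarrow> complex"
  assumes y: "\<And>s. s \<in> {a..b} \<Longrightarrow> (y has_vector_derivative (of_real \<nu> * y s + f s)) (at s within {a..b})"
    and f: "\<And>s. s \<in> {a..b} \<Longrightarrow> norm (f s) \<le> G" and "\<nu> \<noteq> 0" and t: "t \<in> {a..b}"
  shows "norm (y t - of_real (exp (\<nu> * (t - a))) * y a) \<le> G * ((exp (\<nu> * (t - a)) - 1) / \<nu>)"
proof (cases "a < t")
  case False
  then show ?thesis using t by auto
next
  case True
  \<comment> \<open>Integrating factor: z' = exp(-\<nu> (s - a)) f, whose norm is dominated by the
    derivative of \<phi>.\<close>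
  define z where "z s = exp (- \<nu> * (s - a)) *\<^sub>R y s" for s
  define \<phi> where "\<phi> s = - (G / \<nu>) * exp (- \<nu> * (s - a))" for s
  have sub: "{a..t} \<subseteq> {a..b}" using t by auto
  have zd: "(z has_vector_derivative exp (- \<nu> * (s - a)) *\<^sub>R f s) (at s within {a..b})" if "s \<in> {a..b}" for s
    unfolding z_def
    by (rule derivative_eq_intros y[OF that] refl)+ (simp add: scaleR_conv_of_real algebra_simps)
  have "norm (z t - z a) \<le> \<phi> t - \<phi> a"
  proof (rule differentiable_bound_general[OF True, where f' = "\<lambda>s. exp (- \<nu> * (s - a)) *\<^sub>R f s" and \<phi>' = "\<lambda>s. G * exp (- \<nu> * (s - a))"])
    show "continuous_on {a..t} z"
      using zd sub by (meson continuous_on_subset continuous_on_vector_derivative)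
    show "continuous_on {a..t} \<phi>" unfolding \<phi>_def by (intro continuous_intros)
    fix s assume s: "a < s" "s < t"
    then have "at s within {a..b} = at s" using t by (simp add: at_within_Icc_at)
    then show "(z has_vector_derivative exp (- \<nu> * (s - a)) *\<^sub>R f s) (at s)"
      using zd[of s] s t by simp
    show "(\<phi> has_vector_derivative G * exp (- \<nu> * (s - a))) (at s)"
      unfolding \<phi>_def has_real_derivative_iff_has_vector_derivative[symmetric]
      using \<open>\<nu> \<noteq> 0\<close> by (auto intro!: derivative_eq_intros)
    show "norm (exp (- \<nu> * (s - a)) *\<^sub>R f s) \<le> G * exp (- \<nu> * (s - a))"
      using f[of s] s t by simp
  qed
  then have *: "norm (exp (- \<nu> * (t - a)) *\<^sub>R y t - y a) \<le> (G / \<nu>) * (1 - exp (- \<nu> * (t - a)))"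
    by (simp add: z_def \<phi>_def algebra_simps)
  have ee: "exp (\<nu> * (t - a)) * exp (- \<nu> * (t - a)) = 1"
    by (simp add: exp_add[symmetric])
  have "y t - of_real (exp (\<nu> * (t - a))) * y a = exp (\<nu> * (t - a)) *\<^sub>R (exp (- \<nu> * (t - a)) *\<^sub>R y t - y a)"
    unfolding scaleR_diff_right scaleR_scaleR ee by (simp add: scaleR_conv_of_real)
  then have "norm (y t - of_real (exp (\<nu> * (t - a))) * y a) = exp (\<nu> * (t - a)) * norm (exp (- \<nu> * (t - a)) *\<^sub>R y t - y a)"
    by simp
  also have "\<dots> \<le> exp (\<nu> * (t - a)) * ((G / \<nu>) * (1 - exp (- \<nu> * (t - a))))"
    by (intro mult_left_mono *) simp
  also have "\<dots> = (G / \<nu>) * (exp (\<nu> * (t - a)) - exp (\<nu> * (t - a)) * exp (- \<nu> * (t - a)))"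
    by (simp add: algebra_simps)
  also have "\<dots> = G * ((exp (\<nu> * (t - a)) - 1) / \<nu>)" unfolding ee by simp
  finally show ?thesis .
qed

text \<open>With E = exp(-l (t - a)), the value y(t) lies within (1 - E) g of E y(a), so |y(t)| is
  at most a convex combination of |y(a)| and g. The bound is uniform in l; forcing proportional to l
  can therefore be absorbed mode by mode.\<close>

lemma damped_ode_max:
  fixes y :: "real \<Rightarrow> complex"
  assumes y: "\<And>s. s \<in> {a..b} \<Longrightarrow> (y has_vector_derivative (f s - of_real l * y s)) (at s within {a..b})"
    and f: "\<And>s. s \<in> {a..b} \<Longrightarrow> norm (f s) \<le> l * g" and "l > 0" and t: "t \<in> {a..b}"
  shows "norm (y t) \<le> max (norm (y a)) g"
proof -
  define E where "E = exp (- l * (t - a))"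
  have E: "0 \<le> E" "E \<le> 1" using t \<open>l > 0\<close> by (auto simp: E_def)
  have "norm (y t - of_real (exp (- l * (t - a))) * y a) \<le> (l * g) * ((exp (- l * (t - a)) - 1) / (- l))"
    by (rule linear_ode_bound[where f = f and b = b]) (use assms in \<open>auto simp: algebra_simps\<close>)
  also have "\<dots> = g * (1 - E)" using \<open>l > 0\<close> by (simp add: E_def field_simps)
  finally have "norm (y t) \<le> norm (of_real E * y a) + g * (1 - E)"
    using norm_triangle_ineq2[of "y t" "of_real E * y a"] by (simp add: E_def)
  also have "\<dots> = E * norm (y a) + (1 - E) * g" using E by (simp add: norm_mult)
  also have "\<dots> \<le> max (norm (y a)) g"
    using E by (intro convex_bound_le) auto
  finally show ?thesis .
qed

text \<open>This takes the place of Gronwall for an infinite system. If every bound C improves to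
  max X (C / 2), the supremum s satisfies s \<le> max X (s / 2), hence s \<le> X. The a priori bound
  M makes s finite, and its size does not enter the conclusion.\<close>

lemma sup_absorb:
  fixes h :: "'z \<Rightarrow> real"
  assumes bdd: "\<And>z. z \<in> Z \<Longrightarrow> h z \<le> M"
    and step: "\<And>C z. 0 \<le> C \<Longrightarrow> (\<And>z. z \<in> Z \<Longrightarrow> h z \<le> C) \<Longrightarrow> z \<in> Z \<Longrightarrow> h z \<le> max X (C / 2)"
    and "z \<in> Z" and nn: "\<And>z. z \<in> Z \<Longrightarrow> 0 \<le> h z" and "0 \<le> X"
  shows "h z \<le> X"
proof -
  define s where "s = Sup (h ` Z)"
  have le: "h z \<le> s" if "z \<in> Z" for z
    unfolding s_def using that bdd by (intro cSup_upper bdd_aboveI2) auto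
  have "s \<ge> 0" using le[OF \<open>z \<in> Z\<close>] nn[OF \<open>z \<in> Z\<close>] by simp
  have "s \<le> max X (s / 2)"
    unfolding s_def
  proof (rule cSup_least)
    show "h ` Z \<noteq> {}" using \<open>z \<in> Z\<close> by auto
    fix x assume "x \<in> h ` Z"
    then show "x \<le> max X (Sup (h ` Z) / 2)"
      using step[OF \<open>s \<ge> 0\<close> le] by (auto simp: s_def)
  qed
  then have "s \<le> X" using \<open>0 \<le> X\<close> \<open>s \<ge> 0\<close> by (auto simp: max_def split: if_splits)
  then show ?thesis using le[OF \<open>z \<in> Z\<close>] by simp
qed

text \<open>The amplitude of the cellular flow, and the ratio of its length scale to that of the mean field.
  The alpha effect wins over diffusion of the mean field because kap is small compared with del^2.\<close>

definition del :: real where "del = 1 / 10000"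
definition kap :: real where "kap = del\<^sup>2 / 16"

lemma del_bounds: "0 < del" "del \<le> 1 / 10000" by (auto simp: del_def)
lemma kap_bounds: "0 < kap" "kap \<le> 1 / 1000000000" by (auto simp: kap_def del_def power2_eq_square)

section \<open>The Roberts flow in Fourier space and its alpha effect\<close>

definition helical_x :: "3 \<Rightarrow> complex" where
  "helical_x j = (if j = 1 then 0 else if j = 2 then 1 / 2 else \<i> / 2)"
text \<open>\<open>helical_x\<close> and \<open>helical_y\<close> are the amplitudes of (0, cos x,
  -sin x) and (cos y, 0, sin y). Each of these waves equals its own curl, so both have the same
  handedness; this helicity is what produces the alpha effect.\<close>

definition helical_y :: "3 \<Rightarrow> complex" where
  "helical_y j = (if j = 1 then 1 / 2 else if j = 2 then 0 else - \<i> / 2)"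

lemma helical_simps [simp]:
  "helical_x 1 = 0" "helical_x 2 = 1 / 2" "helical_x 3 = \<i> / 2" "helical_y 1 = 1 / 2" "helical_y 2 = 0" "helical_y 3 = - \<i> / 2"
  by (auto simp: helical_x_def helical_y_def)

lemma norm_helical: "norm (helical_x j) \<le> 1 / 2" "norm (helical_y j) \<le> 1 / 2"
  by (auto simp: helical_x_def helical_y_def norm_divide)

text \<open>Modes of the cell are indexed by integers p, q and have wave vector m (p, q, kap).\<close>

definition wavevec :: "int \<Rightarrow> int \<Rightarrow> 3 \<Rightarrow> real" where
  "wavevec p q j = (if j = 1 then of_int p else if j = 2 then of_int q else kap)"

lemma wavevec_simps [simp]: "wavevec p q 1 = of_int p" "wavevec p q 2 = of_int q" "wavevec p q 3 = kap"
  by (auto simp: wavevec_def)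

text \<open>The triple product x \<times> (w \<times> v), expanded. Multiplied by -i it is the
  symbol of curl(v \<times> w) at wave vector x, for a velocity mode v and a field mode w.\<close>

definition cross_term :: "(3 \<Rightarrow> real) \<Rightarrow> (3 \<Rightarrow> complex) \<Rightarrow> (3 \<Rightarrow> complex) \<Rightarrow> 3 \<Rightarrow> complex" where
  "cross_term x v w i = (\<Sum>j\<in>UNIV. of_real (x j) * (v j * w i - v i * w j))"

lemma norm_cross_term:
  assumes v: "\<And>j. norm (v j) \<le> 1 / 2" and w: "\<And>j. norm (w j) \<le> X"
  shows "norm (cross_term x v w i) \<le> (\<bar>x 1\<bar> + \<bar>x 2\<bar> + \<bar>x 3\<bar>) * X"
proof -
  have "X \<ge> 0" using w[of 1] norm_ge_zero[of "w 1"] by linarith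
  have "norm (v j * w i - v i * w j) \<le> X" for j
  proof -
    have "norm (v j * w i - v i * w j) \<le> norm (v j) * norm (w i) + norm (v i) * norm (w j)"
      using norm_triangle_ineq4[of "v j * w i" "v i * w j"] by (simp add: norm_mult)
    also have "\<dots> \<le> 1 / 2 * X + 1 / 2 * X"
      by (intro add_mono mult_mono v w) auto
    finally show ?thesis by simp
  qed
  then have "norm (cross_term x v w i) \<le> (\<Sum>j\<in>UNIV. \<bar>x j\<bar> * X)"
    unfolding cross_term_def by (intro sum_norm_le) (auto simp: norm_mult intro: mult_left_mono)
  also have "\<dots> = (\<bar>x 1\<bar> + \<bar>x 2\<bar> + \<bar>x 3\<bar>) * X"
    by (simp add: sum_3 algebra_simps)
  finally show ?thesis .
qed

text \<open>The wave number m from the derivative and the amplitude \<open>del\<close> / m multiply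
  to \<open>del\<close>, so the scale has disappeared; \<open>phase_rhs_Dyn\<close> makes the
  link.\<close>

definition cell_induction :: "(int \<Rightarrow> int \<Rightarrow> 3 \<Rightarrow> complex) \<Rightarrow> int \<Rightarrow> int \<Rightarrow> 3 \<Rightarrow> complex" where
  "cell_induction D p q i = - \<i> * of_real del *
     (cross_term (wavevec p q) helical_x (D (p - 1) q) i + cross_term (wavevec p q) (\<lambda>j. cnj (helical_x j)) (D (p + 1) q) i
      + cross_term (wavevec p q) helical_y (D p (q - 1)) i + cross_term (wavevec p q) (\<lambda>j. cnj (helical_y j)) (D p (q + 1)) i)"

lemma norm_add4_le:
  fixes a b c d :: complex
  shows "norm (a + b + c + d) \<le> norm a + norm b + norm c + norm d"
  by (intro order_trans[OF norm_triangle_ineq] add_mono order_refl)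

lemma norm_cell_induction:
  assumes "\<And>j. norm (D (p - 1) q j) \<le> X" "\<And>j. norm (D (p + 1) q j) \<le> X"
    "\<And>j. norm (D p (q - 1) j) \<le> X" "\<And>j. norm (D p (q + 1) j) \<le> X"
  shows "norm (cell_induction D p q i) \<le> 4 * del * (\<bar>of_int p\<bar> + \<bar>of_int q\<bar> + kap) * X"
proof -
  let ?s = "\<bar>of_int p\<bar> + \<bar>of_int q\<bar> + kap"
  have "norm (cross_term (wavevec p q) helical_x (D (p - 1) q) i + cross_term (wavevec p q) (\<lambda>j. cnj (helical_x j)) (D (p + 1) q) i
      + cross_term (wavevec p q) helical_y (D p (q - 1)) i + cross_term (wavevec p q) (\<lambda>j. cnj (helical_y j)) (D p (q + 1)) i)
      \<le> ?s * X + ?s * X + ?s * X + ?s * X"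
    using norm_cross_term[of helical_x "D (p - 1) q" X "wavevec p q" i] norm_cross_term[of "\<lambda>j. cnj (helical_x j)" "D (p + 1) q" X "wavevec p q" i]
      norm_cross_term[of helical_y "D p (q - 1)" X "wavevec p q" i] norm_cross_term[of "\<lambda>j. cnj (helical_y j)" "D p (q + 1)" X "wavevec p q" i]
      norm_helical assms kap_bounds(1)
    by (intro order_trans[OF norm_add4_le] add_mono) auto
  also have "?s * X + ?s * X + ?s * X + ?s * X = 4 * ?s * X" by simp
  finally have "del * norm (cross_term (wavevec p q) helical_x (D (p - 1) q) i + cross_term (wavevec p q) (\<lambda>j. cnj (helical_x j)) (D (p + 1) q) i
      + cross_term (wavevec p q) helical_y (D p (q - 1)) i + cross_term (wavevec p q) (\<lambda>j. cnj (helical_y j)) (D p (q + 1)) i) \<le> del * (4 * ?s * X)"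
    by (rule mult_left_mono) (use del_bounds(1) in simp)
  moreover have "norm (cell_induction D p q i) = del * norm (cross_term (wavevec p q) helical_x (D (p - 1) q) i + cross_term (wavevec p q) (\<lambda>j. cnj (helical_x j)) (D (p + 1) q) i
      + cross_term (wavevec p q) helical_y (D p (q - 1)) i + cross_term (wavevec p q) (\<lambda>j. cnj (helical_y j)) (D p (q + 1)) i)"
    using del_bounds(1) by (simp add: cell_induction_def norm_mult)
  moreover have "del * (4 * ?s * X) = 4 * del * ?s * X" by (simp only: mult_ac)
  ultimately show ?thesis by (simp only:)
qed

text \<open>Up to the factor \<open>del\<close>, the entries i = 1, 2 are E_2 and -E_1, where E is
  the mean electromotive force, the average of velocity \<times> fluctuation. Its curl drives the
  mean mode, which varies in z alone.\<close>

definition emf :: "(int \<Rightarrow> int \<Rightarrow> 3 \<Rightarrow> complex) \<Rightarrow> 3 \<Rightarrow> complex" where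
  "emf W i = (helical_x 3 * W (-1) 0 i - helical_x i * W (-1) 0 3) + (cnj (helical_x 3) * W 1 0 i - cnj (helical_x i) * W 1 0 3)
     + (helical_y 3 * W 0 (-1) i - helical_y i * W 0 (-1) 3) + (cnj (helical_y 3) * W 0 1 i - cnj (helical_y i) * W 0 1 3)"

definition emf_pol :: "complex \<Rightarrow> (int \<Rightarrow> int \<Rightarrow> 3 \<Rightarrow> complex) \<Rightarrow> complex" where
  "emf_pol s W = - \<i> * (emf W 1 + s * \<i> * emf W 2)"

text \<open>For s = 1 and s = -1 these are the two circular polarisations of a horizontal field
  proportional to e^(i \<open>kap\<close> z). They belong to opposite eigenvalues of curl, so the
  alpha effect acts on each as a scalar.\<close>

definition mean_pol :: "complex \<Rightarrow> (int \<Rightarrow> int \<Rightarrow> 3 \<Rightarrow> complex) \<Rightarrow> complex" where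
  "mean_pol s W = W 0 0 1 + s * \<i> * W 0 0 2"

definition neighbour :: "int \<Rightarrow> int \<Rightarrow> bool" where
  "neighbour p q \<longleftrightarrow> (p, q) \<in> {(-1, 0), (1, 0), (0, -1), (0, 1)}"

text \<open>The stretching B.grad u of the mean field by the flow, at the four neighbours of the
  mean mode. Divided by \<eta> it is the leading-order equilibrium of the fluctuations, whose
  damping rate is \<eta> (1 + \<open>kap\<close>^2). The last branch stands for (0, -1); the formula
  is meant for neighbours.\<close>

definition slaved :: "(int \<Rightarrow> int \<Rightarrow> 3 \<Rightarrow> complex) \<Rightarrow> int \<Rightarrow> int \<Rightarrow> 3 \<Rightarrow> complex" where
  "slaved D p q i = \<i> * of_real del *
     (if (p, q) = (1, 0) then helical_x i * D 0 0 1 else if (p, q) = (-1, 0) then - cnj (helical_x i) * D 0 0 1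
      else if (p, q) = (0, 1) then helical_y i * D 0 0 2 else - cnj (helical_y i) * D 0 0 2)"

lemma norm_emf:
  assumes "\<And>p q j. neighbour p q \<Longrightarrow> norm (W p q j) \<le> X"
  shows "norm (emf W i) \<le> 4 * X"
proof -
  have *: "norm (a * W p q i - b * W p q 3) \<le> X" if "norm a \<le> 1/2" "norm b \<le> 1/2" "neighbour p q" for a b p q
  proof -
    have "X \<ge> 0" using assms[OF that(3), of 1] norm_ge_zero order_trans by blast
    have "norm (a * W p q i - b * W p q 3) \<le> norm a * norm (W p q i) + norm b * norm (W p q 3)"
      using norm_triangle_ineq4[of "a * W p q i" "b * W p q 3"] by (simp add: norm_mult)
    also have "\<dots> \<le> 1 / 2 * X + 1 / 2 * X"
      by (intro add_mono mult_mono that assms) auto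
    finally show ?thesis by simp
  qed
  have "norm (emf W i) \<le> X + X + X + X"
    unfolding emf_def
    by (intro order_trans[OF norm_add4_le] add_mono *) (simp_all only: complex_mod_cnj norm_helical, simp_all add: neighbour_def)
  then show ?thesis by simp
qed

lemma norm_emf_pol:
  assumes "\<And>p q j. neighbour p q \<Longrightarrow> norm (W p q j) \<le> X" "norm s = 1"
  shows "norm (emf_pol s W) \<le> 8 * X"
proof -
  have "norm (emf_pol s W) \<le> norm (emf W 1) + norm (emf W 2)"
    using norm_triangle_ineq[of "emf W 1" "s * \<i> * emf W 2"] assms(2) by (simp add: emf_pol_def norm_mult)
  also have "\<dots> \<le> 4 * X + 4 * X" by (intro add_mono norm_emf assms)
  finally show ?thesis by simp
qed

lemma emf_pol_diff: "emf_pol s (\<lambda>p q i. W p q i - W' p q i) = emf_pol s W - emf_pol s W'"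
  by (simp add: emf_pol_def emf_def algebra_simps)

lemma emf_pol_scale: "emf_pol s (\<lambda>p q i. r * W p q i) = r * emf_pol s W"
  by (simp add: emf_pol_def emf_def algebra_simps)

text \<open>The alpha effect: the slaved fluctuations amplify one circularly polarised component
  of the mean field (s = 1) and damp the other (s = -1).\<close>
lemma emf_pol_slaved:
  assumes "s = 1 \<or> s = -1"
  shows "emf_pol s (slaved D) = s * of_real del * mean_pol s D"
proof -
  have E1: "emf (slaved D) 1 = - of_real del * D 0 0 2" and E2: "emf (slaved D) 2 = of_real del * D 0 0 1"
    by (simp_all add: emf_def slaved_def)
  have "s * s = 1" using assms by auto
  then show ?thesis unfolding emf_pol_def E1 E2 mean_pol_def by (simp add: algebra_simps)
qed

text \<open>The mean has wave vector (0, 0, \<open>kap\<close>), so only j = 3 contributes and the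
  identity is exact.\<close>

lemma cell_induction_mean: "mean_pol s (cell_induction D) = of_real (del * kap) * emf_pol s D"
proof -
  have T: "cross_term (wavevec 0 0) v w i = of_real kap * (v 3 * w i - v i * w 3)" for v w i
    by (simp add: cross_term_def sum_3)
  have F: "cell_induction D 0 0 i = - \<i> * of_real (del * kap) * emf D i" for i
    unfolding cell_induction_def T emf_def by (simp only: of_real_mult diff_0 add_0 distrib_left mult.assoc mult.left_commute)
  show ?thesis unfolding mean_pol_def F emf_pol_def by (simp only: distrib_left mult.assoc mult.left_commute)
qed

text \<open>Of the four interactions feeding a neighbour, one involves the mean. There the
  transversality of the wave removes the horizontal advection term, the stretching term is
  \<open>slaved\<close>, and a remainder with factor \<open>kap\<close> is left. The other three
  interactions involve fluctuations, which R bounds.\<close>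

lemma cell_induction_slaved:
  assumes "neighbour p q" and z3: "D 0 0 3 = 0"
    and C: "\<And>j. norm (D 0 0 j) \<le> C" and R: "\<And>p q j. (p, q) \<noteq> (0, 0) \<Longrightarrow> norm (D p q j) \<le> R"
  shows "norm (cell_induction D p q i - slaved D p q i) \<le> del * (kap * C + 4 * R)"
proof -
  have R0: "R \<ge> 0" using order_trans[OF norm_ge_zero R[of 1 0 1]] by simp
  have C0: "C \<ge> 0" using C[of 1] norm_ge_zero[of "D 0 0 1"] by linarith
  have x: "(\<bar>wavevec p q 1\<bar> + \<bar>wavevec p q 2\<bar> + \<bar>wavevec p q 3\<bar>) = 1 + kap"
    using assms(1) kap_bounds by (auto simp: neighbour_def)
  have T: "norm (cross_term (wavevec p q) v (D p' q') i) \<le> (1 + kap) * R" if "\<And>j. norm (v j) \<le> 1 / 2" "(p', q') \<noteq> (0, 0)" for v p' q'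
    using norm_cross_term[of v "D p' q'" R "wavevec p q" i] that R unfolding x by blast
  have n3: "norm (a + b + c) \<le> norm a + norm b + norm c" for a b c :: complex
    by (intro order_trans[OF norm_triangle_ineq] add_mono order_refl)
  have main: "norm (- \<i> * of_real del * (e * (of_real kap * (w * D 0 0 i)) + T1 + T2 + T3)) \<le> del * (kap * C + 4 * R)"
    if "norm T1 \<le> (1 + kap) * R" "norm T2 \<le> (1 + kap) * R" "norm T3 \<le> (1 + kap) * R" "norm w \<le> 1/2" "norm e = 1"
    for T1 T2 T3 w e
  proof -
    have "norm (e * (of_real kap * (w * D 0 0 i))) \<le> kap * (1 / 2 * C)"
    proof -
      have "norm w * norm (D 0 0 i) \<le> 1 / 2 * C" by (rule mult_mono) (use that(4) C in auto)
      then have "kap * (norm w * norm (D 0 0 i)) \<le> kap * (1 / 2 * C)"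
        by (rule mult_left_mono) (use kap_bounds in simp)
      then show ?thesis using that(5) kap_bounds(1) by (simp add: norm_mult)
    qed
    then have "norm (e * (of_real kap * (w * D 0 0 i)) + T1 + T2 + T3) \<le> kap * (1 / 2 * C) + (1 + kap) * R + (1 + kap) * R + (1 + kap) * R"
      using that by (intro order_trans[OF norm_add4_le] add_mono) auto
    also have "\<dots> \<le> kap * C + 4 * R"
    proof -
      have "kap * R \<le> 1/3 * R" using kap_bounds R0 by (intro mult_right_mono) auto
      moreover have "0 \<le> kap * C" using kap_bounds C0 by simp
      ultimately show ?thesis by (simp add: algebra_simps)
    qed
    finally show ?thesis using del_bounds(1) by (simp add: norm_mult)
  qed
  have T0: "cross_term (wavevec p q) v (D 0 0) i = of_int p * (v 1 * D 0 0 i - v i * D 0 0 1)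
      + of_int q * (v 2 * D 0 0 i - v i * D 0 0 2) + of_real kap * (v 3 * D 0 0 i)" for v
    by (simp add: cross_term_def sum_3 z3)
  \<comment> \<open>Common end of the four cases: T0 is the interaction with the mean, X cancels its
    stretching part, and their sum is of order \<open>kap\<close>.\<close>
  have fin: "norm (cell_induction D p q i - slaved D p q i) \<le> del * (kap * C + 4 * R)"
    if "cell_induction D p q i = - \<i> * of_real del * (T0 + T1 + T2 + T3)" "slaved D p q i = \<i> * of_real del * X"
      "T0 + X = of_real kap * (w * D 0 0 i)"
      "norm T1 \<le> (1 + kap) * R" "norm T2 \<le> (1 + kap) * R" "norm T3 \<le> (1 + kap) * R" "norm w \<le> 1/2"
    for T0 T1 T2 T3 X w
  proof -
    have "cell_induction D p q i - slaved D p q i = - \<i> * of_real del * ((T0 + X) + T1 + T2 + T3)"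
      unfolding that(1,2) by (simp add: algebra_simps)
    also have "\<dots> = - \<i> * of_real del * (1 * (of_real kap * (w * D 0 0 i)) + T1 + T2 + T3)"
      unfolding that(3) by simp
    finally show ?thesis using main[OF that(4-7), of 1] by simp
  qed
  from assms(1) consider "p = -1" "q = 0" | "p = 1" "q = 0" | "p = 0" "q = -1" | "p = 0" "q = 1"
    by (auto simp: neighbour_def)
  then show ?thesis
  proof cases
    case 1
    show ?thesis
    proof (rule fin)
      show "cell_induction D p q i = - \<i> * of_real del * (cross_term (wavevec p q) (\<lambda>j. cnj (helical_x j)) (D 0 0) i
         + cross_term (wavevec p q) helical_x (D (-2) 0) i + cross_term (wavevec p q) helical_y (D (-1) (-1)) i + cross_term (wavevec p q) (\<lambda>j. cnj (helical_y j)) (D (-1) 1) i)"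
        by (simp add: cell_induction_def 1 add.commute)
      show "slaved D p q i = \<i> * of_real del * (- cnj (helical_x i) * D 0 0 1)" by (simp add: slaved_def 1)
      show "cross_term (wavevec p q) (\<lambda>j. cnj (helical_x j)) (D 0 0) i + - cnj (helical_x i) * D 0 0 1 = of_real kap * (cnj (helical_x 3) * D 0 0 i)"
        unfolding T0 by (simp add: 1)
    qed ((rule T)?; ((simp only: complex_mod_cnj norm_helical)?, simp?))+
  next
    case 2
    show ?thesis
    proof (rule fin)
      show "cell_induction D p q i = - \<i> * of_real del * (cross_term (wavevec p q) helical_x (D 0 0) i
         + cross_term (wavevec p q) (\<lambda>j. cnj (helical_x j)) (D 2 0) i + cross_term (wavevec p q) helical_y (D 1 (-1)) i + cross_term (wavevec p q) (\<lambda>j. cnj (helical_y j)) (D 1 1) i)"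
        by (simp add: cell_induction_def 2)
      show "slaved D p q i = \<i> * of_real del * (helical_x i * D 0 0 1)" by (simp add: slaved_def 2)
      show "cross_term (wavevec p q) helical_x (D 0 0) i + helical_x i * D 0 0 1 = of_real kap * (helical_x 3 * D 0 0 i)"
        unfolding T0 by (simp add: 2)
    qed ((rule T)?; ((simp only: complex_mod_cnj norm_helical)?, simp?))+
  next
    case 3
    show ?thesis
    proof (rule fin)
      show "cell_induction D p q i = - \<i> * of_real del * (cross_term (wavevec p q) (\<lambda>j. cnj (helical_y j)) (D 0 0) i
         + cross_term (wavevec p q) helical_x (D (-1) (-1)) i + cross_term (wavevec p q) (\<lambda>j. cnj (helical_x j)) (D 1 (-1)) i + cross_term (wavevec p q) helical_y (D 0 (-2)) i)"
        by (simp add: cell_induction_def 3 add_ac)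
      show "slaved D p q i = \<i> * of_real del * (- cnj (helical_y i) * D 0 0 2)" by (simp add: slaved_def 3)
      show "cross_term (wavevec p q) (\<lambda>j. cnj (helical_y j)) (D 0 0) i + - cnj (helical_y i) * D 0 0 2 = of_real kap * (cnj (helical_y 3) * D 0 0 i)"
        unfolding T0 by (simp add: 3)
    qed ((rule T)?; ((simp only: complex_mod_cnj norm_helical)?, simp?))+
  next
    case 4
    show ?thesis
    proof (rule fin)
      show "cell_induction D p q i = - \<i> * of_real del * (cross_term (wavevec p q) helical_y (D 0 0) i
         + cross_term (wavevec p q) helical_x (D (-1) 1) i + cross_term (wavevec p q) (\<lambda>j. cnj (helical_x j)) (D 1 1) i + cross_term (wavevec p q) (\<lambda>j. cnj (helical_y j)) (D 0 2) i)"
        by (simp add: cell_induction_def 4 add_ac)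
      show "slaved D p q i = \<i> * of_real del * (helical_y i * D 0 0 2)" by (simp add: slaved_def 4)
      show "cross_term (wavevec p q) helical_y (D 0 0) i + helical_y i * D 0 0 2 = of_real kap * (helical_y 3 * D 0 0 i)"
        unfolding T0 by (simp add: 4)
    qed ((rule T)?; ((simp only: complex_mod_cnj norm_helical)?, simp?))+
  qed
qed

section \<open>The dynamo cell\<close>

text \<open>Adding the fluctuations to the mean field with this small weight cancels their leading-order
  contribution to its evolution, so that no estimate on how well the fluctuations are slaved is needed.\<close>
definition mean_corr :: "real \<Rightarrow> real \<Rightarrow> (int \<Rightarrow> int \<Rightarrow> 3 \<Rightarrow> complex) \<Rightarrow> complex" where
  "mean_corr \<eta> s W = mean_pol (of_real s) W + of_real (del * kap / \<eta>) * emf_pol (of_real s) W"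

definition cell_rhs :: "real \<Rightarrow> (int \<Rightarrow> int \<Rightarrow> 3 \<Rightarrow> complex) \<Rightarrow> int \<Rightarrow> int \<Rightarrow> 3 \<Rightarrow> complex" where
  "cell_rhs \<eta> D p q i = cell_induction D p q i - of_real (\<eta> * ((of_int p)\<^sup>2 + (of_int q)\<^sup>2 + kap\<^sup>2)) * D p q i"

text \<open>The third component of the mean vanishes because the field is solenoidal and the wave
  vector is vertical. Boundedness, uniform over all modes, is the finiteness that
  \<open>sup_absorb\<close> asks for.\<close>

definition cell_sol :: "real \<Rightarrow> (real \<Rightarrow> int \<Rightarrow> int \<Rightarrow> 3 \<Rightarrow> complex) \<Rightarrow> real \<Rightarrow> real \<Rightarrow> bool" where
  "cell_sol \<eta> D a b \<longleftrightarrow> (\<forall>t\<in>{a..b}. D t 0 0 3 = 0 \<and>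
     (\<forall>p q i. ((\<lambda>t. D t p q i) has_vector_derivative cell_rhs \<eta> (D t) p q i) (at t within {a..b})))
     \<and> (\<exists>C. \<forall>t\<in>{a..b}. \<forall>p q i. norm (D t p q i) \<le> C)"

text \<open>The effective exponent of polarisation s when the fluctuations are replaced by
  \<open>slaved\<close> / \<eta>: alpha effect minus diffusion of the mean.\<close>

definition growth_exp :: "real \<Rightarrow> real \<Rightarrow> real" where
  "growth_exp \<eta> s = s * (del\<^sup>2 * kap / \<eta>) - \<eta> * kap\<^sup>2"

lemma emf_pol_cong:
  assumes "\<And>p q i. neighbour p q \<Longrightarrow> W p q i = W' p q i"
  shows "emf_pol s W = emf_pol s W'"
  using assms by (simp add: emf_pol_def emf_def neighbour_def)

lemma norm_del_kap_mult:
  assumes "\<eta> > 0"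
  shows "norm (of_real (del * kap / \<eta>) * z :: complex) = del * kap / \<eta> * norm z"
  unfolding norm_mult norm_of_real using assms del_bounds kap_bounds by simp

text \<open>Write z for the mean polarisation, L for \<open>emf_pol\<close> of the state and F for
  \<open>emf_pol\<close> of its induction. Then z' = \<open>del\<close> \<open>kap\<close> L -
  \<eta> \<open>kap\<close>^2 z and L' = F - \<eta> (1 + \<open>kap\<close>^2) L. The weight
  \<open>del\<close> \<open>kap\<close> / \<eta> cancels the term \<open>del\<close>
  \<open>kap\<close> L, and the slaved part of F becomes s \<open>del\<close>^2 \<open>kap\<close> /
  \<eta> times z. What is left is the slaving defect and a multiple of L with the extra factor
  \<open>growth_exp\<close> / \<eta> + \<open>kap\<close>^2.\<close>

lemma mean_corr_deriv:
  assumes "cell_sol \<eta> D a b" "t \<in> {a..b}" and s: "s = 1 \<or> s = -1" and "\<eta> \<noteq> 0"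
  shows "((\<lambda>t. mean_corr \<eta> s (D t)) has_vector_derivative
     (of_real (growth_exp \<eta> s) * mean_corr \<eta> s (D t)
      + (of_real (del * kap / \<eta>) * emf_pol (of_real s) (\<lambda>p q i. cell_induction (D t) p q i - slaved (D t) p q i)
         - of_real (del * kap * (growth_exp \<eta> s / \<eta> + kap\<^sup>2)) * emf_pol (of_real s) (D t)))) (at t within {a..b})"
proof -
  have d: "((\<lambda>t. D t p q i) has_vector_derivative cell_rhs \<eta> (D t) p q i) (at t within {a..b})" for p q i
    using assms by (auto simp: cell_sol_def)
  have "((\<lambda>t. mean_corr \<eta> s (D t)) has_vector_derivative mean_corr \<eta> s (cell_rhs \<eta> (D t))) (at t within {a..b})"
    unfolding mean_corr_def mean_pol_def emf_pol_def emf_def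
    by (intro has_vector_derivative_add has_vector_derivative_mult_right has_vector_derivative_diff d)
  moreover have "mean_corr \<eta> s (cell_rhs \<eta> (D t)) = of_real (growth_exp \<eta> s) * mean_corr \<eta> s (D t)
      + (of_real (del * kap / \<eta>) * emf_pol (of_real s) (\<lambda>p q i. cell_induction (D t) p q i - slaved (D t) p q i)
         - of_real (del * kap * (growth_exp \<eta> s / \<eta> + kap\<^sup>2)) * emf_pol (of_real s) (D t))"
  proof -
    define L where "L = emf_pol (of_real s) (D t)"
    define z where "z = mean_pol (of_real s) (D t)"
    define F where "F = emf_pol (of_real s) (cell_induction (D t))"
    have z: "mean_pol (of_real s) (cell_rhs \<eta> (D t)) = of_real (del * kap) * L - of_real (\<eta> * kap\<^sup>2) * z"
      unfolding L_def z_def cell_induction_mean[symmetric] by (simp add: mean_pol_def cell_rhs_def algebra_simps)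
    have l: "emf_pol (of_real s) (cell_rhs \<eta> (D t)) = F - of_real (\<eta> * (1 + kap\<^sup>2)) * L"
    proof -
      have "emf_pol (of_real s) (cell_rhs \<eta> (D t)) = emf_pol (of_real s) (\<lambda>p q i. cell_induction (D t) p q i - of_real (\<eta> * (1 + kap\<^sup>2)) * D t p q i)"
        by (rule emf_pol_cong) (auto simp: cell_rhs_def neighbour_def)
      then show ?thesis unfolding L_def F_def by (simp only: emf_pol_diff emf_pol_scale)
    qed
    have sl: "emf_pol (of_real s) (\<lambda>p q i. cell_induction (D t) p q i - slaved (D t) p q i) = F - of_real (s * del) * z"
      using s unfolding emf_pol_diff F_def z_def by (subst emf_pol_slaved) auto
    show ?thesis
      unfolding mean_corr_def z l sl z_def[symmetric] L_def[symmetric]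
      using \<open>\<eta> \<noteq> 0\<close> by (simp add: growth_exp_def field_simps power2_eq_square)
  qed
  ultimately show ?thesis by simp
qed

text \<open>Integrality gives |p| \<le> p^2, and off the mean p^2 + q^2 \<ge> 1 also covers the
  summand \<open>kap\<close>. Diffusion, of second order in the wave vector, thereby dominates the
  first-order induction term.\<close>

lemma int_pair_le:
  assumes "(p, q) \<noteq> (0, 0 :: int)"
  shows "\<bar>of_int p\<bar> + \<bar>of_int q\<bar> + kap \<le> 2 * ((of_int p)\<^sup>2 + (of_int q)\<^sup>2 + kap\<^sup>2)"
proof -
  have *: "\<bar>x\<bar> \<le> x\<^sup>2" for x :: int
  proof (cases "x = 0")
    case False
    then have "\<bar>x\<bar> * 1 \<le> \<bar>x\<bar> * \<bar>x\<bar>" by (intro mult_left_mono) auto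
    then show ?thesis by (simp add: power2_eq_square)
  qed simp
  have **: "\<bar>of_int x\<bar> \<le> (of_int x :: real)\<^sup>2" for x :: int
    using *[of x] by (metis of_int_abs of_int_le_iff of_int_power)
  have "p \<noteq> 0 \<or> q \<noteq> 0" using assms by auto
  then have "1 \<le> \<bar>p\<bar> + \<bar>q\<bar>" by linarith
  then have "1 \<le> p\<^sup>2 + q\<^sup>2" using *[of p] *[of q] by linarith
  then have "(1::real) \<le> (of_int p)\<^sup>2 + (of_int q)\<^sup>2"
    by (metis of_int_1_le_iff of_int_add of_int_power)
  note 1 = this
  have lin: "a + b + k \<le> 2 * (A + B + K)" if "a \<le> A" "b \<le> B" "1 \<le> A + B" "k \<le> 1" "0 \<le> K"
    for a b A B k K :: real using that by auto
  show ?thesis by (rule lin[OF **[of p] **[of q] 1]) (use kap_bounds in auto)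
qed

text \<open>As \<open>kap\<close>^2 = \<open>kap\<close> \<open>del\<close>^2 / 16, every term is a
  multiple of \<sigma> = \<open>kap\<close> \<open>del\<close>^2: the alpha effect has size between
  \<sigma>/2 and \<sigma>, diffusion at most \<sigma>/8. The constant 3/8 is 1/2 - 1/8.\<close>

lemma growth_exp_bounds:
  assumes "\<eta> \<in> {1..2}"
  shows "growth_exp \<eta> 1 \<ge> 3 / 8 * (kap * del\<^sup>2)" "growth_exp \<eta> 1 \<le> kap * del\<^sup>2"
    "growth_exp \<eta> (-1) \<le> - (kap * del\<^sup>2) / 2" "growth_exp \<eta> (-1) \<ge> - 2 * (kap * del\<^sup>2)"
proof -
  have k: "kap\<^sup>2 = kap * del\<^sup>2 / 16" by (simp add: kap_def power2_eq_square)
  define \<sigma> where "\<sigma> = kap * del\<^sup>2"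
  have s: "\<sigma> > 0" using kap_bounds del_bounds by (simp add: \<sigma>_def)
  have 1: "\<sigma> / 2 \<le> \<sigma> / \<eta>" "\<sigma> / \<eta> \<le> \<sigma>"
    using assms s by (auto simp: field_simps)
  have 2: "\<eta> * \<sigma> / 16 \<le> \<sigma> / 8" "0 \<le> \<eta> * \<sigma> / 16" using assms s by (auto simp: field_simps)
  have e: "growth_exp \<eta> r = r * (\<sigma> / \<eta>) - \<eta> * \<sigma> / 16" for r
    unfolding growth_exp_def k by (simp add: \<sigma>_def mult.commute)
  show "growth_exp \<eta> 1 \<ge> 3 / 8 * (kap * del\<^sup>2)" "growth_exp \<eta> 1 \<le> kap * del\<^sup>2"
    "growth_exp \<eta> (-1) \<le> - (kap * del\<^sup>2) / 2" "growth_exp \<eta> (-1) \<ge> - 2 * (kap * del\<^sup>2)"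
    unfolding e \<sigma>_def[symmetric] using 1 2 s by linarith+
qed

text \<open>A cone mapped into itself over unit time: the amplified polarisation dominates the
  damped one and all fluctuations, and X records a lower bound for it. The ratio 16
  \<open>del\<close> is twice the level 8 \<open>del\<close> that induction can sustain against
  diffusion.\<close>

definition dynamo_cone :: "real \<Rightarrow> (int \<Rightarrow> int \<Rightarrow> 3 \<Rightarrow> complex) \<Rightarrow> real \<Rightarrow> bool" where
  "dynamo_cone \<eta> W X \<longleftrightarrow> X > 0 \<and> X \<le> norm (mean_corr \<eta> 1 W) \<and> norm (mean_corr \<eta> (-1) W) \<le> norm (mean_corr \<eta> 1 W) \<and>
     (\<forall>p q i. (p, q) \<noteq> (0, 0) \<longrightarrow> norm (W p q i) \<le> 16 * del * norm (mean_corr \<eta> 1 W))"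

text \<open>Sum and difference of the two polarisations give the horizontal components. Passing from
  \<open>mean_corr\<close> to \<open>mean_pol\<close> costs a multiple of \<open>del\<close>
  \<open>kap\<close> times the fluctuations, far below 0.001 in relative size.\<close>

lemma dynamo_cone_mean_bound:
  assumes \<eta>: "\<eta> \<in> {1..2}" and c: "dynamo_cone \<eta> W X" and z3: "W 0 0 3 = 0"
  shows "norm (W 0 0 i) \<le> 1.001 * norm (mean_corr \<eta> 1 W)"
proof -
  define Y where "Y = norm (mean_corr \<eta> 1 W)"
  have Y: "Y > 0" using c by (auto simp: dynamo_cone_def Y_def)
  have L: "norm (of_real (del * kap / \<eta>) * emf_pol s W) \<le> 0.001 * Y" if "norm s = 1" for s
  proof -
    have "norm (emf_pol s W) \<le> 8 * (16 * del * Y)"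
      by (rule norm_emf_pol) (use c that in \<open>auto simp: dynamo_cone_def Y_def neighbour_def\<close>)
    have "del * kap / \<eta> \<le> (1/10000) * (1/1000000000) / 1" using \<eta> del_bounds kap_bounds by (intro frac_le mult_mono) auto
    then have "del * kap / \<eta> * norm (emf_pol s W) \<le> ((1/10000) * (1/1000000000)) * (8 * (16 * del * Y))"
      using \<open>norm (emf_pol s W) \<le> 8 * (16 * del * Y)\<close> \<eta> del_bounds kap_bounds Y by (intro mult_mono) auto
    also have "\<dots> \<le> 0.001 * Y" using Y by (simp add: del_def)
    finally show ?thesis using \<eta> by (subst norm_del_kap_mult) auto
  qed
  have a: "norm (mean_pol 1 W) \<le> Y + 0.001 * Y"
    using norm_triangle_ineq4[of "mean_corr \<eta> 1 W" "of_real (del * kap / \<eta>) * emf_pol 1 W"] L[of 1]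
    by (simp add: mean_corr_def Y_def)
  have b: "norm (mean_pol (-1) W) \<le> Y + 0.001 * Y"
    using norm_triangle_ineq4[of "mean_corr \<eta> (-1) W" "of_real (del * kap / \<eta>) * emf_pol (-1) W"] L[of "-1"] c
    by (simp add: mean_corr_def Y_def dynamo_cone_def)
  have "2 * norm (W 0 0 1) = norm (mean_pol 1 W + mean_pol (-1) W)"
    by (simp add: mean_pol_def norm_mult flip: mult_2)
  also have "\<dots> \<le> 2 * (1.001 * Y)" using norm_triangle_ineq[of "mean_pol 1 W" "mean_pol (-1) W"] a b by simp
  finally have 1: "norm (W 0 0 1) \<le> 1.001 * Y" by simp
  have "mean_pol 1 W - mean_pol (-1) W = \<i> * (2 * W 0 0 2)"
    by (simp add: mean_pol_def)
  then have "2 * norm (W 0 0 2) = norm (mean_pol 1 W - mean_pol (-1) W)"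
    by (simp add: norm_mult)
  also have "\<dots> \<le> 2 * (1.001 * Y)" using norm_triangle_ineq4[of "mean_pol 1 W" "mean_pol (-1) W"] a b by simp
  finally have 2: "norm (W 0 0 2) \<le> 1.001 * Y" by simp
  show ?thesis using 1 2 z3 Y exhaust_3[of i] by (auto simp: Y_def)
qed

text \<open>Over unit time the mean changes little, and diffusion holds the fluctuations at their
  level. Each of the two estimates presupposes a bound on the other modes; \<open>sup_absorb\<close>
  closes the loop in the norm where fluctuations are divided by \<rho>.\<close>

lemma window_bounds:
  assumes \<eta>: "\<eta> \<in> {1..2}" and sol: "cell_sol \<eta> D a (a + 1)" and c: "dynamo_cone \<eta> (D a) X"
    and t: "t \<in> {a..a + 1}"
  shows "norm (D t 0 0 i) \<le> 1.01 * norm (mean_corr \<eta> 1 (D a))"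
    and "(p, q) \<noteq> (0, 0) \<Longrightarrow> norm (D t p q i) \<le> 16 * del * norm (mean_corr \<eta> 1 (D a))"
proof -
  define Y where "Y = norm (mean_corr \<eta> 1 (D a))"
  have Y: "Y > 0" using c by (auto simp: dynamo_cone_def Y_def)
  define \<rho> where "\<rho> = 16 * del"
  have \<rho>: "0 < \<rho>" "\<rho> \<le> 0.0016" using del_bounds by (auto simp: \<rho>_def)
  have d: "((\<lambda>t. D t p q i) has_vector_derivative cell_rhs \<eta> (D t) p q i) (at t within {a..a + 1})" if "t \<in> {a..a + 1}" for p q i t
    using sol that by (auto simp: cell_sol_def)
  have z3: "D t 0 0 3 = 0" if "t \<in> {a..a + 1}" for t using sol that by (auto simp: cell_sol_def)
  obtain C0 where C0: "\<And>t p q i. t \<in> {a..a + 1} \<Longrightarrow> norm (D t p q i) \<le> C0"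
    using sol unfolding cell_sol_def by blast
  \<comment> \<open>With |k|^2 = p^2 + q^2 + \<open>kap\<close>^2, damping is at least |k|^2 and
    induction at most 4 \<open>del\<close> * 2 |k|^2 C; their quotient is the 8 \<open>del\<close> C
    of the bound.\<close>
  have fluct: "norm (D t p q i) \<le> max (\<rho> * Y) (8 * del * C)"
    if "t \<in> {a..a + 1}" "(p, q) \<noteq> (0, 0)"
      and le: "\<And>t p q i. t \<in> {a..a + 1} \<Longrightarrow> norm (D t p q i) \<le> C" for t p q i C
  proof -
    define l where "l = \<eta> * ((of_int p)\<^sup>2 + (of_int q)\<^sup>2 + kap\<^sup>2)"
    have x0: "0 < (of_int p)\<^sup>2 + (of_int q)\<^sup>2 + kap\<^sup>2"
      using kap_bounds(1) by (intro add_nonneg_pos) auto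
    then have l: "l > 0" using \<eta> by (simp add: l_def)
    have C: "C \<ge> 0" using order_trans[OF norm_ge_zero le[OF t]] .
    have "norm (D t p q i) \<le> max (norm (D a p q i)) (8 * del * C)"
    proof (rule damped_ode_max[where f = "\<lambda>t. cell_induction (D t) p q i" and l = l and a = a and b = "a + 1"])
      show "((\<lambda>t. D t p q i) has_vector_derivative cell_induction (D s) p q i - complex_of_real l * D s p q i) (at s within {a..a + 1})"
        if "s \<in> {a..a + 1}" for s using d[OF that] by (simp add: cell_rhs_def l_def)
      show "norm (cell_induction (D s) p q i) \<le> l * (8 * del * C)" if "s \<in> {a..a + 1}" for s
      proof -
        have "norm (cell_induction (D s) p q i) \<le> 4 * del * (\<bar>of_int p\<bar> + \<bar>of_int q\<bar> + kap) * C"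
          by (intro norm_cell_induction le that)
        also have "\<dots> \<le> 4 * del * (2 * ((of_int p)\<^sup>2 + (of_int q)\<^sup>2 + kap\<^sup>2)) * C"
          using int_pair_le[OF \<open>(p, q) \<noteq> (0, 0)\<close>] C del_bounds by (intro mult_right_mono mult_left_mono) auto
        also have "\<dots> = 1 * ((of_int p)\<^sup>2 + (of_int q)\<^sup>2 + kap\<^sup>2) * (8 * del * C)" by simp
        also have "\<dots> \<le> \<eta> * ((of_int p)\<^sup>2 + (of_int q)\<^sup>2 + kap\<^sup>2) * (8 * del * C)"
          using \<eta> x0 C del_bounds by (intro mult_right_mono) auto
        finally show ?thesis by (simp add: l_def)
      qed
    qed (use l that in auto)
    moreover have "norm (D a p q i) \<le> \<rho> * Y" using c that by (auto simp: dynamo_cone_def \<rho>_def Y_def)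
    then have "max (norm (D a p q i)) (8 * del * C) \<le> max (\<rho> * Y) (8 * del * C)" by (rule max.mono) simp
    ultimately show ?thesis by linarith
  qed
  \<comment> \<open>The mean has wave number \<open>kap\<close>, so induction adds at most 4
    \<open>del\<close> \<open>kap\<close> C over a unit of time.\<close>
  have mean: "norm (D t 0 0 i) \<le> 1.001 * Y + 0.001 * C"
    if "t \<in> {a..a + 1}" "C \<ge> 0" and le: "\<And>t p q i. t \<in> {a..a + 1} \<Longrightarrow> (p, q) \<noteq> (0, 0) \<Longrightarrow> norm (D t p q i) \<le> C" for t i C
  proof -
    let ?\<nu> = "- (\<eta> * kap\<^sup>2)"
    have k: "0 < \<eta> * kap\<^sup>2" using \<eta> kap_bounds by simp
    have "norm (D t 0 0 i - of_real (exp (?\<nu> * (t - a))) * D a 0 0 i) \<le> (4 * del * kap * C) * ((exp (?\<nu> * (t - a)) - 1) / ?\<nu>)"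
    proof (rule linear_ode_bound[where f = "\<lambda>t. cell_induction (D t) 0 0 i" and b = "a + 1"])
      show "((\<lambda>t. D t 0 0 i) has_vector_derivative complex_of_real ?\<nu> * D s 0 0 i + cell_induction (D s) 0 0 i) (at s within {a..a + 1})"
        if "s \<in> {a..a + 1}" for s using d[OF that, of 0 0 i] by (simp add: cell_rhs_def)
      show "norm (cell_induction (D s) 0 0 i) \<le> 4 * del * kap * C" if "s \<in> {a..a + 1}" for s
        using norm_cell_induction[of "D s" 0 0 C i] le[OF that] by simp
    qed (use k that in auto)
    also have "(exp (?\<nu> * (t - a)) - 1) / ?\<nu> = (1 - exp (?\<nu> * (t - a))) / (\<eta> * kap\<^sup>2)"
      by (metis minus_diff_eq minus_divide_divide)
    also have "\<dots> \<le> (\<eta> * kap\<^sup>2 * (t - a)) / (\<eta> * kap\<^sup>2)"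
      using exp_ge_add_one_self[of "?\<nu> * (t - a)"] k by (intro divide_right_mono) auto
    also have "\<dots> \<le> 1" using k that by simp
    finally have 1: "norm (D t 0 0 i - of_real (exp (?\<nu> * (t - a))) * D a 0 0 i) \<le> 4 * del * kap * C"
      using del_bounds kap_bounds \<open>C \<ge> 0\<close> by (simp add: mult_left_mono)
    have "4 * del * kap \<le> 4 * 1/10000 * 1"
      using del_bounds kap_bounds by (intro mult_mono) auto
    then have 2: "4 * del * kap * C \<le> 0.001 * C" using \<open>C \<ge> 0\<close> by (intro mult_right_mono) auto
    have "norm (of_real (exp (?\<nu> * (t - a))) * D a 0 0 i) \<le> 1 * norm (D a 0 0 i)"
      unfolding norm_mult using k that by (intro mult_right_mono) auto
    also have "\<dots> \<le> 1.001 * Y" using dynamo_cone_mean_bound[OF \<eta> c z3] by (simp add: Y_def)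
    finally show ?thesis
      using 1 2 norm_triangle_ineq2[of "D t 0 0 i" "of_real (exp (?\<nu> * (t - a))) * D a 0 0 i"] by linarith
  qed
  have "norm (D t p q i) / (if (p, q) = (0, 0) then 1 else \<rho>) \<le> 1.01 * Y" if "t \<in> {a..a + 1}" for t p q i
  proof -
    define w where "w p q = (if (p, q) = (0, 0) then 1 else \<rho>)" for p q :: int
    have w: "w p q > 0" "w p q \<le> 1" for p q using \<rho> by (auto simp: w_def)
    define Z :: "(real \<times> int \<times> int \<times> 3) set" where "Z = {(t, p, q, i). t \<in> {a..a + 1}}"
    define h where "h = (\<lambda>(t, p, q, i). norm (D t p q i) / w p q)"
    have "h (t, p, q, i) \<le> 1.01 * Y"
    proof (rule sup_absorb[where Z = Z and M = "C0 / \<rho>"])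
      show "h z \<le> C0 / \<rho>" if z: "z \<in> Z" for z
      proof -
        obtain t p q i where [simp]: "z = (t, p, q, i)" and t: "t \<in> {a..a + 1}" using z by (auto simp: Z_def)
        have "norm (D t p q i) / w p q \<le> C0 / \<rho>"
          using C0[OF t] \<rho> order_trans[OF norm_ge_zero C0[OF t]] by (intro frac_le) (auto simp: w_def)
        then show ?thesis by (simp add: h_def)
      qed
      show "h z \<le> max (1.01 * Y) (C / 2)" if C: "0 \<le> C" and hC: "\<And>z. z \<in> Z \<Longrightarrow> h z \<le> C" and z: "z \<in> Z" for C z
      proof -
        obtain t p q i where [simp]: "z = (t, p, q, i)" and t: "t \<in> {a..a + 1}" using z by (auto simp: Z_def)
        have le': "norm (D t p q i) \<le> w p q * C" if "t \<in> {a..a + 1}" for t p q i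
          using hC[of "(t, p, q, i)"] that w[of p q] by (simp add: h_def Z_def field_simps)
        have le: "norm (D t p q i) \<le> C" if "t \<in> {a..a + 1}" for t p q i
          using le'[OF that, of p q i] mult_right_mono[OF w(2)[of p q] C] by simp
        have f: "norm (D t p q i) \<le> max (\<rho> * Y) (8 * del * C)" if "(p, q) \<noteq> (0, 0)"
          by (rule fluct[OF t that le])
        have m: "norm (D t 0 0 i) \<le> 1.001 * Y + 0.001 * C"
          by (rule mean[OF t C le])
        show ?thesis
        proof (cases "(p, q) = (0, 0)")
          case True
          then show ?thesis using m Y C by (simp add: h_def w_def max_def)
        next
          case False
          have "norm (D t p q i) / \<rho> \<le> max (\<rho> * Y) (8 * del * C) / \<rho>"
            using f[OF False] \<rho> by (intro divide_right_mono) auto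
          \<comment> \<open>The choice \<rho> = 16 \<open>del\<close> gives 8 \<open>del\<close> /
            \<rho> = 1/2, the factor required by \<open>sup_absorb\<close>.\<close>
          also have "\<dots> = max Y (C / 2)"
            using \<rho> by (simp add: max_divide_distrib_right \<rho>_def)
          also have "\<dots> \<le> max (1.01 * Y) (C / 2)" using Y by (intro max.mono) auto
          finally have "norm (D t p q i) / \<rho> \<le> max (1.01 * Y) (C / 2)" .
          then show ?thesis using False by (auto simp: h_def w_def)
        qed
      qed
      show "(t, p, q, i) \<in> Z" using that by (simp add: Z_def)
      show "0 \<le> h z" for z using w by (auto simp: h_def split: prod.splits intro!: divide_nonneg_pos)
    qed (use Y in auto)
    then show ?thesis by (simp add: h_def w_def)
  qed
  note H = this
  have le: "norm (D t p q i) \<le> 1.01 * Y" if "t \<in> {a..a + 1}" for t p q i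
  proof (cases "(p, q) = (0, 0)")
    case True then show ?thesis using H[OF that, of p q i] by simp
  next
    case False
    then have "norm (D t p q i) / \<rho> \<le> 1.01 * Y" using H[OF that, of p q i] by auto
    then have "norm (D t p q i) \<le> \<rho> * (1.01 * Y)" using \<rho> by (simp add: field_simps)
    also have "\<dots> \<le> 1 * (1.01 * Y)" using \<rho> Y by (intro mult_right_mono) auto
    finally show ?thesis by simp
  qed
  show "norm (D t 0 0 i) \<le> 1.01 * norm (mean_corr \<eta> 1 (D a))" using le[OF t] by (simp add: Y_def)
  show "norm (D t p q i) \<le> 16 * del * norm (mean_corr \<eta> 1 (D a))" if "(p, q) \<noteq> (0, 0)"
  proof -
    \<comment> \<open>Feeding the uniform bound 1.01 Y back into \<open>fluct\<close> restores the
      initial level without loss, because \<rho> Y is the larger entry of the maximum.\<close>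
    have "8 * del * (1.01 * Y) \<le> \<rho> * Y" using del_bounds Y by (simp add: \<rho>_def)
    then show ?thesis using fluct[OF t that le, of i] by (simp add: Y_def \<rho>_def)
  qed
qed

text \<open>Both corrected polarisations obey scalar equations with forcing at most 0.06 \<sigma> Y.
  The growing one gains 3/8 \<sigma> less this error, still more than \<sigma>/4; the damped one
  loses at least \<sigma>/4, which absorbs the forcing and keeps it below Y. The cone is recovered
  with a larger X.\<close>

lemma window_step:
  assumes \<eta>: "\<eta> \<in> {1..2}" and sol: "cell_sol \<eta> D a (a + 1)" and c: "dynamo_cone \<eta> (D a) X"
  shows "dynamo_cone \<eta> (D (a + 1)) ((1 + kap * del\<^sup>2 / 4) * X)"
proof -
  define Y where "Y = norm (mean_corr \<eta> 1 (D a))"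
  have Y: "Y > 0" "X \<le> Y" "X > 0" using c by (auto simp: dynamo_cone_def Y_def)
  define \<sigma> where "\<sigma> = kap * del\<^sup>2"
  have \<sigma>: "0 < \<sigma>" "\<sigma> \<le> 1 / 1000000"
  proof -
    have "kap * del\<^sup>2 \<le> 1 / 1000000000 * (1 / 10000)\<^sup>2"
      using del_bounds kap_bounds by (intro mult_mono power_mono) auto
    then show "0 < \<sigma>" "\<sigma> \<le> 1 / 1000000" using del_bounds kap_bounds by (auto simp: \<sigma>_def power2_eq_square)
  qed
  note W = window_bounds[OF \<eta> sol c, folded Y_def]
  note gb = growth_exp_bounds[OF \<eta>, folded \<sigma>_def]
  \<comment> \<open>The forcing consists of the slaving defect, at most 520 \<open>del\<close>
    \<sigma> Y = 0.052 \<sigma> Y, and a term made much smaller by the factor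
    \<open>growth_exp\<close> / \<eta> + \<open>kap\<close>^2.\<close>
  have f: "norm (of_real (del * kap / \<eta>) * emf_pol (of_real s) (\<lambda>p q i. cell_induction (D t) p q i - slaved (D t) p q i)
         - of_real (del * kap * (growth_exp \<eta> s / \<eta> + kap\<^sup>2)) * emf_pol (of_real s) (D t)) \<le> 0.06 * \<sigma> * Y"
    if t: "t \<in> {a..a + 1}" and s: "s = 1 \<or> s = -1" for s t
  proof -
    have z3: "D t 0 0 3 = 0" using sol t by (auto simp: cell_sol_def)
    have ns: "norm (of_real s :: complex) = 1" using s by auto
    have "norm (emf_pol (of_real s) (\<lambda>p q i. cell_induction (D t) p q i - slaved (D t) p q i)) \<le> 8 * (del * (kap * (1.01 * Y) + 4 * (16 * del * Y)))"
      by (intro norm_emf_pol cell_induction_slaved ns z3 W t) auto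
    \<comment> \<open>The fluctuations contribute 4 * 16 = 64; the mean contributes less than 1
      because \<open>kap\<close> is at most \<open>del\<close> / 10.\<close>
    also have "\<dots> \<le> 8 * (del * (65 * del * Y))"
    proof -
      have "kap \<le> 1/10 * del" using del_bounds by (simp add: kap_def power2_eq_square)
      then have "kap * (1.01 * Y) \<le> 1/10 * del * (1.01 * Y)" using Y by (intro mult_right_mono) auto
      moreover have "0 \<le> del * Y" using Y del_bounds by simp
      ultimately show ?thesis using del_bounds by (intro mult_left_mono) (auto simp: algebra_simps)
    qed
    finally have 1: "norm (emf_pol (of_real s) (\<lambda>p q i. cell_induction (D t) p q i - slaved (D t) p q i)) \<le> 520 * del\<^sup>2 * Y"
      by (simp add: power2_eq_square)
    have "del * kap / \<eta> \<le> del * kap / 1" using \<eta> del_bounds kap_bounds by (intro divide_left_mono) auto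
    then have "del * kap / \<eta> * norm (emf_pol (of_real s) (\<lambda>p q i. cell_induction (D t) p q i - slaved (D t) p q i)) \<le> (del * kap) * (520 * del\<^sup>2 * Y)"
      using 1 \<eta> del_bounds kap_bounds by (intro mult_mono) auto
    also have "\<dots> = (520 * del) * (\<sigma> * Y)" by (simp add: \<sigma>_def)
    also have "\<dots> = 0.052 * (\<sigma> * Y)" by (simp add: del_def)
    finally have A: "norm (of_real (del * kap / \<eta>) * emf_pol (of_real s) (\<lambda>p q i. cell_induction (D t) p q i - slaved (D t) p q i)) \<le> 0.052 * (\<sigma> * Y)"
      using \<eta> by (subst norm_del_kap_mult) auto
    have 2: "norm (emf_pol (of_real s) (D t)) \<le> 8 * (16 * del * Y)"
      by (rule norm_emf_pol) (use ns W(2)[OF t] in \<open>auto simp: neighbour_def\<close>)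
    have "\<bar>growth_exp \<eta> s\<bar> \<le> 2 * \<sigma>" using gb s \<sigma> by auto
    then have "\<bar>growth_exp \<eta> s / \<eta>\<bar> \<le> 2 * \<sigma> / 1" unfolding abs_divide using \<eta> \<sigma> by (intro frac_le) auto
    then have "\<bar>growth_exp \<eta> s / \<eta> + kap\<^sup>2\<bar> \<le> 2 * \<sigma> + kap\<^sup>2" using abs_triangle_ineq[of "growth_exp \<eta> s / \<eta>" "kap\<^sup>2"] by simp
    moreover have "kap\<^sup>2 \<le> 1/1000000" using kap_bounds power_mono[of kap "1/1000000000" 2] by (simp add: power2_eq_square)
    ultimately have 3: "\<bar>growth_exp \<eta> s / \<eta> + kap\<^sup>2\<bar> \<le> 1 / 100000" using \<sigma> by simp
    have "norm (of_real (del * kap * (growth_exp \<eta> s / \<eta> + kap\<^sup>2)) * emf_pol (of_real s) (D t))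
       = del * kap * \<bar>growth_exp \<eta> s / \<eta> + kap\<^sup>2\<bar> * norm (emf_pol (of_real s) (D t))"
      unfolding norm_mult norm_of_real abs_mult using del_bounds kap_bounds by simp
    also have "\<dots> \<le> del * kap * (1 / 100000) * (8 * (16 * del * Y))"
      using 2 3 del_bounds kap_bounds by (intro mult_mono[OF mult_left_mono]) auto
    also have "\<dots> = 128/100000 * (\<sigma> * Y)" by (simp add: \<sigma>_def power2_eq_square)
    finally have B: "norm (of_real (del * kap * (growth_exp \<eta> s / \<eta> + kap\<^sup>2)) * emf_pol (of_real s) (D t)) \<le> 128/100000 * (\<sigma> * Y)" .
    have "0 \<le> \<sigma> * Y" using \<sigma> Y by simp
    then show ?thesis
      using norm_triangle_ineq4[of "of_real (del * kap / \<eta>) * emf_pol (of_real s) (\<lambda>p q i. cell_induction (D t) p q i - slaved (D t) p q i)"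
          "of_real (del * kap * (growth_exp \<eta> s / \<eta> + kap\<^sup>2)) * emf_pol (of_real s) (D t)"] A B
      by (simp add: mult.assoc)
  qed
  have B: "norm (mean_corr \<eta> s (D (a + 1)) - of_real (exp (growth_exp \<eta> s)) * mean_corr \<eta> s (D a)) \<le> 0.06 * \<sigma> * Y * ((exp (growth_exp \<eta> s) - 1) / growth_exp \<eta> s)"
    if s: "s = 1 \<or> s = -1" and nz: "growth_exp \<eta> s \<noteq> 0" for s
    using linear_ode_bound[of a "a + 1" "\<lambda>t. mean_corr \<eta> s (D t)" "growth_exp \<eta> s" _ "0.06 * \<sigma> * Y" "a + 1", OF mean_corr_deriv[OF sol _ s] f[OF _ s] nz] \<eta>
    by simp
  have g1: "growth_exp \<eta> 1 > 0" using gb \<sigma> by linarith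
  have g2: "growth_exp \<eta> (-1) < 0" using gb \<sigma> by linarith
  have p1: "norm (mean_corr \<eta> 1 (D (a + 1))) \<ge> (1 + \<sigma> / 4) * Y"
  proof -
    define e where "e = exp (growth_exp \<eta> 1)"
    have e1: "e \<ge> 1 + 3/8 * \<sigma>" unfolding e_def using exp_ge_add_one_self[of "growth_exp \<eta> 1"] gb(1) by linarith
    have "1 - exp (- growth_exp \<eta> 1) \<le> growth_exp \<eta> 1" using exp_ge_add_one_self[of "- growth_exp \<eta> 1"] by simp
    then have "e * (1 - exp (- growth_exp \<eta> 1)) \<le> e * growth_exp \<eta> 1" by (intro mult_left_mono) (auto simp: e_def)
    then have "(e - 1) / growth_exp \<eta> 1 \<le> e"
      using g1 by (simp add: e_def right_diff_distrib divide_le_eq flip: exp_add)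
    then have "0.06 * \<sigma> * Y * ((e - 1) / growth_exp \<eta> 1) \<le> 0.06 * \<sigma> * Y * e"
      using \<sigma> Y by (intro mult_left_mono) auto
    then have "norm (mean_corr \<eta> 1 (D (a + 1)) - of_real e * mean_corr \<eta> 1 (D a)) \<le> 0.06 * \<sigma> * Y * e"
      by (rule order_trans[rotated]) (unfold e_def, rule B, use g1 in auto)
    moreover have "norm (of_real e * mean_corr \<eta> 1 (D a)) = e * Y" by (simp add: norm_mult Y_def e_def)
    ultimately have "norm (mean_corr \<eta> 1 (D (a + 1))) \<ge> e * ((1 - 0.06 * \<sigma>) * Y)"
      using norm_triangle_ineq2[of "of_real e * mean_corr \<eta> 1 (D a)" "mean_corr \<eta> 1 (D (a + 1))"]
      by (simp add: norm_minus_commute algebra_simps)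
    moreover have "(1 + 3/8 * \<sigma>) * ((1 - 0.06 * \<sigma>) * Y) \<le> e * ((1 - 0.06 * \<sigma>) * Y)"
      using e1 \<sigma> Y by (intro mult_right_mono) auto
    moreover have "(1 + \<sigma> / 4) * Y \<le> (1 + 3/8 * \<sigma>) * ((1 - 0.06 * \<sigma>) * Y)"
    proof -
      have "\<sigma> * \<sigma> \<le> \<sigma> * 1" using \<sigma> by (intro mult_left_mono) auto
      then have "1 + \<sigma> / 4 \<le> (1 + 3/8 * \<sigma>) * (1 - 0.06 * \<sigma>)" using \<sigma> by (simp add: algebra_simps)
      then have "(1 + \<sigma> / 4) * Y \<le> ((1 + 3/8 * \<sigma>) * (1 - 0.06 * \<sigma>)) * Y" by (rule mult_right_mono) (use Y in simp)
      then show ?thesis by (simp only: mult.assoc)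
    qed
    ultimately show ?thesis by linarith
  qed
  have p2: "norm (mean_corr \<eta> (-1) (D (a + 1))) \<le> Y"
  proof -
    define g where "g = - growth_exp \<eta> (-1)"
    have g: "g \<ge> \<sigma> / 2" "g > 0" "g \<le> 2 * \<sigma>" using gb g2 by (auto simp: g_def)
    define e where "e = exp (- g)"
    have e: "e \<ge> 1 - g" using exp_ge_add_one_self[of "- g"] by (simp add: e_def)
    have "e * (1 + g) \<le> e * exp g" using exp_ge_add_one_self[of g] by (intro mult_left_mono) (auto simp: e_def)
    then have e2: "e * (1 + g) \<le> 1" by (simp add: e_def exp_minus)
    have "(1 - e) / g \<le> 1" using e g by simp
    then have "0.06 * \<sigma> * Y * ((1 - e) / g) \<le> 0.06 * \<sigma> * Y * 1"
      using \<sigma> Y by (intro mult_left_mono) auto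
    moreover have "(exp (growth_exp \<eta> (-1)) - 1) / growth_exp \<eta> (-1) = (1 - e) / g"
      using g by (simp add: e_def g_def field_simps)
    moreover have "norm (mean_corr \<eta> (-1) (D (a + 1)) - of_real e * mean_corr \<eta> (-1) (D a))
       \<le> 0.06 * \<sigma> * Y * ((exp (growth_exp \<eta> (-1)) - 1) / growth_exp \<eta> (-1))"
      unfolding e_def g_def minus_minus by (rule B) (use g2 in auto)
    ultimately have "norm (mean_corr \<eta> (-1) (D (a + 1)) - of_real e * mean_corr \<eta> (-1) (D a)) \<le> 0.06 * \<sigma> * Y"
      by (simp only: mult_1_right)
    moreover have "norm (of_real e * mean_corr \<eta> (-1) (D a)) \<le> e * Y"
      using c by (simp add: norm_mult Y_def e_def dynamo_cone_def)
    ultimately have "norm (mean_corr \<eta> (-1) (D (a + 1))) \<le> (e + 0.06 * \<sigma>) * Y"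
      using norm_triangle_ineq2[of "mean_corr \<eta> (-1) (D (a + 1))" "of_real e * mean_corr \<eta> (-1) (D a)"] by (simp add: algebra_simps)
    also have "\<dots> \<le> 1 * Y"
    proof (rule mult_right_mono)
      \<comment> \<open>The inequality e (1 + g) \<le> 1 says e \<le> 1 - e g, and e g is at least
        1/2 * \<sigma>/2.\<close>
      have "e \<ge> 1 / 2" using e g \<sigma> by simp
      then have "1/2 * (\<sigma> / 2) \<le> e * g" using g \<sigma> by (intro mult_mono) auto
      then have "e \<le> 1 - \<sigma> / 4" using e2 by (simp add: algebra_simps)
      then show "e + 0.06 * \<sigma> \<le> 1" using \<sigma> by simp
    qed (use Y in simp)
    finally show ?thesis by simp
  qed
  have YY: "Y \<le> (1 + \<sigma> / 4) * Y" using \<sigma> Y by (simp add: algebra_simps)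
  show ?thesis
    unfolding dynamo_cone_def \<sigma>_def[symmetric]
  proof (intro conjI allI impI)
    show "0 < (1 + \<sigma> / 4) * X" using \<sigma> Y by (intro mult_pos_pos) auto
    have "(1 + \<sigma> / 4) * X \<le> (1 + \<sigma> / 4) * Y" using \<sigma> Y by (intro mult_left_mono) auto
    then show "(1 + \<sigma> / 4) * X \<le> norm (mean_corr \<eta> 1 (D (a + 1)))" using p1 by simp
    show "norm (mean_corr \<eta> (-1) (D (a + 1))) \<le> norm (mean_corr \<eta> 1 (D (a + 1)))" using p1 p2 YY by simp
    fix p q :: int and i :: 3 assume "(p, q) \<noteq> (0, 0)"
    then have "norm (D (a + 1) p q i) \<le> 16 * del * Y" using W(2)[of "a + 1"] by simp
    also have "\<dots> \<le> 16 * del * norm (mean_corr \<eta> 1 (D (a + 1)))"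
      using p1 YY del_bounds by (intro mult_left_mono) auto
    finally show "norm (D (a + 1) p q i) \<le> 16 * del * norm (mean_corr \<eta> 1 (D (a + 1)))" .
  qed
qed

lemma cell_growth:
  assumes \<eta>: "\<eta> \<in> {1..2}" and sol: "cell_sol \<eta> D a b" and c: "dynamo_cone \<eta> (D a) X" and "a + real n \<le> b"
  shows "dynamo_cone \<eta> (D (a + real n)) ((1 + kap * del\<^sup>2 / 4) ^ n * X)"
  using assms(4)
proof (induction n)
  case 0
  then show ?case using c by simp
next
  case (Suc n)
  have sub: "{a + real n..a + real n + 1} \<subseteq> {a..b}" using Suc.prems by auto
  have "cell_sol \<eta> D (a + real n) (a + real n + 1)"
    unfolding cell_sol_def
  proof (intro conjI ballI allI)
    show "\<exists>C. \<forall>t\<in>{a + real n..a + real n + 1}. \<forall>p q i. norm (D t p q i) \<le> C"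
          proof -
      obtain C where "\<forall>t\<in>{a..b}. \<forall>p q i. norm (D t p q i) \<le> C"
        using sol unfolding cell_sol_def by blast
      then show ?thesis using sub by (intro exI[of _ C]) auto
    qed
    fix t assume t: "t \<in> {a + real n..a + real n + 1}"
    show "D t 0 0 3 = 0" using sol t sub by (auto simp: cell_sol_def)
    show "((\<lambda>t. D t p q i) has_vector_derivative cell_rhs \<eta> (D t) p q i) (at t within {a + real n..a + real n + 1})" for p q i
      by (rule has_vector_derivative_within_subset[OF _ sub]) (use sol t sub in \<open>auto simp: cell_sol_def\<close>)
  qed
  then have "dynamo_cone \<eta> (D (a + real n + 1)) ((1 + kap * del\<^sup>2 / 4) * ((1 + kap * del\<^sup>2 / 4) ^ n * X))"
    using Suc by (intro window_step \<eta>) auto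
  then show ?case by (simp add: algebra_simps)
qed

section \<open>The velocity schedule\<close>

datatype phase = Rest | Seed nat | Dyn nat

text \<open>The inverse of \<open>kap\<close>. Being an integer, it makes N \<open>scale_inv\<close>
  (p, q, \<open>kap\<close>) a lattice vector and the flow of wave number N \<open>scale_inv\<close>
  periodic on the torus.\<close>

definition scale_inv :: real where "scale_inv = 1600000000"

lemma scale_inv_kap: "scale_inv * kap = 1" by (simp add: scale_inv_def kap_def del_def power2_eq_square)

fun wave :: "phase \<Rightarrow> real" where
  "wave Rest = 0" | "wave (Seed N) = real N" | "wave (Dyn N) = real N * scale_inv"

text \<open>Together with \<open>sinamp\<close> this encodes (1/N) (cos Nz, sin Nz, 0) for
  \<open>Seed N\<close> and, with m = N \<open>scale_inv\<close>, (\<open>del\<close>/m) ((0, cos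
  mx, -sin mx) + (cos my, 0, sin my)) for \<open>Dyn N\<close>. Both amplitudes are inversely
  proportional to the wave number.\<close>

fun cosamp :: "phase \<Rightarrow> 3 \<Rightarrow> real^3" where
  "cosamp Rest l = 0"
| "cosamp (Seed N) l = (if l = 3 then (1 / real N) *\<^sub>R axis 1 1 else 0)"
| "cosamp (Dyn N) l = (if l = 1 then (del / (real N * scale_inv)) *\<^sub>R axis 2 1
     else if l = 2 then (del / (real N * scale_inv)) *\<^sub>R axis 1 1 else 0)"

fun sinamp :: "phase \<Rightarrow> 3 \<Rightarrow> real^3" where
  "sinamp Rest l = 0"
| "sinamp (Seed N) l = (if l = 3 then (1 / real N) *\<^sub>R axis 2 1 else 0)"
| "sinamp (Dyn N) l = (if l = 1 then (- del / (real N * scale_inv)) *\<^sub>R axis 3 1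
     else if l = 2 then (del / (real N * scale_inv)) *\<^sub>R axis 3 1 else 0)"

section \<open>Size of the induction term in each phase\<close>

definition phase_rhs :: "real \<Rightarrow> phase \<Rightarrow> (real^3 \<Rightarrow> 3 \<Rightarrow> complex) \<Rightarrow> real^3 \<Rightarrow> 3 \<Rightarrow> complex" where
  "phase_rhs \<epsilon> p = mode_rhs \<epsilon> (wave p) (cosamp p) (sinamp p)"

definition phase_amp :: "phase \<Rightarrow> 3 \<Rightarrow> 3 \<Rightarrow> complex" where
  "phase_amp p = fourier_amp (cosamp p) (sinamp p)"

text \<open>Recording the directions that carry a wave makes it possible to treat a set of modes
  closed only under the shifts that occur; in the seed phase these are vertical.\<close>

definition active :: "phase \<Rightarrow> 3 \<Rightarrow> bool" where
  "active p l \<longleftrightarrow> (\<exists>j. phase_amp p l j \<noteq> 0)"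

lemma wave_Ints: "wave p \<in> \<int>"
  by (cases p) (auto simp: scale_inv_def intro!: Ints_mult)

lemma abs_fourier_amp_le: "\<bar>cosamp p l $ j\<bar> \<le> 1" "\<bar>sinamp p l $ j\<bar> \<le> 1"
proof -
  have *: "\<bar>1 / real N\<bar> \<le> 1" for N by (cases "N = 0") auto
  have **: "\<bar>del / (real N * scale_inv)\<bar> \<le> 1" for N
    by (cases "N = 0") (auto simp: del_def scale_inv_def field_simps)
  show "\<bar>cosamp p l $ j\<bar> \<le> 1" by (cases p) (use * ** in \<open>auto simp: axis_def\<close>)
  show "\<bar>sinamp p l $ j\<bar> \<le> 1" by (cases p) (use * ** in \<open>auto simp: axis_def\<close>)
qed

lemma norm_phase_amp: "norm (phase_amp p l j) \<le> 1"
proof -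
  have "norm (phase_amp p l j) \<le> \<bar>Re (phase_amp p l j)\<bar> + \<bar>Im (phase_amp p l j)\<bar>" by (rule cmod_le)
  also have "\<dots> \<le> 1" using abs_fourier_amp_le[of p l j] by (simp add: phase_amp_def fourier_amp_def)
  finally show ?thesis .
qed

lemma int_vec_shift:
  assumes "int_vec k"
  shows "int_vec (k + shift (wave p) l)" "int_vec (k - shift (wave p) l)"
  using assms wave_Ints[of p] by (auto simp: int_vec_def shift_def axis_def)

text \<open>The constant counts 3 directions, 3 indices j and 4 products, each at most
  \<open>norm k * X\<close>.\<close>

lemma norm_induction_term:
  assumes c: "\<And>l j. active p l \<Longrightarrow> norm (c (k - shift (wave p) l) j) \<le> X"
    "\<And>l j. active p l \<Longrightarrow> norm (c (k + shift (wave p) l) j) \<le> X" and X: "0 \<le> X"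
  shows "norm (induction_term (wave p) (cosamp p) (sinamp p) c k i) \<le> 36 * norm k * X"
proof -
  have summand: "norm (of_real (k $ j) * (phase_amp p l j * c (k - shift (wave p) l) i - phase_amp p l i * c (k - shift (wave p) l) j
       + (cnj (phase_amp p l j) * c (k + shift (wave p) l) i - cnj (phase_amp p l i) * c (k + shift (wave p) l) j))) \<le> norm k * (4 * X)" for l j
  proof (cases "active p l")
    case True
    have b: "norm (u * c k' j') \<le> X" if "norm u \<le> 1" "k' = k - shift (wave p) l \<or> k' = k + shift (wave p) l" for u k' j'
      using mult_mono[OF that(1), of "norm (c k' j')" X] c(1,2)[OF True, of j'] that X by (auto simp: norm_mult)
    have "norm (phase_amp p l j * c (k - shift (wave p) l) i - phase_amp p l i * c (k - shift (wave p) l) j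
       + (cnj (phase_amp p l j) * c (k + shift (wave p) l) i - cnj (phase_amp p l i) * c (k + shift (wave p) l) j)) \<le> (X + X) + (X + X)"
      by (intro order_trans[OF norm_triangle_ineq] add_mono order_trans[OF norm_triangle_ineq4] b) (auto simp: norm_phase_amp)
    then show ?thesis unfolding norm_mult using component_le_norm_cart[of k j] by (intro mult_mono) auto
  next
    case False
    then show ?thesis using X by (simp add: active_def)
  qed
  have "norm (induction_term (wave p) (cosamp p) (sinamp p) c k i) \<le> (\<Sum>l\<in>(UNIV::3 set). \<Sum>j\<in>(UNIV::3 set). norm k * (4 * X))"
    unfolding induction_term_def norm_mult norm_minus_cancel norm_ii mult_1 phase_amp_def[symmetric]
    by (intro sum_norm_le summand)
  also have "\<dots> = 36 * norm k * X" by simp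
  finally show ?thesis .
qed

section \<open>A priori bounds: crude exponential growth, and decay at rest\<close>

definition crude_rate :: "real \<Rightarrow> real" where "crude_rate \<epsilon> = 1296 / \<epsilon>"

text \<open>Young's inequality, from the square (\<epsilon> n - 36)^2 with 1296 = 36^2. Half of the
  right-hand sum is kept in reserve to supply the factor 1/2 of \<open>sup_absorb\<close>.\<close>

lemma young_crude_rate:
  assumes "\<epsilon> > 0"
  shows "36 * n \<le> (\<epsilon> * n\<^sup>2 + crude_rate \<epsilon>) / 2"
proof -
  have "0 \<le> (\<epsilon> * n - 36)\<^sup>2 / \<epsilon>" using assms by simp
  also have "(\<epsilon> * n - 36)\<^sup>2 / \<epsilon> = \<epsilon> * n\<^sup>2 - 72 * n + crude_rate \<epsilon>"
    using assms by (simp add: crude_rate_def field_simps power2_eq_square)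
  finally show ?thesis by simp
qed

definition phase_sol :: "real \<Rightarrow> phase \<Rightarrow> (real \<Rightarrow> real^3 \<Rightarrow> 3 \<Rightarrow> complex) \<Rightarrow> real \<Rightarrow> real \<Rightarrow> (real^3) set \<Rightarrow> bool" where
  "phase_sol \<epsilon> p c a b K \<longleftrightarrow> (\<forall>t\<in>{a..b}. \<forall>k\<in>K. \<forall>i.
     ((\<lambda>t. c t k i) has_vector_derivative phase_rhs \<epsilon> p (c t) k i) (at t within {a..b}))"

text \<open>Multiplying by exp(-L (t - a)) adds L to the damping, and half of \<epsilon> |k|^2 + L
  absorbs the induction term of size 36 |k|. The rate depends on neither the phase nor the scale. K
  may be any family of modes invariant under the active shifts, which isolates it from the modes
  outside.\<close>

lemma crude_bound:
  assumes \<epsilon>: "\<epsilon> > 0" and sol: "phase_sol \<epsilon> p c a b K"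
    and closed: "\<And>k l. k \<in> K \<Longrightarrow> active p l \<Longrightarrow> k - shift (wave p) l \<in> K \<and> k + shift (wave p) l \<in> K"
    and bdd: "\<And>t k i. t \<in> {a..b} \<Longrightarrow> k \<in> K \<Longrightarrow> norm (c t k i) \<le> M"
    and init: "\<And>k i. k \<in> K \<Longrightarrow> norm (c a k i) \<le> X" and X: "0 \<le> X"
    and t: "t \<in> {a..b}" and k: "k \<in> K"
  shows "norm (c t k i) \<le> exp (crude_rate \<epsilon> * (t - a)) * X"
proof -
  define L where "L = crude_rate \<epsilon>"
  have L: "L > 0" using \<epsilon> by (simp add: L_def crude_rate_def)
  define y where "y t k i = exp (- L * (t - a)) *\<^sub>R c t k i" for t k i
  define h where "h = (\<lambda>(t, k, i). norm (y t k i))"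
  define Z :: "(real \<times> (real^3) \<times> 3) set" where "Z = {(t, k, i). t \<in> {a..b} \<and> k \<in> K}"
  have "h (t, k, i) \<le> X"
  proof (rule sup_absorb[where Z = Z and M = M])
    show "h z \<le> M" if z: "z \<in> Z" for z
    proof -
      obtain t k i where [simp]: "z = (t, k, i)" and t: "t \<in> {a..b}" "k \<in> K" using z by (auto simp: Z_def)
      have "norm (y t k i) = exp (- L * (t - a)) * norm (c t k i)" by (simp add: y_def)
      also have "\<dots> \<le> 1 * norm (c t k i)" using t L by (intro mult_right_mono) auto
      finally show ?thesis using bdd[OF t, of i] by (simp add: h_def)
    qed
    show "h z \<le> max X (C / 2)" if C: "0 \<le> C" and hC: "\<And>z. z \<in> Z \<Longrightarrow> h z \<le> C" and z: "z \<in> Z" for C z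
    proof -
      obtain t k i where [simp]: "z = (t, k, i)" and t: "t \<in> {a..b}" and k: "k \<in> K" using z by (auto simp: Z_def)
      define l where "l = \<epsilon> * (norm k)\<^sup>2 + L"
      have l: "l > 0" using \<epsilon> L by (simp add: l_def add_nonneg_pos)
      have cb: "norm (c t k i) \<le> exp (L * (t - a)) * C" if "t \<in> {a..b}" "k \<in> K" for t k i
      proof -
        have "c t k i = exp (L * (t - a)) *\<^sub>R y t k i"
          by (simp add: y_def flip: exp_add)
        moreover have "norm (y t k i) \<le> C" using hC[of "(t, k, i)"] that by (simp add: Z_def h_def)
        ultimately show ?thesis by (simp add: mult_left_mono)
      qed
      have "norm (y t k i) \<le> max (norm (y a k i)) (C / 2)"
      proof (rule damped_ode_max[where b = b and l = l
            and f = "\<lambda>s. exp (- L * (s - a)) *\<^sub>R induction_term (wave p) (cosamp p) (sinamp p) (c s) k i"])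
        fix s assume s: "s \<in> {a..b}"
        have d: "((\<lambda>t. c t k i) has_vector_derivative phase_rhs \<epsilon> p (c s) k i) (at s within {a..b})"
          using sol s k by (auto simp: phase_sol_def)
        show "((\<lambda>t. y t k i) has_vector_derivative
           exp (- L * (s - a)) *\<^sub>R induction_term (wave p) (cosamp p) (sinamp p) (c s) k i - of_real l * y s k i) (at s within {a..b})"
          unfolding y_def
          by (rule derivative_eq_intros d refl)+
             (simp add: phase_rhs_def mode_rhs_def l_def scaleR_conv_of_real algebra_simps)
        have "norm (induction_term (wave p) (cosamp p) (sinamp p) (c s) k i) \<le> 36 * norm k * (exp (L * (s - a)) * C)"
          using closed[OF k] C by (intro norm_induction_term cb s) auto
        then have "exp (- L * (s - a)) * norm (induction_term (wave p) (cosamp p) (sinamp p) (c s) k i)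
           \<le> exp (- L * (s - a)) * (36 * norm k * (exp (L * (s - a)) * C))"
          by (rule mult_left_mono) simp
        also have "\<dots> = (exp (- L * (s - a)) * exp (L * (s - a))) * (36 * norm k * C)"
          by (simp only: mult_ac)
        also have "exp (- L * (s - a)) * exp (L * (s - a)) = 1" by (simp flip: exp_add)
        also have "1 * (36 * norm k * C) \<le> l / 2 * C"
          using young_crude_rate[OF \<epsilon>, of "norm k"] C unfolding mult_1 l_def L_def by (intro mult_right_mono) auto
        finally show "norm (exp (- L * (s - a)) *\<^sub>R induction_term (wave p) (cosamp p) (sinamp p) (c s) k i) \<le> l * (C / 2)"
          by simp
      qed (use l t in auto)
      moreover have "norm (y a k i) \<le> X" using init[OF k] by (simp add: y_def)
      ultimately show ?thesis by (auto simp: h_def intro: order_trans[OF _ max.mono])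
    qed
    show "(t, k, i) \<in> Z" using t k by (simp add: Z_def)
    show "0 \<le> h z" for z by (auto simp: h_def split: prod.splits)
  qed (rule X)
  then have "norm (y t k i) \<le> X" by (simp add: h_def)
  moreover have "c t k i = exp (L * (t - a)) *\<^sub>R y t k i"
    by (simp add: y_def flip: exp_add)
  ultimately show ?thesis by (simp add: L_def mult_left_mono)
qed

text \<open>Without velocity the modes decouple, and each decays at rate \<epsilon> |k|^2.\<close>

lemma rest_decay:
  assumes \<epsilon>: "\<epsilon> > 0" and sol: "phase_sol \<epsilon> Rest c a b K" and k: "k \<in> K" "1 \<le> norm k" and t: "t \<in> {a..b}"
  shows "norm (c t k i) \<le> exp (- \<epsilon> * (t - a)) * norm (c a k i)"
proof -
  let ?\<nu> = "- (\<epsilon> * (norm k)\<^sup>2)"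
  have "norm (c t k i - of_real (exp (?\<nu> * (t - a))) * c a k i) \<le> 0 * ((exp (?\<nu> * (t - a)) - 1) / ?\<nu>)"
  proof (rule linear_ode_bound[where b = b and f = "\<lambda>_. 0"])
    fix s assume "s \<in> {a..b}"
    then have "((\<lambda>t. c t k i) has_vector_derivative phase_rhs \<epsilon> Rest (c s) k i) (at s within {a..b})"
      using sol k by (auto simp: phase_sol_def)
    moreover have "phase_rhs \<epsilon> Rest (c s) k i = of_real ?\<nu> * c s k i + 0"
    proof -
      have "phase_amp Rest l j = 0" for l j by (simp add: phase_amp_def fourier_amp_def complex_eq_iff)
      then show ?thesis by (simp add: phase_rhs_def mode_rhs_def induction_term_def phase_amp_def)
    qed
    ultimately show "((\<lambda>t. c t k i) has_vector_derivative of_real ?\<nu> * c s k i + 0) (at s within {a..b})" by simp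
  qed (use k \<epsilon> t in auto)
  then have "norm (c t k i) = exp (?\<nu> * (t - a)) * norm (c a k i)" by (simp add: norm_mult)
  also have "\<dots> \<le> exp (- \<epsilon> * (t - a)) * norm (c a k i)"
  proof -
    have "1 \<le> (norm k)\<^sup>2" using k by simp
    then have "\<epsilon> * 1 * (t - a) \<le> \<epsilon> * (norm k)\<^sup>2 * (t - a)"
      using \<epsilon> t by (intro mult_right_mono mult_left_mono) auto
    then show ?thesis by (intro mult_right_mono) auto
  qed
  finally show ?thesis .
qed

text \<open>The factor n + 2 makes the rest in epoch n long enough, for each fixed diffusivity and all large n,
  to beat the crude growth bound up to the start of the epoch.\<close>

fun epoch_start :: "nat \<Rightarrow> nat" where
  "epoch_start 0 = 1"
| "epoch_start (Suc n) = 4 * ((n + 2) * epoch_start n + 1)"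

definition rest_end :: "nat \<Rightarrow> nat" where "rest_end n = (n + 2) * epoch_start n"
text \<open>The first component of the inverse Cantor pairing takes each value for infinitely many
  n; the successor excludes scale 0.\<close>

definition epoch_scale :: "nat \<Rightarrow> nat" where "epoch_scale n = Suc (fst (prod_decode n))"
text \<open>Epoch 0 also covers all times before \<open>epoch_start 0\<close>, negative ones
  included, so the schedule is defined on the whole line.\<close>

definition epoch :: "real \<Rightarrow> nat" where "epoch t = (LEAST n. t < real (epoch_start (Suc n)))"
definition phase_at :: "real \<Rightarrow> phase" where
  "phase_at t = (if t < real (rest_end (epoch t)) then Rest
     else if t < real (rest_end (epoch t)) + 1 then Seed (epoch_scale (epoch t)) else Dyn (epoch_scale (epoch t)))"

section \<open>Order of the switching times, and the phase on each interval\<close>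

lemma epoch_start_Suc: "epoch_start (Suc n) = 4 * (rest_end n + 1)" by (simp add: rest_end_def)

lemma epoch_start_le_rest_end: "epoch_start n \<le> rest_end n" by (simp add: rest_end_def)

lemma rest_end_less_epoch_start: "rest_end n + 1 < epoch_start (Suc n)" unfolding epoch_start_Suc by simp

lemma epoch_start_less_Suc: "epoch_start n < epoch_start (Suc n)" using epoch_start_le_rest_end[of n] rest_end_less_epoch_start[of n] by linarith

lemma strict_mono_epoch_start: "strict_mono epoch_start"
  by (rule strict_monoI_Suc) (rule epoch_start_less_Suc)

lemma epoch_start_ge: "n < epoch_start n"
proof (induction n)
  case (Suc n)
  then show ?case using epoch_start_less_Suc[of n] by linarith
qed simp

declare epoch_start.simps(2) [simp del]

lemma epoch_eq:
  assumes "n = 0 \<or> real (epoch_start n) \<le> t" "t < real (epoch_start (Suc n))"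
  shows "epoch t = n"
  unfolding epoch_def
proof (rule Least_equality)
  show "t < real (epoch_start (Suc n))" by fact
  fix y assume y: "t < real (epoch_start (Suc y))"
  show "n \<le> y"
  proof (rule ccontr)
    assume "\<not> n \<le> y"
    then have "Suc y \<le> n" by simp
    then have "epoch_start (Suc y) \<le> epoch_start n" using strict_mono_epoch_start by (simp add: strict_mono_less_eq)
    then show False using y assms \<open>\<not> n \<le> y\<close> by (auto simp: not_le)
  qed
qed

lemma phase_at_rest0: "t < 2 \<Longrightarrow> phase_at t = Rest"
proof -
  assume t: "t < 2"
  have "rest_end 0 = 2" by (simp add: rest_end_def)
  moreover have "epoch t = 0" by (rule epoch_eq) (use t rest_end_less_epoch_start[of 0] \<open>rest_end 0 = 2\<close> in auto)
  ultimately show ?thesis using t by (simp add: phase_at_def)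
qed

lemma phase_at_rest: "t \<in> {real (epoch_start n)..<real (rest_end n)} \<Longrightarrow> phase_at t = Rest"
  using epoch_eq[of n t] rest_end_less_epoch_start[of n] by (simp add: phase_at_def)

lemma phase_at_seed: "t \<in> {real (rest_end n)..<real (rest_end n) + 1} \<Longrightarrow> phase_at t = Seed (epoch_scale n)"
  using epoch_eq[of n t] rest_end_less_epoch_start[of n] epoch_start_le_rest_end[of n] by (simp add: phase_at_def)

lemma phase_at_dyn: "t \<in> {real (rest_end n) + 1..<real (epoch_start (Suc n))} \<Longrightarrow> phase_at t = Dyn (epoch_scale n)"
  using epoch_eq[of n t] rest_end_less_epoch_start[of n] epoch_start_le_rest_end[of n] by (simp add: phase_at_def)

text \<open>What an arbitrary weak solution provides, in terms of coefficients. The equation stays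
  in integrated form because its right-hand side jumps at the switching times. The local bound is
  uniform in k, as \<open>sup_absorb\<close> requires.\<close>

definition mode_sol :: "real \<Rightarrow> (real \<Rightarrow> real^3 \<Rightarrow> 3 \<Rightarrow> complex) \<Rightarrow> bool" where
  "mode_sol \<epsilon> c \<longleftrightarrow>
     (\<forall>k i. int_vec k \<longrightarrow> continuous_on {0..} (\<lambda>t. c t k i) \<and>
        (\<forall>t\<ge>0. ((\<lambda>s. phase_rhs \<epsilon> (phase_at s) (c s) k i) has_integral (c t k i - c 0 k i)) {0..t})) \<and>
     (\<forall>T. \<exists>C. \<forall>t\<in>{0..T}. \<forall>k i. int_vec k \<longrightarrow> norm (c t k i) \<le> C) \<and>
     (\<forall>t\<ge>0. \<forall>k. int_vec k \<longrightarrow> (\<Sum>i\<in>UNIV. of_real (k $ i) * c t k i) = 0)"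

lemma continuous_phase_rhs:
  assumes "int_vec k" "\<And>k i. int_vec k \<Longrightarrow> continuous_on S (\<lambda>t. c t k i)"
  shows "continuous_on S (\<lambda>t. phase_rhs \<epsilon> p (c t) k i)"
  unfolding phase_rhs_def mode_rhs_def induction_term_def
  by (intro continuous_intros assms int_vec_shift)

text \<open>Within one phase the integrand is continuous, so the integrated equation can be
  differentiated, one-sidedly at the end points.\<close>

lemma phase_solI:
  assumes sol: "mode_sol \<epsilon> c" and ab: "0 \<le> a" "a \<le> b" and p: "\<And>s. s \<in> {a..<b} \<Longrightarrow> phase_at s = p"
  shows "phase_sol \<epsilon> p c a b (Collect int_vec)"
  unfolding phase_sol_def
proof (intro ballI allI)
  fix t k i assume t: "t \<in> {a..b}" and "k \<in> Collect int_vec"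
  then have k: "int_vec k" by simp
  let ?g = "\<lambda>s. phase_rhs \<epsilon> p (c s) k i"
  let ?f = "\<lambda>s. phase_rhs \<epsilon> (phase_at s) (c s) k i"
  have cont: "continuous_on {a..b} (\<lambda>t. c t k i)" if "int_vec k" for k i
  proof -
    have "continuous_on {0..} (\<lambda>t. c t k i)" using sol that by (simp add: mode_sol_def)
    then show ?thesis by (rule continuous_on_subset) (use ab in auto)
  qed
  have cg: "continuous_on {a..b} ?g" by (intro continuous_phase_rhs k cont)
  have int: "(?f has_integral (c t k i - c 0 k i)) {0..t}" if "t \<ge> 0" for t
    using sol that k by (auto simp: mode_sol_def)
  have eq: "c a k i + integral {a..t} ?g = c t k i" if t: "t \<in> {a..b}" for t
  proof -
    have i0: "?f integrable_on {0..t}" using int[of t] t ab by auto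
    then have "integral {0..a} ?f + integral {a..t} ?f = integral {0..t} ?f"
      using t ab by (intro Henstock_Kurzweil_Integration.integral_combine) auto
    moreover have "integral {0..a} ?f = c a k i - c 0 k i" "integral {0..t} ?f = c t k i - c 0 k i"
      using int[of a] int[of t] t ab by (auto intro: integral_unique)
    \<comment> \<open>At b the next phase may already be in force, so the two integrands may differ
      at that single point.\<close>
    moreover have "integral {a..t} ?f = integral {a..t} ?g"
      by (rule integral_spike[where S = "{b}"]) (use p t in auto)
    ultimately show ?thesis by (simp add: algebra_simps)
  qed
  have "((\<lambda>t. c a k i + integral {a..t} ?g) has_vector_derivative 0 + ?g t) (at t within {a..b})"
    by (intro has_vector_derivative_add has_vector_derivative_const integral_has_vector_derivative cg t)
  then have "((\<lambda>t. c a k i + integral {a..t} ?g) has_vector_derivative ?g t) (at t within {a..b})" by simp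
  then show "((\<lambda>t. c t k i) has_vector_derivative ?g t) (at t within {a..b})"
    by (rule has_vector_derivative_transform[OF t, rotated]) (use eq in auto)
qed

lemma mode_sol_mean:
  assumes "mode_sol \<epsilon> c" "t \<ge> 0"
  shows "c t 0 i = c 0 0 i"
proof -
  have "((\<lambda>s. phase_rhs \<epsilon> (phase_at s) (c s) 0 i) has_integral (c t 0 i - c 0 0 i)) {0..t}"
    using assms by (auto simp: mode_sol_def int_vec_def)
  moreover have "phase_rhs \<epsilon> (phase_at s) (c s) 0 i = 0" for s
    by (simp add: phase_rhs_def mode_rhs_def induction_term_def)
  ultimately have "((\<lambda>s. 0) has_integral (c t 0 i - c 0 0 i)) {0..t}" by simp
  then show ?thesis using has_integral_unique[OF has_integral_0] by fastforce
qed

lemma mode_sol_phase_bound: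
  assumes \<epsilon>: "\<epsilon> > 0" and sol: "mode_sol \<epsilon> c" and ab: "0 \<le> a" "a \<le> b" and p: "\<And>s. s \<in> {a..<b} \<Longrightarrow> phase_at s = p"
    and init: "\<And>k i. int_vec k \<Longrightarrow> norm (c a k i) \<le> exp (crude_rate \<epsilon> * a) * V" and V: "0 \<le> V" and k: "int_vec k"
  shows "norm (c b k i) \<le> exp (crude_rate \<epsilon> * b) * V"
proof -
  obtain C where C: "\<And>t k i. t \<in> {0..b} \<Longrightarrow> int_vec k \<Longrightarrow> norm (c t k i) \<le> C"
    using sol unfolding mode_sol_def by blast
  have "norm (c b k i) \<le> exp (crude_rate \<epsilon> * (b - a)) * (exp (crude_rate \<epsilon> * a) * V)"
    by (rule crude_bound[OF \<epsilon> phase_solI[OF sol ab p], where M = C])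
       (use C ab init V k int_vec_shift in auto)
  also have "\<dots> = exp (crude_rate \<epsilon> * (b - a) + crude_rate \<epsilon> * a) * V" by (simp add: exp_add)
  also have "crude_rate \<epsilon> * (b - a) + crude_rate \<epsilon> * a = crude_rate \<epsilon> * b" by (simp add: algebra_simps)
  finally show ?thesis .
qed

text \<open>All phases share the same \<open>crude_rate\<close>, so the growth factors of successive
  phases multiply to one exponential in absolute time.\<close>

lemma mode_sol_bound:
  assumes \<epsilon>: "\<epsilon> > 0" and sol: "mode_sol \<epsilon> c"
    and init: "\<And>k i. int_vec k \<Longrightarrow> norm (c 0 k i) \<le> V" and V: "0 \<le> V" and k: "int_vec k"
  shows "norm (c (real (epoch_start n)) k i) \<le> exp (crude_rate \<epsilon> * real (epoch_start n)) * V"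
  using k
proof (induction n arbitrary: k i)
  case 0
  show ?case
    by (rule mode_sol_phase_bound[OF \<epsilon> sol, where a = 0 and p = Rest])
       (use init V 0 in \<open>auto intro: phase_at_rest0\<close>)
next
  case (Suc n)
  have 1: "norm (c (real (rest_end n)) k i) \<le> exp (crude_rate \<epsilon> * real (rest_end n)) * V" if "int_vec k" for k i
    by (rule mode_sol_phase_bound[OF \<epsilon> sol, where a = "real (epoch_start n)" and p = Rest])
       (use Suc.IH V that epoch_start_le_rest_end phase_at_rest in auto)
  have 2: "norm (c (real (rest_end n) + 1) k i) \<le> exp (crude_rate \<epsilon> * (real (rest_end n) + 1)) * V" if "int_vec k" for k i
    by (rule mode_sol_phase_bound[OF \<epsilon> sol, where a = "real (rest_end n)" and p = "Seed (epoch_scale n)"])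
       (use 1 V that phase_at_seed in auto)
  show ?case
    by (rule mode_sol_phase_bound[OF \<epsilon> sol, where a = "real (rest_end n) + 1" and p = "Dyn (epoch_scale n)"])
       (use 2 V Suc.prems phase_at_dyn rest_end_less_epoch_start[of n] in auto)
qed

section \<open>Restriction to the lattice of the cell, and the source in the seed phase\<close>

definition cell_mode :: "nat \<Rightarrow> int \<Rightarrow> int \<Rightarrow> real^3" where
  "cell_mode N p q = (\<chi> j. real N * scale_inv * wavevec p q j)"

lemma cell_mode_shift:
  "cell_mode N p q - shift (wave (Dyn N)) 1 = cell_mode N (p - 1) q" "cell_mode N p q + shift (wave (Dyn N)) 1 = cell_mode N (p + 1) q"
  "cell_mode N p q - shift (wave (Dyn N)) 2 = cell_mode N p (q - 1)" "cell_mode N p q + shift (wave (Dyn N)) 2 = cell_mode N p (q + 1)"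
  by (auto simp: cell_mode_def shift_def vec_eq_iff forall_3 axis_def algebra_simps)

text \<open>The mean field of \<open>Dyn N\<close> thus has vertical wave number N, the one that
  \<open>Seed N\<close> excites.\<close>

lemma cell_mode_3: "cell_mode N p q $ 3 = real N"
  using scale_inv_kap by (simp add: cell_mode_def mult.assoc)

lemma int_vec_cell_mode: "int_vec (cell_mode N p q)"
  unfolding int_vec_def forall_3 cell_mode_3 by (auto simp: cell_mode_def scale_inv_def intro!: Ints_mult)

lemma norm_cell_mode: "(norm (cell_mode N p q))\<^sup>2 = (real N * scale_inv)\<^sup>2 * ((of_int p)\<^sup>2 + (of_int q)\<^sup>2 + kap\<^sup>2)"
  by (simp add: norm_vec_def L2_set_def sum_3 cell_mode_def power_mult_distrib algebra_simps add_nonneg_nonneg)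

lemma phase_amp_Dyn: "phase_amp (Dyn N) 1 j = of_real (del / (real N * scale_inv)) * helical_x j"
  "phase_amp (Dyn N) 2 j = of_real (del / (real N * scale_inv)) * helical_y j" "phase_amp (Dyn N) 3 j = 0"
  using exhaust_3[of j] by (auto simp: phase_amp_def fourier_amp_def complex_eq_iff axis_def)

text \<open>The scaling relation: with m = N \<open>scale_inv\<close>, the factor m of the wave
  vector cancels against the amplitude \<open>del\<close> / m, and the diffusivity becomes
  \<epsilon> m^2. On this sublattice the full system is exactly the cell system.\<close>

lemma phase_rhs_Dyn:
  assumes "N > 0"
  shows "phase_rhs \<epsilon> (Dyn N) c (cell_mode N p q) i = cell_rhs (\<epsilon> * (real N * scale_inv)\<^sup>2) (\<lambda>p q. c (cell_mode N p q)) p q i"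
proof -
  define m where "m = real N * scale_inv"
  have m: "m \<noteq> 0" using assms by (simp add: m_def scale_inv_def)
  have k: "cell_mode N p q $ j = m * wavevec p q j" for j by (simp add: cell_mode_def m_def)
  have mm: "complex_of_real (m * x) * (of_real (del / m) * u * w - of_real (del / m) * u' * w' + (of_real (del / m) * v * z - of_real (del / m) * v' * z'))
     = of_real del * (of_real x * (u * w - u' * w')) + of_real del * (of_real x * (v * z - v' * z'))" for x u w u' w' v z v' z'
    using m by (simp add: field_simps)
  define T where "T l = (\<Sum>j\<in>UNIV. of_real (cell_mode N p q $ j) *
      (phase_amp (Dyn N) l j * c (cell_mode N p q - shift (wave (Dyn N)) l) i - phase_amp (Dyn N) l i * c (cell_mode N p q - shift (wave (Dyn N)) l) j
       + (cnj (phase_amp (Dyn N) l j) * c (cell_mode N p q + shift (wave (Dyn N)) l) i - cnj (phase_amp (Dyn N) l i) * c (cell_mode N p q + shift (wave (Dyn N)) l) j)))" for l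
  have T1: "T 1 = of_real del * cross_term (wavevec p q) helical_x (c (cell_mode N (p - 1) q)) i + of_real del * cross_term (wavevec p q) (\<lambda>j. cnj (helical_x j)) (c (cell_mode N (p + 1) q)) i"
    unfolding T_def cell_mode_shift phase_amp_Dyn complex_cnj_mult complex_cnj_complex_of_real m_def[symmetric] k mm cross_term_def
    by (simp only: sum.distrib sum_distrib_left)
  have T2: "T 2 = of_real del * cross_term (wavevec p q) helical_y (c (cell_mode N p (q - 1))) i + of_real del * cross_term (wavevec p q) (\<lambda>j. cnj (helical_y j)) (c (cell_mode N p (q + 1))) i"
    unfolding T_def cell_mode_shift phase_amp_Dyn complex_cnj_mult complex_cnj_complex_of_real m_def[symmetric] k mm cross_term_def
    by (simp only: sum.distrib sum_distrib_left)
  have T3: "T 3 = 0" unfolding T_def phase_amp_Dyn by simp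
  have "induction_term (wave (Dyn N)) (cosamp (Dyn N)) (sinamp (Dyn N)) c (cell_mode N p q) i = - \<i> * (T 1 + T 2 + T 3)"
    unfolding induction_term_def T_def phase_amp_def[symmetric] by (rule arg_cong[OF sum_3])
  also have "\<dots> = cell_induction (\<lambda>p q. c (cell_mode N p q)) p q i"
    unfolding T1 T2 T3 cell_induction_def by (simp add: algebra_simps)
  finally have "induction_term (wave (Dyn N)) (cosamp (Dyn N)) (sinamp (Dyn N)) c (cell_mode N p q) i = cell_induction (\<lambda>p q. c (cell_mode N p q)) p q i" .
  then show ?thesis by (simp add: phase_rhs_def mode_rhs_def cell_rhs_def norm_cell_mode mult.assoc)
qed

text \<open>Two modes feed (0, 0, N): the conserved mean, and (0, 0, 2N), whose vertical component
  vanishes for a solenoidal field. The sources i/2 and 1/2 add up in the polarisation s = 1 and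
  cancel in s = -1.\<close>

lemma seed_mode:
  assumes N: "N > 0" and z: "c (cell_mode N 0 0 + shift (real N) 3) 3 = 0"
  shows "phase_rhs \<epsilon> (Seed N) c (cell_mode N 0 0) 1 = \<i> / 2 * c 0 3 - of_real (\<epsilon> * (norm (cell_mode N 0 0))\<^sup>2) * c (cell_mode N 0 0) 1"
    and "phase_rhs \<epsilon> (Seed N) c (cell_mode N 0 0) 2 = 1 / 2 * c 0 3 - of_real (\<epsilon> * (norm (cell_mode N 0 0))\<^sup>2) * c (cell_mode N 0 0) 2"
proof -
  have P: "phase_amp (Seed N) l j = (if l = 3 then (if j = 1 then of_real (1 / (2 * real N)) else if j = 2 then - \<i> * of_real (1 / (2 * real N)) else 0) else 0)" for l j
    by (auto simp: phase_amp_def fourier_amp_def complex_eq_iff axis_def)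
  have k0: "cell_mode N 0 0 - shift (wave (Seed N)) 3 = 0"
    using scale_inv_kap by (auto simp: cell_mode_def shift_def vec_eq_iff forall_3 axis_def)
  have kj: "cell_mode N 0 0 $ 1 = 0" "cell_mode N 0 0 $ 2 = 0" "cell_mode N 0 0 $ 3 = real N"
    by (simp_all add: cell_mode_3) (simp_all add: cell_mode_def)
  show "phase_rhs \<epsilon> (Seed N) c (cell_mode N 0 0) 1 = \<i> / 2 * c 0 3 - of_real (\<epsilon> * (norm (cell_mode N 0 0))\<^sup>2) * c (cell_mode N 0 0) 1"
    "phase_rhs \<epsilon> (Seed N) c (cell_mode N 0 0) 2 = 1 / 2 * c 0 3 - of_real (\<epsilon> * (norm (cell_mode N 0 0))\<^sup>2) * c (cell_mode N 0 0) 2"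
    unfolding phase_rhs_def mode_rhs_def induction_term_def phase_amp_def[symmetric] P sum_3 k0 kj
    using N z by (simp_all add: field_simps)
qed

section \<open>Growth over one epoch\<close>

lemma norm_int_vec_ge_1:
  assumes "int_vec k" "k \<noteq> 0"
  shows "1 \<le> norm k"
proof -
  obtain i where "k $ i \<noteq> 0" using assms(2) by (auto simp: vec_eq_iff)
  moreover have "k $ i \<in> \<int>" using assms(1) by (simp add: int_vec_def)
  ultimately have "1 \<le> \<bar>k $ i\<bar>" using Ints_nonzero_abs_ge1 by blast
  then show ?thesis using component_le_norm_cart[of k i] by linarith
qed

lemma phase_sol_subset: "phase_sol \<epsilon> p c a b K \<Longrightarrow> K' \<subseteq> K \<Longrightarrow> phase_sol \<epsilon> p c a b K'"
  by (auto simp: phase_sol_def)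

lemma norm_corr_weight_le:
  assumes "\<eta> \<in> {1..2}" "0 \<le> B" "norm z \<le> 8 * B"
  shows "norm (of_real (del * kap / \<eta>) * z :: complex) \<le> 8 * B"
proof -
  have "del * kap / \<eta> \<le> 1 * 1 / 1" using assms del_bounds kap_bounds by (intro frac_le mult_mono) auto
  then have "del * kap / \<eta> * norm z \<le> 1 * (8 * B)"
    using assms del_bounds kap_bounds by (intro mult_mono) auto
  then show ?thesis using assms by (subst norm_del_kap_mult) auto
qed

text \<open>The hypothesis \<open>small\<close> states that crude growth up to the epoch, decay
  during the rest and one further unit of crude growth leave at most \<open>del\<close> times the
  mean. The seed then places the state in the cone with X = V / 4, and the cellular flow runs for 3
  (\<open>rest_end n\<close> + 1) unit windows. The constant 40 is this 4 times the 10 lost in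
  passing from \<open>mean_corr\<close> to one coefficient.\<close>

lemma epoch_growth:
  assumes \<epsilon>: "\<epsilon> > 0" and sol: "mode_sol \<epsilon> c" and V: "V > 0"
    and init: "\<And>k i. int_vec k \<Longrightarrow> norm (c 0 k i) \<le> V" and mean: "c 0 0 3 = of_real V"
    and \<eta>: "\<epsilon> * (real (epoch_scale n) * scale_inv)\<^sup>2 \<in> {1..2}"
    and small: "exp (crude_rate \<epsilon> * real (epoch_start n) - \<epsilon> * (real (Suc n) * real (epoch_start n)) + crude_rate \<epsilon>) \<le> del"
  shows "\<exists>k i. int_vec k \<and> (1 + kap * del\<^sup>2 / 4) ^ (3 * (rest_end n + 1)) * (V / 40) \<le> norm (c (real (epoch_start (Suc n))) k i)"
proof -
  define N where "N = epoch_scale n"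
  define \<eta> where "\<eta> = \<epsilon> * (real N * scale_inv)\<^sup>2"
  have N: "N > 0" by (simp add: N_def epoch_scale_def)
  have eta: "\<eta> \<in> {1..2}" using assms(6) by (simp add: \<eta>_def N_def)
  define s where "s = real (rest_end n)"
  \<comment> \<open>r bounds every mode except k = 0 at the end of the rest; R adds the growth
    possible during the seed phase of length 1.\<close>
  define r where "r = exp (crude_rate \<epsilon> * real (epoch_start n) - \<epsilon> * (real (Suc n) * real (epoch_start n))) * V"
  define R where "R = exp (crude_rate \<epsilon>) * r"
  have crude_rate: "crude_rate \<epsilon> > 0" using \<epsilon> by (simp add: crude_rate_def)
  have r0: "r \<ge> 0" using V by (simp add: r_def)
  have rR: "r \<le> R" using crude_rate mult_right_mono[of 1 "exp (crude_rate \<epsilon>)" r] r0 by (simp add: R_def)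
  have "R = exp (crude_rate \<epsilon> * real (epoch_start n) - \<epsilon> * (real (Suc n) * real (epoch_start n)) + crude_rate \<epsilon>) * V"
    unfolding R_def r_def by (simp add: exp_add)
  also have "\<dots> \<le> del * V" using small V by (intro mult_right_mono) auto
  finally have R: "R \<le> del * V" .
  have s0: "s \<ge> 0" by (simp add: s_def)
  have ts: "real (epoch_start n) \<le> s" using epoch_start_le_rest_end[of n] by (simp add: s_def)
  have stt: "s - real (epoch_start n) = real (Suc n) * real (epoch_start n)" by (simp add: s_def rest_end_def algebra_simps)
  have rest: "norm (c s k i) \<le> r" if k: "int_vec k" "k \<noteq> 0" for k i
  proof -
    have ps: "phase_sol \<epsilon> Rest c (real (epoch_start n)) s (Collect int_vec)"
      by (rule phase_solI[OF sol]) (use ts phase_at_rest in \<open>auto simp: s_def\<close>)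
    have "norm (c s k i) \<le> exp (- \<epsilon> * (s - real (epoch_start n))) * norm (c (real (epoch_start n)) k i)"
      by (rule rest_decay[OF \<epsilon> ps]) (use k norm_int_vec_ge_1 ts in auto)
    also have "\<dots> \<le> exp (- \<epsilon> * (s - real (epoch_start n))) * (exp (crude_rate \<epsilon> * real (epoch_start n)) * V)"
      using V by (intro mult_left_mono mode_sol_bound \<epsilon> sol init k(1)) auto
    also have "\<dots> = exp (- \<epsilon> * (s - real (epoch_start n)) + crude_rate \<epsilon> * real (epoch_start n)) * V" by (simp only: exp_add mult.assoc)
    also have "- \<epsilon> * (s - real (epoch_start n)) + crude_rate \<epsilon> * real (epoch_start n) = crude_rate \<epsilon> * real (epoch_start n) - \<epsilon> * (real (Suc n) * real (epoch_start n))"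
      unfolding stt by simp
    finally show ?thesis by (simp add: r_def)
  qed
  have ps: "phase_sol \<epsilon> (Seed N) c s (s + 1) (Collect int_vec)"
    by (rule phase_solI[OF sol]) (use phase_at_seed in \<open>auto simp: s_def N_def\<close>)
  obtain C where C: "\<And>t k i. t \<in> {0..s + 1} \<Longrightarrow> int_vec k \<Longrightarrow> norm (c t k i) \<le> C"
    using sol unfolding mode_sol_def by blast
  \<comment> \<open>The seed flow depends on z alone, so its shifts preserve K. K omits the
    conserved mean, which acts as the source, and contains all cell modes with (p, q)
    nonzero.\<close>
  define K where "K = {k. int_vec k \<and> (k $ 1 \<noteq> 0 \<or> k $ 2 \<noteq> 0)}"
  have seed: "norm (c (s + 1) k i) \<le> R" if k: "k \<in> K" for k i
  proof -
    have act: "active (Seed N) l \<Longrightarrow> l = 3" for l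
      by (auto simp: active_def phase_amp_def fourier_amp_def complex_eq_iff split: if_splits)
    have "norm (c (s + 1) k i) \<le> exp (crude_rate \<epsilon> * (s + 1 - s)) * r"
    proof (rule crude_bound[OF \<epsilon> phase_sol_subset[OF ps], where M = C])
      show "k - shift (wave (Seed N)) l \<in> K \<and> k + shift (wave (Seed N)) l \<in> K" if "k \<in> K" "active (Seed N) l" for k l
        using that int_vec_shift[of k "Seed N" l] act[OF that(2)] by (auto simp: K_def shift_def axis_def)
      show "norm (c s k i) \<le> r" if "k \<in> K" for k i
        using that by (intro rest) (auto simp: K_def)
    qed (use k C s0 r0 in \<open>auto simp: K_def\<close>)
    then show ?thesis by (simp add: R_def)
  qed
  have kv0: "int_vec (cell_mode N 0 0)" "cell_mode N 0 0 \<noteq> 0"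
    using N int_vec_cell_mode cell_mode_3[of N 0 0] by (auto simp: vec_eq_iff forall_3)
  define x where "x = \<epsilon> * (norm (cell_mode N 0 0))\<^sup>2"
  have xe: "x = \<eta> * kap\<^sup>2" by (simp add: x_def norm_cell_mode \<eta>_def)
  have x: "0 < x" "x \<le> 1"
  proof -
    show "0 < x" using eta kap_bounds by (simp add: xe)
    have "\<eta> * kap\<^sup>2 \<le> 2 * (1/1000000000)\<^sup>2" using eta kap_bounds by (intro mult_mono power_mono) auto
    then show "x \<le> 1" by (simp add: xe power2_eq_square)
  qed
  have seedd: "((\<lambda>t. c t (cell_mode N 0 0) 1) has_vector_derivative \<i> / 2 * of_real V - of_real x * c t (cell_mode N 0 0) 1) (at t within {s..s + 1})"
    "((\<lambda>t. c t (cell_mode N 0 0) 2) has_vector_derivative 1 / 2 * of_real V - of_real x * c t (cell_mode N 0 0) 2) (at t within {s..s + 1})"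
    if t: "t \<in> {s..s + 1}" for t
  proof -
    define kk where "kk = cell_mode N 0 0 + shift (real N) 3"
    have t0: "t \<ge> 0" using t s0 by simp
    have ik: "int_vec kk" using int_vec_shift(1)[OF kv0(1), of "Seed N" 3] by (simp add: kk_def)
    have "kk $ 1 = 0" "kk $ 2 = 0" "kk $ 3 = 2 * real N"
      by (simp_all add: kk_def cell_mode_3 shift_def axis_def) (simp_all add: cell_mode_def)
    moreover have "(\<Sum>i\<in>UNIV. of_real (kk $ i) * c t kk i) = 0"
      using sol t0 ik unfolding mode_sol_def by blast
    ultimately have z: "c t kk 3 = 0" using N by (simp add: sum_3)
    have c0: "c t 0 3 = of_real V" using mode_sol_mean[OF sol t0] mean by simp
    have d: "((\<lambda>t. c t (cell_mode N 0 0) i) has_vector_derivative phase_rhs \<epsilon> (Seed N) (c t) (cell_mode N 0 0) i) (at t within {s..s + 1})" for i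
      using ps t kv0 by (auto simp: phase_sol_def)
    show "((\<lambda>t. c t (cell_mode N 0 0) 1) has_vector_derivative \<i> / 2 * of_real V - of_real x * c t (cell_mode N 0 0) 1) (at t within {s..s + 1})"
      "((\<lambda>t. c t (cell_mode N 0 0) 2) has_vector_derivative 1 / 2 * of_real V - of_real x * c t (cell_mode N 0 0) 2) (at t within {s..s + 1})"
      using d[of 1] d[of 2] unfolding seed_mode[where c = "c t", OF N z[unfolded kk_def]] c0 x_def by auto
  qed
  define D where "D t p q = c t (cell_mode N p q)" for t p q
  define z where "z e t = mean_pol (of_real e) (D t)" for e t
  \<comment> \<open>z obeys z' = -x z + i (1 + e)/2 V exactly. Subtracting the stationary value
    leaves w with zero forcing, so \<open>linear_ode_bound\<close> yields an identity. For e = -1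
    there is no source.\<close>
  have zs: "z e (s + 1) = of_real ((1 - exp (- x)) / x) * (\<i> * of_real ((1 + e) / 2 * V)) + of_real (exp (- x)) * z e s" for e
  proof -
    define w where "w t = z e t - \<i> * of_real ((1 + e) / 2 * V / x)" for t
    have "norm (w (s + 1) - of_real (exp (- x * (s + 1 - s))) * w s) \<le> 0 * ((exp (- x * (s + 1 - s)) - 1) / - x)"
    proof (rule linear_ode_bound[where f = "\<lambda>_. 0" and b = "s + 1"])
      fix t assume t: "t \<in> {s..s + 1}"
      have "(w has_vector_derivative (\<i> / 2 * of_real V - of_real x * c t (cell_mode N 0 0) 1)
         + of_real e * \<i> * (1 / 2 * of_real V - of_real x * c t (cell_mode N 0 0) 2) - 0) (at t within {s..s + 1})"
        unfolding w_def z_def mean_pol_def D_def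
        by (intro has_vector_derivative_add has_vector_derivative_diff has_vector_derivative_mult_right has_vector_derivative_const seedd t)
      moreover have "(\<i> / 2 * of_real V - of_real x * c t (cell_mode N 0 0) 1)
         + of_real e * \<i> * (1 / 2 * of_real V - of_real x * c t (cell_mode N 0 0) 2) - 0 = of_real (- x) * w t + 0"
        using x by (simp add: w_def z_def mean_pol_def D_def field_simps)
      ultimately show "(w has_vector_derivative of_real (- x) * w t + 0) (at t within {s..s + 1})" by simp
    qed (use x in auto)
    then have "w (s + 1) = of_real (exp (- x)) * w s" by simp
    then have "z e (s + 1) = \<i> * of_real ((1 + e) / 2 * V / x) + of_real (exp (- x)) * (z e s - \<i> * of_real ((1 + e) / 2 * V / x))"
      by (simp add: w_def algebra_simps)
    also have "\<dots> = of_real ((1 - exp (- x)) / x) * (\<i> * of_real ((1 + e) / 2 * V)) + of_real (exp (- x)) * z e s"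
      using x by (simp add: field_simps del: of_real_exp)
    finally show ?thesis .
  qed
  have zsr: "norm (of_real (exp (- x)) * z e s) \<le> 2 * R" if "e = 1 \<or> e = -1" for e
  proof -
    have "norm (z e s) \<le> norm (c s (cell_mode N 0 0) 1) + norm (of_real e * \<i> * c s (cell_mode N 0 0) 2)"
      unfolding z_def mean_pol_def D_def by (rule norm_triangle_ineq)
    also have "norm (of_real e * \<i> * c s (cell_mode N 0 0) 2) = norm (c s (cell_mode N 0 0) 2)"
      using that by (auto simp: norm_mult)
    finally have "norm (z e s) \<le> R + R" using rest[OF kv0] rR by (meson add_mono order_trans)
    then have "exp (- x) * norm (z e s) \<le> 1 * (R + R)" using x by (intro mult_mono) auto
    then show ?thesis by (simp add: norm_mult)
  qed
  \<comment> \<open>From exp(-x) \<le> 1/(1 + x) \<le> 1 - x/2 for 0 < x \<le> 1.\<close>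
  have half: "(1 - exp (- x)) / x \<ge> 1 / 2"
  proof -
    have "exp (- x) * (1 + x) \<le> exp (- x) * exp x" using exp_ge_add_one_self[of x] by (intro mult_left_mono) auto
    then have "exp (- x) * (1 + x) \<le> 1" by (simp add: exp_minus)
    moreover have "1 \<le> (1 - x / 2) * (1 + x)" using x mult_left_mono[of x 1 x] by (simp add: algebra_simps)
    ultimately have "exp (- x) * (1 + x) \<le> (1 - x / 2) * (1 + x)" by linarith
    then have "exp (- x) \<le> 1 - x / 2" using x by (simp add: mult_le_cancel_right)
    then show ?thesis using x by (simp add: field_simps)
  qed
  have fl: "norm (D (s + 1) p q i) \<le> R" if "(p, q) \<noteq> (0, 0)" for p q i
    unfolding D_def
  proof (rule seed)
    show "cell_mode N p q \<in> K" using that int_vec_cell_mode N by (auto simp: K_def cell_mode_def scale_inv_def)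
  qed
  have R0: "R \<ge> 0" using rR r0 by linarith
  have LLb: "norm (of_real (del * kap / \<eta>) * emf_pol (of_real e) (D (s + 1))) \<le> 8 * R" if "e = 1 \<or> e = -1" for e
    by (rule norm_corr_weight_le[OF eta R0], rule norm_emf_pol) (use fl that in \<open>auto simp: neighbour_def\<close>)
  have Y1: "norm (mean_corr \<eta> 1 (D (s + 1))) \<ge> V / 2 - 10 * R"
  proof -
    have "norm (of_real ((1 - exp (- x)) / x) * (\<i> * of_real ((1 + 1) / 2 * V))) \<ge> V / 2"
      using half V x mult_right_mono[OF half, of V] unfolding norm_mult norm_of_real by simp
    then have "norm (z 1 (s + 1)) \<ge> V / 2 - 2 * R"
      unfolding zs using zsr[of 1] norm_diff_ineq[of "of_real ((1 - exp (- x)) / x) * (\<i> * of_real ((1 + 1) / 2 * V))" "of_real (exp (- x)) * z 1 s"]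
      by linarith
    then show ?thesis unfolding mean_corr_def using LLb[of 1]
        norm_diff_ineq[of "mean_pol (of_real 1) (D (s + 1))" "of_real (del * kap / \<eta>) * emf_pol (of_real 1) (D (s + 1))"]
      by (simp add: z_def)
  qed
  have Y2: "norm (mean_corr \<eta> (-1) (D (s + 1))) \<le> 10 * R"
  proof -
    have "norm (z (-1) (s + 1)) \<le> 2 * R"
      unfolding zs using zsr[of "-1"] by simp
    then show ?thesis unfolding mean_corr_def using LLb[of "-1"]
        norm_triangle_ineq[of "mean_pol (of_real (-1)) (D (s + 1))" "of_real (del * kap / \<eta>) * emf_pol (of_real (-1)) (D (s + 1))"]
      by (simp add: z_def)
  qed
  have RV: "R \<le> V / 10000" using R by (simp add: del_def)
  have dynamo_cone: "dynamo_cone \<eta> (D (s + 1)) (V / 4)"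
    unfolding dynamo_cone_def
  proof (intro conjI allI impI)
    show "V / 4 > 0" using V by simp
    show a: "V / 4 \<le> norm (mean_corr \<eta> 1 (D (s + 1)))" using Y1 RV V by linarith
    show "norm (mean_corr \<eta> (-1) (D (s + 1))) \<le> norm (mean_corr \<eta> 1 (D (s + 1)))" using Y1 Y2 RV V by linarith
    fix p q :: int and i :: 3 assume "(p, q) \<noteq> (0, 0)"
    then have "norm (D (s + 1) p q i) \<le> del * V" using fl R order_trans by blast
    also have "\<dots> \<le> 16 * del * (V / 4)" using del_bounds V by simp
    also have "\<dots> \<le> 16 * del * norm (mean_corr \<eta> 1 (D (s + 1)))" using a del_bounds by (intro mult_left_mono) auto
    finally show "norm (D (s + 1) p q i) \<le> 16 * del * norm (mean_corr \<eta> 1 (D (s + 1)))" .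
  qed
  define T where "T = real (epoch_start (Suc n))"
  have T: "T = s + 1 + real (3 * (rest_end n + 1))" by (simp add: T_def s_def epoch_start_Suc)
  have dsol: "cell_sol \<eta> D (s + 1) T"
    unfolding cell_sol_def
  proof (intro conjI ballI allI)
    have psd: "phase_sol \<epsilon> (Dyn N) c (s + 1) T (Collect int_vec)"
      by (rule phase_solI[OF sol]) (use phase_at_dyn T in \<open>auto simp: s_def N_def T_def\<close>)
    obtain C where "\<And>t k i. t \<in> {0..T} \<Longrightarrow> int_vec k \<Longrightarrow> norm (c t k i) \<le> C"
      using sol unfolding mode_sol_def by blast
    then show "\<exists>C. \<forall>t\<in>{s + 1..T}. \<forall>p q i. norm (D t p q i) \<le> C"
      using s0 int_vec_cell_mode unfolding D_def by (intro exI[of _ C]) auto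
    fix t assume t: "t \<in> {s + 1..T}"
    have t0: "t \<ge> 0" using t s0 by simp
    have "(\<Sum>i\<in>UNIV. of_real (cell_mode N 0 0 $ i) * c t (cell_mode N 0 0) i) = 0"
      using sol t0 kv0 unfolding mode_sol_def by blast
    moreover have "cell_mode N 0 0 $ 1 = 0" "cell_mode N 0 0 $ 2 = 0" by (simp_all add: cell_mode_def)
    ultimately show "D t 0 0 3 = 0" using N by (simp add: sum_3 cell_mode_3 D_def)
    fix p q i
    have "((\<lambda>t. c t (cell_mode N p q) i) has_vector_derivative phase_rhs \<epsilon> (Dyn N) (c t) (cell_mode N p q) i) (at t within {s + 1..T})"
      using psd t int_vec_cell_mode by (auto simp: phase_sol_def)
    then show "((\<lambda>t. D t p q i) has_vector_derivative cell_rhs \<eta> (D t) p q i) (at t within {s + 1..T})"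
      unfolding phase_rhs_Dyn[OF N] D_def \<eta>_def .
  qed
  have "dynamo_cone \<eta> (D T) ((1 + kap * del\<^sup>2 / 4) ^ (3 * (rest_end n + 1)) * (V / 4))"
    unfolding T using cell_growth[OF eta dsol dynamo_cone, of "3 * (rest_end n + 1)"] T by simp
  then have X: "(1 + kap * del\<^sup>2 / 4) ^ (3 * (rest_end n + 1)) * (V / 4) \<le> norm (mean_corr \<eta> 1 (D T))"
    and Xp: "(1 + kap * del\<^sup>2 / 4) ^ (3 * (rest_end n + 1)) * (V / 4) > 0"
    by (auto simp: dynamo_cone_def)
  define X where "X = (1 + kap * del\<^sup>2 / 4) ^ (3 * (rest_end n + 1)) * (V / 40)"
  have X10: "(1 + kap * del\<^sup>2 / 4) ^ (3 * (rest_end n + 1)) * (V / 4) = 10 * X" by (simp add: X_def)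
  show ?thesis
  \<comment> \<open>If every cell coefficient were below X, the mean would contribute less than 2 X
    and the correction at most 8 X, against the 10 X granted by the cone.\<close>
  proof (rule ccontr)
    assume "\<not> ?thesis"
    then have lt: "norm (D T p q i) < X" for p q i
      using int_vec_cell_mode by (auto simp: X_def D_def T_def not_le)
    have "X \<ge> 0" using Xp unfolding X10 by simp
    have "norm (mean_corr \<eta> 1 (D T)) \<le> norm (mean_pol (of_real 1) (D T)) + norm (of_real (del * kap / \<eta>) * emf_pol (of_real 1) (D T))"
      unfolding mean_corr_def by (rule norm_triangle_ineq)
    also have "norm (of_real (del * kap / \<eta>) * emf_pol (of_real 1) (D T)) \<le> 8 * X"
      by (rule norm_corr_weight_le[OF eta \<open>X \<ge> 0\<close>], rule norm_emf_pol) (use lt in \<open>auto intro: less_imp_le\<close>)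
    also have "norm (mean_pol (of_real 1) (D T)) \<le> norm (D T 0 0 1) + norm (\<i> * D T 0 0 2)"
      unfolding mean_pol_def using norm_triangle_ineq[of "D T 0 0 1" "\<i> * D T 0 0 2"] by simp
    also have "\<dots> < X + X" using lt[of 0 0 1] lt[of 0 0 2] by (simp add: norm_mult)
    finally show False using X unfolding X10 by simp
  qed
qed

section \<open>Existence by Dyson series\<close>

text \<open>Its inverse is summable over the lattice, so bounded weighted coefficients give an
  absolutely convergent Fourier series, and a shift of k changes it by at most a factor depending on
  the shift.\<close>

definition weight :: "real^3 \<Rightarrow> real" where
  "weight k = (1 + (k $ 1)\<^sup>2) * (1 + (k $ 2)\<^sup>2) * (1 + (k $ 3)\<^sup>2)"

lemma weight_pos: "weight k > 0"
  unfolding weight_def by (intro mult_pos_pos add_pos_nonneg) auto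

lemma weight_0 [simp]: "weight 0 = 1" by (simp add: weight_def)

text \<open>A form of Peetre's inequality; the difference of the two sides is a sum of
  squares.\<close>

lemma one_plus_sq_shift: "1 + (x::real)\<^sup>2 \<le> 2 * (1 + q\<^sup>2) * (1 + (x + q)\<^sup>2)"
proof -
  have "2 * (1 + q\<^sup>2) * (1 + (x + q)\<^sup>2) - (1 + x\<^sup>2) = 1 + (x + 2 * q)\<^sup>2 + 2 * (q * (x + q))\<^sup>2"
    by (simp add: power2_eq_square algebra_simps)
  moreover have "0 \<le> (x + 2 * q)\<^sup>2" "0 \<le> (q * (x + q))\<^sup>2" by simp_all
  ultimately show ?thesis by linarith
qed

lemma weight_shift: "weight k \<le> 2 * (1 + q\<^sup>2) * weight (k + shift q l)"
proof -
  have p: "0 < 1 + x\<^sup>2" for x :: real by (simp add: add_pos_nonneg)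
  have g: "a * b * c \<le> 2 * (1 + q\<^sup>2) * (a' * b * c)" if "a \<le> 2 * (1 + q\<^sup>2) * a'" "0 < b" "0 < c" for a b c a'
    using mult_right_mono[OF mult_right_mono[OF that(1), of b], of c] that by (simp add: mult.assoc)
  note q = one_plus_sq_shift[of _ q]
  consider "l = 1" | "l = 2" | "l = 3" using exhaust_3[of l] by blast
  then show ?thesis
  proof cases
    case 1
    then show ?thesis using g[OF q[of "k $ 1"] p[of "k $ 2"] p[of "k $ 3"]] by (simp add: weight_def shift_def axis_def)
  next
    case 2
    then show ?thesis using g[OF q[of "k $ 2"] p[of "k $ 1"] p[of "k $ 3"]] by (simp add: weight_def shift_def axis_def mult_ac)
  next
    case 3
    then show ?thesis using g[OF q[of "k $ 3"] p[of "k $ 1"] p[of "k $ 2"]] by (simp add: weight_def shift_def axis_def mult_ac)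
  qed
qed

lemma weight_shift_minus: "weight k \<le> 2 * (1 + q\<^sup>2) * weight (k - shift q l)"
proof -
  have e: "k - shift q l = k + shift (- q) l" by (simp add: shift_def)
  show ?thesis unfolding e using weight_shift[of k "- q" l] by simp
qed

abbreviation phase_induction :: "phase \<Rightarrow> (real^3 \<Rightarrow> 3 \<Rightarrow> complex) \<Rightarrow> real^3 \<Rightarrow> 3 \<Rightarrow> complex" where
  "phase_induction p \<equiv> induction_term (wave p) (cosamp p) (sinamp p)"

section \<open>Measurability and piecewise constancy of the schedule\<close>

instance phase :: countable by countable_datatype

lemma measurable_epoch [measurable]: "epoch \<in> borel \<rightarrow>\<^sub>M count_space UNIV"
  unfolding epoch_def by measurable

lemma measurable_phase_at [measurable]: "phase_at \<in> borel \<rightarrow>\<^sub>M count_space UNIV"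
proof -
  have [measurable]: "(\<lambda>t. real (rest_end (epoch t))) \<in> borel_measurable borel"
    by (rule measurable_compose[OF measurable_epoch]) simp
  have [measurable]: "(\<lambda>t. Seed (epoch_scale (epoch t))) \<in> borel \<rightarrow>\<^sub>M count_space UNIV"
    "(\<lambda>t. Dyn (epoch_scale (epoch t))) \<in> borel \<rightarrow>\<^sub>M count_space UNIV"
    by (rule measurable_compose[OF measurable_epoch], simp)+
  show ?thesis unfolding phase_at_def by measurable
qed

lemma continuous_phase_induction:
  assumes "\<And>k i. continuous_on S (\<lambda>t. c t k i)"
  shows "continuous_on S (\<lambda>t. phase_induction p (c t) k i)"
  unfolding induction_term_def by (intro continuous_intros assms)

text \<open>There are countably many phases, and for a fixed phase the expression is continuous in
  t.\<close>

lemma measurable_phase_induction: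
  assumes "\<And>k i. continuous_on UNIV (\<lambda>t. c t k i)"
  shows "(\<lambda>t. phase_induction (phase_at t) (c t) k i) \<in> borel_measurable borel"
  by (rule measurable_compose_countable[OF borel_measurable_continuous_onI[OF continuous_phase_induction] measurable_phase_at])
     (rule assms)

definition switch :: "real set" where
  "switch = (\<Union>n. {real (epoch_start n), real (rest_end n), real (rest_end n) + 1})"

lemma finite_switch: "finite (switch \<inter> {0..T})"
proof (rule finite_subset)
  show "switch \<inter> {0..T} \<subseteq> (\<Union>n\<in>{n. real n \<le> T}. {real (epoch_start n), real (rest_end n), real (rest_end n) + 1})"
  proof
    fix x assume x: "x \<in> switch \<inter> {0..T}"
    then obtain n where n: "x \<in> {real (epoch_start n), real (rest_end n), real (rest_end n) + 1}" by (auto simp: switch_def)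
    then have "real (epoch_start n) \<le> x" using epoch_start_le_rest_end[of n] by auto
    then have "real n \<le> T" using epoch_start_ge[of n] x by auto
    then show "x \<in> (\<Union>n\<in>{n. real n \<le> T}. {real (epoch_start n), real (rest_end n), real (rest_end n) + 1})" using n by auto
  qed
  have "{n. real n \<le> T} \<subseteq> {..nat \<lfloor>T\<rfloor>}" by (auto simp: le_nat_floor)
  then have "finite {n. real n \<le> T}" by (rule finite_subset) simp
  then show "finite (\<Union>n\<in>{n. real n \<le> T}. {real (epoch_start n), real (rest_end n), real (rest_end n) + 1})"
    by (rule finite_UN_I) simp
qed

lemma epoch_spec: "x < real (epoch_start (Suc (epoch x)))" "epoch x = 0 \<or> real (epoch_start (epoch x)) \<le> x"
proof -
  obtain n where "x < real n" using reals_Archimedean2 by blast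
  also have "real n \<le> real (epoch_start (Suc n))" using epoch_start_ge[of "Suc n"] by simp
  finally have ex: "x < real (epoch_start (Suc n))" .
  show "x < real (epoch_start (Suc (epoch x)))" unfolding epoch_def by (rule LeastI[of _ n]) (rule ex)
  show "epoch x = 0 \<or> real (epoch_start (epoch x)) \<le> x"
  proof (cases "epoch x")
    case (Suc m)
    then have "\<not> x < real (epoch_start (Suc m))" using not_less_Least[of m "\<lambda>n. x < real (epoch_start (Suc n))"] by (simp add: epoch_def)
    then show ?thesis using Suc by simp
  qed simp
qed

lemma phase_at_locally_const:
  assumes "x \<notin> switch"
  shows "\<exists>a b. a < x \<and> x < b \<and> (\<forall>s\<in>{a<..<b}. phase_at s = phase_at x)"
proof -
  define n where "n = epoch x"
  note sp = epoch_spec[of x, folded n_def]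
  have ne: "x \<noteq> real (epoch_start n)" "x \<noteq> real (rest_end n)" "x \<noteq> real (rest_end n) + 1" using assms by (auto simp: switch_def)
  define lo where "lo = (if n = 0 then x - 1 else real (epoch_start n))"
  have lo: "lo < x" using sp(2) ne by (auto simp: lo_def)
  have ep: "epoch s = n" if "lo < s" "s < real (epoch_start (Suc n))" for s
    using that by (intro epoch_eq) (auto simp: lo_def split: if_splits)
  consider "x < real (rest_end n)" | "real (rest_end n) < x" "x < real (rest_end n) + 1" | "real (rest_end n) + 1 < x" using ne by linarith
  then show ?thesis
  proof cases
    case 1
    then show ?thesis using lo ep rest_end_less_epoch_start[of n] sp(1)
      by (intro exI[of _ lo] exI[of _ "real (rest_end n)"]) (auto simp: phase_at_def)
  next
    case 2
    have "real (rest_end n) + 1 < real (epoch_start (Suc n))" using rest_end_less_epoch_start[of n] by linarith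
    then show ?thesis using lo ep sp(1) 2
      by (intro exI[of _ "max lo (real (rest_end n))"] exI[of _ "real (rest_end n) + 1"]) (auto simp: phase_at_def)
  next
    case 3
    then show ?thesis using lo ep sp(1)
      by (intro exI[of _ "max lo (real (rest_end n) + 1)"] exI[of _ "real (epoch_start (Suc n))"]) (auto simp: phase_at_def)
  qed
qed

lemma isCont_phase_induction:
  assumes "x \<notin> switch" "\<And>k i. continuous_on UNIV (\<lambda>t. c t k i)"
  shows "isCont (\<lambda>t. phase_induction (phase_at t) (c t) k i) x"
proof -
  obtain a b where ab: "a < x" "x < b" "\<forall>s\<in>{a<..<b}. phase_at s = phase_at x"
    using phase_at_locally_const[OF assms(1)] by blast
  have "isCont (\<lambda>t. phase_induction (phase_at x) (c t) k i) x"
  proof -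
    have "continuous_on UNIV (\<lambda>t. phase_induction (phase_at x) (c t) k i)" by (rule continuous_phase_induction) (rule assms)
    then show ?thesis by (simp add: continuous_on_eq_continuous_at)
  qed
  moreover have ev: "\<forall>\<^sub>F s in nhds x. phase_induction (phase_at s) (c s) k i = phase_induction (phase_at x) (c s) k i"
  proof -
    have "\<forall>\<^sub>F s in nhds x. s \<in> {a<..<b}" by (rule eventually_nhds_in_open) (use ab in auto)
    then show ?thesis by (rule eventually_mono) (use ab(3) in simp)
  qed
  ultimately show ?thesis using isCont_cong[OF ev] by simp
qed

section \<open>The scalar Duhamel operator\<close>

lemma set_integrable_bounded_Icc:
  fixes g :: "real \<Rightarrow> complex"
  assumes "g \<in> borel_measurable borel" "\<And>s. s \<in> {0..t} \<Longrightarrow> norm (g s) \<le> H"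
  shows "set_integrable lborel {0..t} g"
  unfolding set_integrable_def
proof (rule Bochner_Integration.integrable_bound)
  show "integrable lborel (\<lambda>s. H *\<^sub>R indicator {0..t} s :: real)"
    by (intro integrable_scaleR_right) (auto simp: emeasure_lborel_Icc_eq)
  show "(\<lambda>s. indicator {0..t} s *\<^sub>R g s) \<in> borel_measurable lborel" using assms(1) by measurable
  show "AE s in lborel. norm (indicator {0..t} s *\<^sub>R g s) \<le> norm (H *\<^sub>R indicator {0..t} s :: real)"
    using order_trans[OF assms(2) abs_ge_self] by (auto simp: indicator_def)
qed

text \<open>The solution of y' = g - l y with y(0) = 0. For t < 0 the interval is empty and the
  value is 0, which extends it to the whole line.\<close>

definition duhamel :: "real \<Rightarrow> (real \<Rightarrow> complex) \<Rightarrow> real \<Rightarrow> complex" where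
  "duhamel l g t = exp (- l * t) *\<^sub>R integral {0..t} (\<lambda>s. exp (l * s) *\<^sub>R g s)"

lemma duhamel_integrable:
  fixes g :: "real \<Rightarrow> complex"
  assumes g: "g \<in> borel_measurable borel" and b: "\<And>s. s \<in> {0..T} \<Longrightarrow> norm (g s) \<le> H"
  shows "(\<lambda>s. exp (l * s) *\<^sub>R g s) integrable_on {0..T}"
proof -
  have "set_integrable lborel {0..T} (\<lambda>s. exp (l * s) *\<^sub>R g s)"
  proof (rule set_integrable_bounded_Icc)
    show "(\<lambda>s. exp (l * s) *\<^sub>R g s) \<in> borel_measurable borel" using g by measurable
    fix s assume s: "s \<in> {0..T}"
    have "l * s \<le> \<bar>l\<bar> * s" using s by (intro mult_right_mono) auto
    also have "\<dots> \<le> \<bar>l\<bar> * T" using s by (intro mult_left_mono) auto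
    finally have "exp (l * s) \<le> exp (\<bar>l\<bar> * T)" by simp
    then have "exp (l * s) * norm (g s) \<le> exp (\<bar>l\<bar> * T) * H"
      by (rule mult_mono) (use b[OF s] in auto)
    then show "norm (exp (l * s) *\<^sub>R g s) \<le> exp (\<bar>l\<bar> * T) * H" by simp
  qed
  then show ?thesis by (rule set_borel_integral_eq_integral(1))
qed

lemma continuous_on_halfline:
  fixes f :: "real \<Rightarrow> 'a :: topological_space"
  assumes "\<And>T. continuous_on {0..T} f"
  shows "continuous_on {0..} f"
  unfolding continuous_on_eq_continuous_within
proof
  fix x :: real assume "x \<in> {0..}"
  then have x: "x \<in> {0..x + 1}" by simp
  have "continuous (at x within {0..x + 1}) f" using assms x by (auto simp: continuous_on_eq_continuous_within)
  moreover have "at x within {0..} = at x within {0..x + 1}"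
    by (rule at_within_nhd[where S = "{..<x + 1}"]) auto
  ultimately show "continuous (at x within {0..}) f" by simp
qed

lemma duhamel_continuous:
  assumes g: "g \<in> borel_measurable borel" and b: "\<And>T. \<exists>H. \<forall>s\<in>{0..T}. norm (g s) \<le> H"
  shows "continuous_on UNIV (duhamel l g)"
proof -
  have "continuous_on {0..T} (duhamel l g)" for T
  proof -
    obtain H where "\<forall>s\<in>{0..T}. norm (g s) \<le> H" using b by blast
    then show ?thesis unfolding duhamel_def
      by (intro continuous_intros indefinite_integral_continuous_1 duhamel_integrable[OF g, where H = H]) auto
  qed
  note 1 = this
  have "continuous_on {0..} (duhamel l g)" by (rule continuous_on_halfline) (rule 1)
  moreover have "continuous_on {..0} (duhamel l g)"
  proof -
    have "duhamel l g t = 0" if "t \<in> {..0}" for t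
      using that by (cases "t = 0") (auto simp: duhamel_def)
    then show ?thesis by (subst continuous_on_cong[OF refl, where g = "\<lambda>_. 0"]) auto
  qed
  ultimately have "continuous_on ({..0} \<union> {0..}) (duhamel l g)" by (intro continuous_on_closed_Un) auto
  moreover have "{..0} \<union> {0::real..} = UNIV" by auto
  ultimately show ?thesis by simp
qed

text \<open>Differentiation under the integral is available where g is continuous, that is, off the
  switching times. Only finitely many of these lie in [0, t], which the fundamental theorem
  tolerates.\<close>

lemma duhamel_ode:
  assumes g: "g \<in> borel_measurable borel" and b: "\<And>T. \<exists>H. \<forall>s\<in>{0..T}. norm (g s) \<le> H"
    and c: "\<And>x. x \<notin> switch \<Longrightarrow> isCont g x" and t: "t \<ge> 0"
  shows "((\<lambda>s. g s - of_real l * duhamel l g s) has_integral duhamel l g t) {0..t}"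
proof -
  obtain H where H: "\<forall>s\<in>{0..t}. norm (g s) \<le> H" using b by blast
  define S where "S = switch \<inter> {0..t}"
  have S: "finite S" unfolding S_def by (rule finite_switch)
  have "((\<lambda>s. g s - of_real l * duhamel l g s) has_integral duhamel l g t - duhamel l g 0) {0..t}"
  proof (rule fundamental_theorem_of_calculus_interior_strong[OF S t])
    show "continuous_on {0..t} (duhamel l g)" by (rule continuous_on_subset[OF duhamel_continuous[OF g b]]) auto
    fix x assume x: "x \<in> {0<..<t} - S"
    then have xs: "x \<notin> switch" by (auto simp: S_def)
    have "((\<lambda>u. integral {0..u} (\<lambda>s. exp (l * s) *\<^sub>R g s)) has_vector_derivative exp (l * x) *\<^sub>R g x) (at x within ({0..t} - S))"
    proof (rule integral_has_vector_derivative_continuous_at)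
      show "(\<lambda>s. exp (l * s) *\<^sub>R g s) integrable_on {0..t}" by (rule duhamel_integrable[OF g, of _ H]) (use H in auto)
      show "continuous (at x within {0..t} - S) (\<lambda>s. exp (l * s) *\<^sub>R g s)"
        by (intro continuous_intros continuous_at_imp_continuous_within[OF c[OF xs]])
    qed (use x S in auto)
    moreover have "at x within ({0..t} - S) = at x"
    proof (rule at_within_interior, rule interiorI)
      show "open ({0<..<t} - S)" using S by (intro open_Diff finite_imp_closed) auto
    qed (use x in auto)
    ultimately have d: "((\<lambda>u. integral {0..u} (\<lambda>s. exp (l * s) *\<^sub>R g s)) has_vector_derivative exp (l * x) *\<^sub>R g x) (at x)"
      by simp
    show "(duhamel l g has_vector_derivative g x - of_real l * duhamel l g x) (at x)"
    proof -
      have e: "((\<lambda>u. exp (- l * u)) has_real_derivative - l * exp (- l * x)) (at x)"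
        by (auto intro!: derivative_eq_intros)
      have ee: "exp (- l * x) * exp (l * x) = 1" unfolding exp_add[symmetric] by simp
      have eq: "exp (- l * x) *\<^sub>R exp (l * x) *\<^sub>R g x + (- l * exp (- l * x)) *\<^sub>R integral {0..x} (\<lambda>s. exp (l * s) *\<^sub>R g s)
         = g x - of_real l * duhamel l g x"
        unfolding scaleR_scaleR ee duhamel_def by (simp add: scaleR_conv_of_real)
      have "(duhamel l g has_vector_derivative exp (- l * x) *\<^sub>R exp (l * x) *\<^sub>R g x + (- l * exp (- l * x)) *\<^sub>R integral {0..x} (\<lambda>s. exp (l * s) *\<^sub>R g s)) (at x)"
        unfolding duhamel_def by (rule has_vector_derivative_scaleR[OF e d])
      then show ?thesis unfolding eq .
    qed
  qed
  moreover have "duhamel l g 0 = 0" by (simp add: duhamel_def)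
  ultimately show ?thesis by simp
qed

text \<open>Against the time weight exp(L t) the operator gains 1 / (l + L). For l = \<epsilon>
  |k|^2 and large L this outweighs the factor |k| of the induction term.\<close>

lemma duhamel_bound:
  assumes g: "g \<in> borel_measurable borel" and b: "\<And>s. s \<in> {0..t} \<Longrightarrow> norm (g s) \<le> H * exp (L * s)"
    and t: "t \<ge> 0" and lL: "l + L > 0" and H: "H \<ge> 0" and L: "L \<ge> 0"
  shows "norm (duhamel l g t) \<le> H / (l + L) * exp (L * t)"
proof -
  have i: "((\<lambda>s. H * exp ((l + L) * s)) has_integral (H / (l + L) * exp ((l + L) * t) - H / (l + L) * exp ((l + L) * 0))) {0..t}"
  proof (rule fundamental_theorem_of_calculus[OF t])
    fix x
    show "((\<lambda>s. H / (l + L) * exp ((l + L) * s)) has_vector_derivative H * exp ((l + L) * x)) (at x within {0..t})"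
    proof -
      have "((\<lambda>s. exp ((l + L) * s)) has_real_derivative exp ((l + L) * x) * (l + L)) (at x within {0..t})"
      proof -
        define a where "a = l + L"
        have "((\<lambda>s. exp (a * s)) has_real_derivative exp (a * x) * a) (at x within {0..t})"
          by (rule DERIV_chain2[OF DERIV_exp DERIV_cmult_Id])
        then show ?thesis by (simp only: a_def)
      qed
      from DERIV_cmult[OF this, of "H / (l + L)"] 
      have "((\<lambda>s. H / (l + L) * exp ((l + L) * s)) has_real_derivative H / (l + L) * (exp ((l + L) * x) * (l + L))) (at x within {0..t})" .
      moreover have "H / (l + L) * (exp ((l + L) * x) * (l + L)) = H * exp ((l + L) * x)" using lL by simp
      ultimately show ?thesis by (simp only: has_real_derivative_iff_has_vector_derivative)
    qed
  qed
  have bb: "norm (g s) \<le> H * exp (L * t)" if "s \<in> {0..t}" for s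
    by (rule order_trans[OF b[OF that]]) (use that H L in \<open>auto intro!: mult_left_mono\<close>)
  have "norm (integral {0..t} (\<lambda>s. exp (l * s) *\<^sub>R g s)) \<le> integral {0..t} (\<lambda>s. H * exp ((l + L) * s))"
  proof (rule integral_norm_bound_integral)
    show "(\<lambda>s. exp (l * s) *\<^sub>R g s) integrable_on {0..t}" by (rule duhamel_integrable[OF g bb])
    show "(\<lambda>s. H * exp ((l + L) * s)) integrable_on {0..t}" using i by blast
    fix s assume s: "s \<in> {0..t}"
    have "exp (l * s) * norm (g s) \<le> exp (l * s) * (H * exp (L * s))" using b[OF s] by (intro mult_left_mono) auto
    also have "\<dots> = H * exp ((l + L) * s)" by (simp add: distrib_right exp_add)
    finally show "norm (exp (l * s) *\<^sub>R g s) \<le> H * exp ((l + L) * s)" by simp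
  qed
  also have "\<dots> \<le> H / (l + L) * exp ((l + L) * t)" unfolding integral_unique[OF i] using H lL by simp
  finally have "exp (- l * t) * norm (integral {0..t} (\<lambda>s. exp (l * s) *\<^sub>R g s)) \<le> exp (- l * t) * (H / (l + L) * exp ((l + L) * t))"
    by (rule mult_left_mono) simp
  also have "\<dots> = H / (l + L) * (exp (- l * t) * exp ((l + L) * t))" by (simp only: mult_ac)
  also have "exp (- l * t) * exp ((l + L) * t) = exp (L * t)"
    unfolding exp_add[symmetric] by (simp add: algebra_simps)
  finally show ?thesis by (simp add: duhamel_def)
qed

text \<open>Picard iteration arranged as a series. Term 0 is the uniform vertical field, stationary
  because the mode k = 0 is not damped; each later term is the response to the induction by its
  predecessor.\<close>

primrec dyson_term :: "real \<Rightarrow> real \<Rightarrow> nat \<Rightarrow> real \<Rightarrow> real^3 \<Rightarrow> 3 \<Rightarrow> complex" where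
  "dyson_term \<epsilon> V 0 = (\<lambda>t k i. if k = 0 \<and> i = 3 then of_real V else 0)"
| "dyson_term \<epsilon> V (Suc m) = (\<lambda>t k i. duhamel (\<epsilon> * (norm k)\<^sup>2) (\<lambda>s. phase_induction (phase_at s) (dyson_term \<epsilon> V m s) k i) t)"

text \<open>Finitely many epochs begin before T, so finitely many phases occur. All scales recur, so
  wave numbers are unbounded over all times and the weighted estimates are made on each
  [0, T].\<close>

lemma wave_bounded: "\<exists>Q\<ge>0. \<forall>s\<le>T. \<bar>wave (phase_at s)\<bar> \<le> Q"
proof -
  obtain n where n: "T < real n" using reals_Archimedean2 by blast
  have "phase_at s \<in> {Rest} \<union> Seed ` epoch_scale ` {..n} \<union> Dyn ` epoch_scale ` {..n}" if "s \<le> T" for s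
  proof -
    have "epoch s \<le> n"
    proof -
      have "s < real (epoch_start (Suc n))" using that n epoch_start_ge[of "Suc n"] by linarith
      then show ?thesis unfolding epoch_def by (rule Least_le)
    qed
    then show ?thesis by (auto simp: phase_at_def)
  qed
  then have "(\<lambda>s. \<bar>wave (phase_at s)\<bar>) ` {..T} \<subseteq> (\<lambda>p. \<bar>wave p\<bar>) ` ({Rest} \<union> Seed ` epoch_scale ` {..n} \<union> Dyn ` epoch_scale ` {..n})"
    by blast
  then have f: "finite ((\<lambda>s. \<bar>wave (phase_at s)\<bar>) ` {..T})" by (rule finite_subset) auto
  let ?Q = "Max ((\<lambda>s. \<bar>wave (phase_at s)\<bar>) ` {..T})"
  have le: "\<bar>wave (phase_at s)\<bar> \<le> ?Q" if "s \<le> T" for s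
    using f that by (intro Max_ge) auto
  moreover have "0 \<le> ?Q" using le[of T] abs_ge_zero[of "wave (phase_at T)"] by linarith
  ultimately show ?thesis by blast
qed

text \<open>Continuity of a term relies on local boundedness of its predecessor, uniformly in k so
  that it survives the shifts. One induction carries both.\<close>

lemma dyson_term_facts:
  assumes \<epsilon>: "\<epsilon> > 0" and V: "V \<ge> 0"
  shows "continuous_on UNIV (\<lambda>t. dyson_term \<epsilon> V m t k i)"
    and "\<And>T. \<exists>H. \<forall>s\<in>{0..T}. norm (phase_induction (phase_at s) (dyson_term \<epsilon> V m s) k i) \<le> H"
proof -
  have bnd: "\<exists>H. \<forall>s\<in>{0..T}. norm (phase_induction (phase_at s) (c s) k i) \<le> H"
    if bd: "\<And>T. \<exists>H. \<forall>s\<in>{0..T}. \<forall>k i. norm (c s k i) \<le> H" for c :: "real \<Rightarrow> real^3 \<Rightarrow> 3 \<Rightarrow> complex" and T k i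
  proof -
    obtain H where H: "\<forall>s\<in>{0..T}. \<forall>k i. norm (c s k i) \<le> H" using bd by blast
    have H': "norm (c s k i) \<le> \<bar>H\<bar>" if "s \<in> {0..T}" for s k i
      by (rule order_trans[OF _ abs_ge_self]) (use H that in blast)
    show ?thesis
    proof (intro exI ballI)
      show "norm (phase_induction (phase_at s) (c s) k i) \<le> 36 * norm k * \<bar>H\<bar>" if "s \<in> {0..T}" for s
        by (rule norm_induction_term) (use H'[OF that] in auto)
    qed
  qed
  have main: "(\<forall>k i. continuous_on UNIV (\<lambda>t. dyson_term \<epsilon> V m t k i)) \<and> (\<forall>T. \<exists>H. \<forall>s\<in>{0..T}. \<forall>k i. norm (dyson_term \<epsilon> V m s k i) \<le> H)" for m
  proof (induction m)
    case 0
    have "\<forall>s\<in>{0..T}. \<forall>k i. norm (dyson_term \<epsilon> V 0 s k i) \<le> V" for T using V by auto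
    then show ?case by (auto intro!: continuous_intros exI)
  next
    case (Suc m)
    have meas: "(\<lambda>s. phase_induction (phase_at s) (dyson_term \<epsilon> V m s) k i) \<in> borel_measurable borel" for k i
      using Suc by (intro measurable_phase_induction) auto
    have "continuous_on UNIV (\<lambda>t. dyson_term \<epsilon> V (Suc m) t k i)" for k i
      unfolding dyson_term.simps by (rule duhamel_continuous[OF meas bnd]) (use Suc in auto)
    moreover have "\<exists>H. \<forall>s\<in>{0..T}. \<forall>k i. norm (dyson_term \<epsilon> V (Suc m) s k i) \<le> H" for T
    proof -
      obtain H where H: "\<forall>s\<in>{0..T}. \<forall>k i. norm (dyson_term \<epsilon> V m s k i) \<le> H" using Suc by blast
      define L where "L = crude_rate \<epsilon>"
      have L: "L > 0" using \<epsilon> by (simp add: L_def crude_rate_def)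
      show ?thesis
      proof (intro exI[of _ "\<bar>H\<bar> * exp (L * T)"] ballI allI)
        fix s k i assume s: "s \<in> {0..T}"
        have "norm (dyson_term \<epsilon> V (Suc m) s k i) \<le> (36 * norm k * \<bar>H\<bar>) / (\<epsilon> * (norm k)\<^sup>2 + L) * exp (L * s)"
          unfolding dyson_term.simps
        proof (rule duhamel_bound[OF meas])
          fix r assume r: "r \<in> {0..s}"
          have "norm (phase_induction (phase_at r) (dyson_term \<epsilon> V m r) k i) \<le> 36 * norm k * \<bar>H\<bar>"
          proof (rule norm_induction_term)
            have n: "norm (dyson_term \<epsilon> V m r k' j) \<le> \<bar>H\<bar>" for k' j
              by (rule order_trans[OF _ abs_ge_self]) (use H r s in auto)
            show "norm (dyson_term \<epsilon> V m r (k - shift (wave (phase_at r)) l) j) \<le> \<bar>H\<bar>"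
              "norm (dyson_term \<epsilon> V m r (k + shift (wave (phase_at r)) l) j) \<le> \<bar>H\<bar>" for l j by (rule n)+
          qed simp
          also have "\<dots> \<le> 36 * norm k * \<bar>H\<bar> * exp (L * r)" using r L mult_left_mono[of 1 "exp (L * r)" "36 * norm k * \<bar>H\<bar>"] by simp
          finally show "norm (phase_induction (phase_at r) (dyson_term \<epsilon> V m r) k i) \<le> 36 * norm k * \<bar>H\<bar> * exp (L * r)" .
        next
          show "\<epsilon> * (norm k)\<^sup>2 + L > 0" using \<epsilon> L by (intro add_nonneg_pos) auto
        qed (use s L in auto)
        also have "\<dots> \<le> \<bar>H\<bar> * exp (L * T)"
        proof (rule mult_mono)
          have "36 * norm k * \<bar>H\<bar> \<le> (\<epsilon> * (norm k)\<^sup>2 + L) * \<bar>H\<bar>"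
          proof (rule mult_right_mono)
            have "0 \<le> \<epsilon> * (norm k)\<^sup>2" using \<epsilon> by simp
            then show "36 * norm k \<le> \<epsilon> * (norm k)\<^sup>2 + L"
              using young_crude_rate[OF \<epsilon>, of "norm k"] L unfolding L_def[symmetric] by argo
          qed simp
          show "36 * norm k * \<bar>H\<bar> / (\<epsilon> * (norm k)\<^sup>2 + L) \<le> \<bar>H\<bar>"
            proof -
            have "\<epsilon> * (norm k)\<^sup>2 + L > 0" using \<epsilon> L by (intro add_nonneg_pos) auto
            then show ?thesis
              using \<open>36 * norm k * \<bar>H\<bar> \<le> (\<epsilon> * (norm k)\<^sup>2 + L) * \<bar>H\<bar>\<close>
              by (simp add: divide_le_eq mult.commute)
          qed
        qed (use s L in auto)
        finally show "norm (dyson_term \<epsilon> V (Suc m) s k i) \<le> \<bar>H\<bar> * exp (L * T)" .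
      qed
    qed
    ultimately show ?case by blast
  qed
  show "continuous_on UNIV (\<lambda>t. dyson_term \<epsilon> V m t k i)" using main by blast
  show "\<exists>H. \<forall>s\<in>{0..T}. norm (phase_induction (phase_at s) (dyson_term \<epsilon> V m s) k i) \<le> H" for T using main by (intro bnd) blast
qed

text \<open>A contraction in the norm given by the supremum of \<open>weight k\<close> exp(-L t)
  |c(k)|: shifting the weight costs q, the induction term costs 36 |k|, and Duhamel returns 1 /
  (\<epsilon> |k|^2 + L). L depends on T through the wave numbers present.\<close>

lemma dyson_term_weighted:
  assumes \<epsilon>: "\<epsilon> > 0" and V: "V \<ge> 0"
  shows "\<exists>C. \<forall>m. \<forall>t\<in>{0..T}. \<forall>k i. norm (dyson_term \<epsilon> V m t k i) \<le> (1 / 2) ^ m * C / weight k"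
proof -
  obtain Q where Q: "Q \<ge> 0" "\<forall>s\<le>T. \<bar>wave (phase_at s)\<bar> \<le> Q" using wave_bounded by blast
  define q where "q = 2 * (1 + Q\<^sup>2)"
  have q: "q \<ge> 1" by (simp add: q_def)
  \<comment> \<open>Chosen so that 72 q n \<le> \<epsilon> n^2 + L, which makes every iteration
    contract by 1/2.\<close>
  define L where "L = (72 * q)\<^sup>2 / \<epsilon>"
  have L: "L > 0" using \<epsilon> q by (simp add: L_def)
  have young: "72 * q * n \<le> \<epsilon> * n\<^sup>2 + L" for n
  proof -
    have "0 \<le> (2 * \<epsilon> * n - 72 * q)\<^sup>2 / (4 * \<epsilon>)" using \<epsilon> by simp
    also have "\<dots> = \<epsilon> * n\<^sup>2 - 72 * q * n + (72 * q)\<^sup>2 / (4 * \<epsilon>)"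
      using \<epsilon> by (simp add: field_simps power2_eq_square)
    also have "(72 * q)\<^sup>2 / (4 * \<epsilon>) \<le> L" using \<epsilon> unfolding L_def by (intro divide_left_mono) auto
    finally show ?thesis by simp
  qed
  have wq: "1 / weight (k + shift (wave (phase_at s)) l) \<le> q / weight k" "1 / weight (k - shift (wave (phase_at s)) l) \<le> q / weight k" if "s \<le> T" for k s l
  proof -
    have "(wave (phase_at s))\<^sup>2 \<le> Q\<^sup>2" using Q that by (metis abs_le_square_iff abs_of_nonneg)
    then have le: "2 * (1 + (wave (phase_at s))\<^sup>2) \<le> q" by (simp add: q_def)
    have *: "1 / w' \<le> q / weight k" if "weight k \<le> 2 * (1 + (wave (phase_at s))\<^sup>2) * w'" "w' > 0" for w'
    proof -
      have "weight k \<le> q * w'" by (rule order_trans[OF that(1)]) (use le that in \<open>intro mult_right_mono; simp\<close>)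
      then show ?thesis using that weight_pos[of k] by (simp add: field_simps)
    qed
    show "1 / weight (k + shift (wave (phase_at s)) l) \<le> q / weight k" "1 / weight (k - shift (wave (phase_at s)) l) \<le> q / weight k"
      by (intro * weight_shift weight_shift_minus weight_pos)+
  qed
  have "norm (dyson_term \<epsilon> V m t k i) \<le> (1 / 2) ^ m * V / weight k * exp (L * t)" if "t \<in> {0..T}" for m t k i
    using that
  proof (induction m arbitrary: t k i)
    case 0
    have "V * 1 \<le> V * exp (L * t)" using V L 0 by (intro mult_left_mono) auto
    moreover have "0 \<le> V / weight k * exp (L * t)" using V less_imp_le[OF weight_pos[of k]] by simp
    ultimately show ?case using V by simp
  next
    case (Suc m)
    define A where "A = (1 / 2) ^ m * V"
    have A: "A \<ge> 0" using V by (simp add: A_def)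
    have "norm (dyson_term \<epsilon> V (Suc m) t k i) \<le> (36 * norm k * (A * (q / weight k))) / (\<epsilon> * (norm k)\<^sup>2 + L) * exp (L * t)"
      unfolding dyson_term.simps
    proof (rule duhamel_bound)
      show "(\<lambda>s. phase_induction (phase_at s) (dyson_term \<epsilon> V m s) k i) \<in> borel_measurable borel"
        by (rule measurable_phase_induction[OF dyson_term_facts(1)[OF \<epsilon> V]])
      fix s assume s: "s \<in> {0..t}"
      have n: "norm (dyson_term \<epsilon> V m s k' j) \<le> A * (q / weight k) * exp (L * s)" if "1 / weight k' \<le> q / weight k" for k' j
      proof -
        have "norm (dyson_term \<epsilon> V m s k' j) \<le> (1 / 2) ^ m * V / weight k' * exp (L * s)" using Suc.IH s Suc.prems by auto
        also have "\<dots> = A * (1 / weight k') * exp (L * s)" by (simp add: A_def)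
        also have "\<dots> \<le> A * (q / weight k) * exp (L * s)" using that A by (intro mult_right_mono mult_left_mono) auto
        finally show ?thesis .
      qed
      have "norm (phase_induction (phase_at s) (dyson_term \<epsilon> V m s) k i) \<le> 36 * norm k * (A * (q / weight k) * exp (L * s))"
        by (rule norm_induction_term) (use n wq s Suc.prems A q weight_pos[of k] in \<open>auto intro!: mult_nonneg_nonneg divide_nonneg_nonneg\<close>)
      then show "norm (phase_induction (phase_at s) (dyson_term \<epsilon> V m s) k i) \<le> 36 * norm k * (A * (q / weight k)) * exp (L * s)"
        by (simp only: mult.assoc)
    next
      show "\<epsilon> * (norm k)\<^sup>2 + L > 0" using \<epsilon> L by (intro add_nonneg_pos) auto
      show "0 \<le> 36 * norm k * (A * (q / weight k))" using A q less_imp_le[OF weight_pos[of k]] by simp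
    qed (use Suc.prems L in auto)
    also have "(36 * norm k * (A * (q / weight k))) / (\<epsilon> * (norm k)\<^sup>2 + L) = (36 * q * norm k) / (\<epsilon> * (norm k)\<^sup>2 + L) * (A / weight k)"
      by (simp add: mult_ac)
    also have "\<dots> * exp (L * t) \<le> 1 / 2 * (A / weight k) * exp (L * t)"
    proof (intro mult_right_mono)
      have "\<epsilon> * (norm k)\<^sup>2 + L > 0" using \<epsilon> L by (simp add: add_nonneg_pos)
      then show "(36 * q * norm k) / (\<epsilon> * (norm k)\<^sup>2 + L) \<le> 1 / 2"
        using young[of "norm k"] by (simp add: divide_le_eq)
    qed (use A weight_pos[of k] in auto)
    also have "\<dots> = (1 / 2) ^ Suc m * V / weight k * exp (L * t)" by (simp add: A_def)
    finally show ?case .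
  qed
  note main = this
  have "norm (dyson_term \<epsilon> V m t k i) \<le> (1 / 2) ^ m * (V * exp (L * T)) / weight k" if "t \<in> {0..T}" for m t k i
  proof -
    have "(1 / 2) ^ m * V / weight k * exp (L * t) \<le> (1 / 2) ^ m * V / weight k * exp (L * T)"
    proof (rule mult_left_mono)
      show "exp (L * t) \<le> exp (L * T)" using that L by simp
      show "0 \<le> (1 / 2) ^ m * V / weight k" using V less_imp_le[OF weight_pos[of k]] by simp
    qed
    with main[OF that, of m k i] have "norm (dyson_term \<epsilon> V m t k i) \<le> (1 / 2) ^ m * V / weight k * exp (L * T)" by (rule order_trans)
    also have "\<dots> = (1 / 2) ^ m * (V * exp (L * T)) / weight k" by simp
    finally show ?thesis .
  qed
  then show ?thesis by blast
qed

section \<open>The sum of the series and its mode equations\<close>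

definition dyson :: "real \<Rightarrow> real \<Rightarrow> real \<Rightarrow> real^3 \<Rightarrow> 3 \<Rightarrow> complex" where
  "dyson \<epsilon> V t k i = (\<Sum>m. dyson_term \<epsilon> V m t k i)"

lemma sums_phase_induction:
  assumes "\<And>k i. (\<lambda>m. d m k i) sums c k i"
  shows "(\<lambda>m. phase_induction p (d m) k i) sums phase_induction p c k i"
  unfolding induction_term_def by (intro sums_mult sums_sum sums_add sums_diff assms)

lemma weight_ge_1: "1 \<le> weight k"
proof -
  have "1 * 1 * 1 \<le> weight k" unfolding weight_def by (intro mult_mono) auto
  then show ?thesis by simp
qed

lemma dyson_sums:
  assumes "\<epsilon> > 0" "V \<ge> 0" "t \<ge> 0"
  shows "(\<lambda>m. dyson_term \<epsilon> V m t k i) sums dyson \<epsilon> V t k i"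
proof -
  obtain C where C: "\<forall>m. \<forall>s\<in>{0..t}. \<forall>k i. norm (dyson_term \<epsilon> V m s k i) \<le> (1 / 2) ^ m * C / weight k"
    using dyson_term_weighted[OF assms(1,2)] by blast
  have "summable (\<lambda>m. dyson_term \<epsilon> V m t k i)"
  proof (rule summable_comparison_test')
    show "summable (\<lambda>m. (1 / 2) ^ m * (C / weight k))" by (intro summable_mult2 summable_geometric) simp
    show "norm (dyson_term \<epsilon> V m t k i) \<le> (1 / 2) ^ m * (C / weight k)" for m
      using C assms(3) by (simp add: algebra_simps)
  qed
  then show ?thesis unfolding dyson_def by (rule summable_sums)
qed

lemma dyson_bound:
  assumes "\<epsilon> > 0" "V \<ge> 0"
  shows "\<exists>C. \<forall>t\<in>{0..T}. \<forall>k i. norm (dyson \<epsilon> V t k i) \<le> C / weight k"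
proof -
  obtain C where C: "\<forall>m. \<forall>s\<in>{0..T}. \<forall>k i. norm (dyson_term \<epsilon> V m s k i) \<le> (1 / 2) ^ m * C / weight k"
    using dyson_term_weighted[OF assms] by blast
  have "norm (dyson \<epsilon> V t k i) \<le> 2 * C / weight k" if "t \<in> {0..T}" for t k i
  proof -
    have g: "(\<lambda>m. (1 / 2 :: real) ^ m * (C / weight k)) sums (2 * (C / weight k))"
      using sums_mult2[OF geometric_sums[of "1 / 2 :: real"], of "C / weight k"] by simp
    have "norm (dyson \<epsilon> V t k i) \<le> (\<Sum>m. (1 / 2) ^ m * (C / weight k))"
      unfolding dyson_def
    proof (rule norm_suminf_le)
      show "summable (\<lambda>m. (1 / 2) ^ m * (C / weight k))" using g by (rule sums_summable)
      show "norm (dyson_term \<epsilon> V m t k i) \<le> (1 / 2) ^ m * (C / weight k)" for m using C that by simp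
    qed
    also have "\<dots> = 2 * C / weight k" using g by (simp add: sums_iff)
    finally show ?thesis .
  qed
  then show ?thesis by blast
qed

lemma continuous_on_suminf:
  fixes f :: "nat \<Rightarrow> 'a::topological_space \<Rightarrow> 'b::banach"
  assumes "\<And>n. continuous_on S (f n)" "\<And>n x. x \<in> S \<Longrightarrow> norm (f n x) \<le> M n" "summable M"
  shows "continuous_on S (\<lambda>x. \<Sum>n. f n x)"
proof (rule uniform_limit_theorem[OF _ Weierstrass_m_test[OF assms(2,3)]])
  show "\<forall>\<^sub>F n in sequentially. continuous_on S (\<lambda>x. \<Sum>i<n. f i x)"
    by (intro always_eventually allI continuous_on_sum assms(1))
qed auto

lemma dyson_continuous:
  assumes "\<epsilon> > 0" "V \<ge> 0"
  shows "continuous_on {0..} (\<lambda>t. dyson \<epsilon> V t k i)"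
proof (rule continuous_on_halfline)
  fix T
  obtain C where C: "\<forall>m. \<forall>s\<in>{0..T}. \<forall>k i. norm (dyson_term \<epsilon> V m s k i) \<le> (1 / 2) ^ m * C / weight k"
    using dyson_term_weighted[OF assms] by blast
  show "continuous_on {0..T} (\<lambda>t. dyson \<epsilon> V t k i)"
    unfolding dyson_def
  proof (rule continuous_on_suminf)
    show "continuous_on {0..T} (\<lambda>t. dyson_term \<epsilon> V m t k i)" for m
      by (rule continuous_on_subset[OF dyson_term_facts(1)[OF assms]]) simp
    show "norm (dyson_term \<epsilon> V m t k i) \<le> (1 / 2) ^ m * (C / weight k)" if "t \<in> {0..T}" for m t
      using C that by simp
    show "summable (\<lambda>m. (1 / 2) ^ m * (C / weight k))"
      by (intro summable_mult2 summable_geometric) simp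
  qed
qed

text \<open>The summand f m pairs induction by term m with damping of term m + 1, which is the
  equation \<open>duhamel_ode\<close> solves. Summing gives the full equation apart from the damping
  of term 0. Geometric bounds allow termwise integration by dominated convergence.\<close>

lemma dyson_mode_eq:
  assumes \<epsilon>: "\<epsilon> > 0" and V: "V \<ge> 0" and t: "t \<ge> 0"
  shows "((\<lambda>s. phase_rhs \<epsilon> (phase_at s) (dyson \<epsilon> V s) k i) has_integral (dyson \<epsilon> V t k i - dyson \<epsilon> V 0 k i)) {0..t}"
proof -
  define l where "l = \<epsilon> * (norm k)\<^sup>2"
  have l: "l \<ge> 0" using \<epsilon> by (simp add: l_def)
  define f where "f m s = phase_induction (phase_at s) (dyson_term \<epsilon> V m s) k i - of_real l * dyson_term \<epsilon> V (Suc m) s k i" for m s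
  obtain C where C: "\<forall>m. \<forall>s\<in>{0..t}. \<forall>k i. norm (dyson_term \<epsilon> V m s k i) \<le> (1 / 2) ^ m * C / weight k"
    using dyson_term_weighted[OF assms(1,2)] by blast
  have C0: "C \<ge> 0"
  proof -
    have "norm (dyson_term \<epsilon> V 0 0 0 3) \<le> (1 / 2) ^ 0 * C / weight 0" using C t by (metis atLeastAtMost_iff order_refl)
    then show ?thesis using order_trans[OF norm_ge_zero] by fastforce
  qed
  have C': "norm (dyson_term \<epsilon> V m s k' j) \<le> (1 / 2) ^ m * C" if "s \<in> {0..t}" for m s k' j
  proof -
    have "norm (dyson_term \<epsilon> V m s k' j) \<le> (1 / 2) ^ m * C / weight k'" using C that by blast
    also have "\<dots> \<le> (1 / 2) ^ m * C / 1" using C0 weight_ge_1[of k'] by (intro divide_left_mono) auto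
    finally show ?thesis by simp
  qed
  define K where "K = 36 * norm k * C + l * C"
  have fb: "norm (f m s) \<le> (1 / 2) ^ m * K" if s: "s \<in> {0..t}" for m s
  proof -
    have 1: "norm (phase_induction (phase_at s) (dyson_term \<epsilon> V m s) k i) \<le> 36 * norm k * ((1 / 2) ^ m * C)"
      by (rule norm_induction_term) (use C'[OF s] C0 in auto)
    have "l * norm (dyson_term \<epsilon> V (Suc m) s k i) \<le> l * ((1 / 2) ^ Suc m * C)"
      by (rule mult_left_mono[OF C'[OF s] l])
    also have "\<dots> \<le> l * ((1 / 2) ^ m * C)" using l C0 by (intro mult_left_mono mult_right_mono) auto
    finally have 2: "norm (of_real l * dyson_term \<epsilon> V (Suc m) s k i) \<le> l * ((1 / 2) ^ m * C)" using l by (simp add: norm_mult)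
    have "norm (f m s) \<le> norm (phase_induction (phase_at s) (dyson_term \<epsilon> V m s) k i) + norm (of_real l * dyson_term \<epsilon> V (Suc m) s k i)"
      unfolding f_def by (rule norm_triangle_ineq4)
    also have "\<dots> \<le> 36 * norm k * ((1 / 2) ^ m * C) + l * ((1 / 2) ^ m * C)" by (rule add_mono[OF 1 2])
    also have "\<dots> = (1 / 2) ^ m * K" by (simp add: K_def algebra_simps)
    finally show ?thesis .
  qed
  have fi: "(f m has_integral dyson_term \<epsilon> V (Suc m) t k i) {0..t}" for m
  proof -
    have "((\<lambda>s. phase_induction (phase_at s) (dyson_term \<epsilon> V m s) k i - of_real l * duhamel l (\<lambda>s. phase_induction (phase_at s) (dyson_term \<epsilon> V m s) k i) s)
       has_integral duhamel l (\<lambda>s. phase_induction (phase_at s) (dyson_term \<epsilon> V m s) k i) t) {0..t}"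
      by (rule duhamel_ode[OF measurable_phase_induction[OF dyson_term_facts(1)[OF \<epsilon> V]] dyson_term_facts(2)[OF \<epsilon> V] isCont_phase_induction[OF _ dyson_term_facts(1)[OF \<epsilon> V]] t])
    then show ?thesis by (simp add: f_def[abs_def] l_def)
  qed
  \<comment> \<open>Term 0 is supported on k = 0, where the damping rate is 0.\<close>
  have l0: "of_real l * dyson_term \<epsilon> V 0 s k i = 0" for s by (simp add: l_def)
  have fs: "(\<lambda>m. f m s) sums phase_rhs \<epsilon> (phase_at s) (dyson \<epsilon> V s) k i" if s: "s \<in> {0..t}" for s
  proof -
    have d: "(\<lambda>m. dyson_term \<epsilon> V m s k i) sums dyson \<epsilon> V s k i" for k i
      using dyson_sums[OF \<epsilon> V] s by simp
    have "(\<lambda>m. dyson_term \<epsilon> V (Suc m) s k i) sums (dyson \<epsilon> V s k i - dyson_term \<epsilon> V 0 s k i)"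
      using d by (subst sums_Suc_iff)  simp
    then have "(\<lambda>m. f m s) sums (phase_induction (phase_at s) (dyson \<epsilon> V s) k i - of_real l * (dyson \<epsilon> V s k i - dyson_term \<epsilon> V 0 s k i))"
      unfolding f_def by (intro sums_diff sums_mult sums_phase_induction d)
    moreover have "phase_induction (phase_at s) (dyson \<epsilon> V s) k i - of_real l * (dyson \<epsilon> V s k i - dyson_term \<epsilon> V 0 s k i) = phase_rhs \<epsilon> (phase_at s) (dyson \<epsilon> V s) k i"
      unfolding right_diff_distrib l0 by (simp add: phase_rhs_def mode_rhs_def l_def)
    ultimately show ?thesis by simp
  qed
  have Si: "((\<lambda>s. \<Sum>m<n. f m s) has_integral (\<Sum>m<n. dyson_term \<epsilon> V (Suc m) t k i)) {0..t}" for n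
    by (intro has_integral_sum fi) auto
  have dom: "(\<lambda>s. phase_rhs \<epsilon> (phase_at s) (dyson \<epsilon> V s) k i) integrable_on {0..t}"
    "(\<lambda>n. integral {0..t} (\<lambda>s. \<Sum>m<n. f m s)) \<longlonglongrightarrow> integral {0..t} (\<lambda>s. phase_rhs \<epsilon> (phase_at s) (dyson \<epsilon> V s) k i)"
  proof -
    have a: "(\<lambda>s. \<Sum>m<n. f m s) integrable_on {0..t}" for n using Si by blast
    have b: "(\<lambda>s. 2 * K) integrable_on {0..t}" by (rule integrable_const_ivl)
    have c: "norm (\<Sum>m<n. f m s) \<le> 2 * K" if "s \<in> {0..t}" for n s
    proof -
      have "norm (\<Sum>m<n. f m s) \<le> (\<Sum>m<n. (1 / 2) ^ m * K)" by (intro sum_norm_le fb that)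
      also have "\<dots> = (\<Sum>m<n. (1 / 2) ^ m) * K" by (rule sum_distrib_right[symmetric])
      also have "\<dots> \<le> 2 * K"
      proof (rule mult_right_mono)
        have "(\<Sum>m<n. (1 / 2 :: real) ^ m) \<le> (\<Sum>m. (1 / 2) ^ m)"
          by (intro sum_le_suminf summable_geometric) auto
        then show "(\<Sum>m<n. (1 / 2 :: real) ^ m) \<le> 2" by (simp add: suminf_geometric)
        show "0 \<le> K" using l C0 by (simp add: K_def)
      qed
      finally show ?thesis .
    qed
    have d: "(\<lambda>n. \<Sum>m<n. f m s) \<longlonglongrightarrow> phase_rhs \<epsilon> (phase_at s) (dyson \<epsilon> V s) k i" if "s \<in> {0..t}" for s
      using fs[OF that] by (simp add: sums_def)
    show "(\<lambda>s. phase_rhs \<epsilon> (phase_at s) (dyson \<epsilon> V s) k i) integrable_on {0..t}"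
      "(\<lambda>n. integral {0..t} (\<lambda>s. \<Sum>m<n. f m s)) \<longlonglongrightarrow> integral {0..t} (\<lambda>s. phase_rhs \<epsilon> (phase_at s) (dyson \<epsilon> V s) k i)"
      using dominated_convergence[of "\<lambda>n s. \<Sum>m<n. f m s", OF a b c d] by auto
  qed
  have d0: "dyson \<epsilon> V 0 k i = dyson_term \<epsilon> V 0 0 k i"
  proof -
    have "(\<lambda>m. dyson_term \<epsilon> V (Suc m) 0 k i) sums (dyson \<epsilon> V 0 k i - dyson_term \<epsilon> V 0 0 k i)"
      using dyson_sums[OF \<epsilon> V order_refl, of k i] by (subst sums_Suc_iff) simp
    moreover have "dyson_term \<epsilon> V (Suc m) 0 k i = 0" for m by (simp add: duhamel_def)
    ultimately have "(\<lambda>m::nat. 0 :: complex) sums (dyson \<epsilon> V 0 k i - dyson_term \<epsilon> V 0 0 k i)" by (simp only:)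
    from sums_unique2[OF this sums_zero] show ?thesis by simp
  qed
  have "(\<lambda>m. dyson_term \<epsilon> V (Suc m) t k i) sums (dyson \<epsilon> V t k i - dyson_term \<epsilon> V 0 t k i)"
    using dyson_sums[OF \<epsilon> V t, of k i] by (subst sums_Suc_iff) simp
  moreover have "dyson_term \<epsilon> V 0 t k i = dyson_term \<epsilon> V 0 0 k i" by simp
  ultimately have "(\<lambda>n. \<Sum>m<n. dyson_term \<epsilon> V (Suc m) t k i) \<longlonglongrightarrow> dyson \<epsilon> V t k i - dyson \<epsilon> V 0 k i"
    unfolding d0 by (simp only: sums_def)
  moreover have "integral {0..t} (\<lambda>s. \<Sum>m<n. f m s) = (\<Sum>m<n. dyson_term \<epsilon> V (Suc m) t k i)" for n
    using Si by (rule integral_unique)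
  ultimately have "integral {0..t} (\<lambda>s. phase_rhs \<epsilon> (phase_at s) (dyson \<epsilon> V s) k i) = dyson \<epsilon> V t k i - dyson \<epsilon> V 0 k i"
    using LIMSEQ_unique[OF dom(2)] by simp
  then show ?thesis using dom(1) by (simp add: has_integral_iff)
qed

lemma dyson_0:
  assumes "\<epsilon> > 0" "V \<ge> 0"
  shows "dyson \<epsilon> V 0 k i = (if k = 0 \<and> i = 3 then of_real V else 0)"
proof -
  have z: "dyson_term \<epsilon> V m 0 k i = 0" if nz: "m \<noteq> 0" for m
  proof -
    obtain n where "m = Suc n" using not0_implies_Suc[OF nz] by blast
    then show ?thesis by (simp add: duhamel_def)
  qed
  have "(\<lambda>m. dyson_term \<epsilon> V m 0 k i) sums (\<Sum>m\<in>{0}. dyson_term \<epsilon> V m 0 k i)"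
    by (rule sums_finite, simp, rule z, simp)
  also have "(\<Sum>m\<in>{0}. dyson_term \<epsilon> V m 0 k i) = dyson_term \<epsilon> V 0 0 k i" by (simp del: dyson_term.simps)
  finally have "(\<lambda>m. dyson_term \<epsilon> V m 0 k i) sums dyson_term \<epsilon> V 0 0 k i" .
  then have "dyson \<epsilon> V 0 k i = dyson_term \<epsilon> V 0 0 k i"
    by (rule sums_unique2[OF dyson_sums[OF assms order_refl]])
  then show ?thesis by simp
qed

text \<open>Replacing k by -k exchanges the two shifts while conjugation exchanges the two
  amplitudes. This is the Hermitian symmetry of the coefficients of a real field.\<close>

lemma dyson_term_cnj: "dyson_term \<epsilon> V m t (- k) i = cnj (dyson_term \<epsilon> V m t k i)"
proof (induction m arbitrary: t k i)
  case (Suc m)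
  have "phase_induction p (dyson_term \<epsilon> V m s) (- k) i = cnj (phase_induction p (dyson_term \<epsilon> V m s) k i)" for p s
  proof -
    have a: "- k - shift q l = - (k + shift q l)" "- k + shift q l = - (k - shift q l)" for q l by simp_all
    define T where "T l j = phase_amp p l j * dyson_term \<epsilon> V m s (k - shift (wave p) l) i - phase_amp p l i * dyson_term \<epsilon> V m s (k - shift (wave p) l) j
       + (cnj (phase_amp p l j) * dyson_term \<epsilon> V m s (k + shift (wave p) l) i - cnj (phase_amp p l i) * dyson_term \<epsilon> V m s (k + shift (wave p) l) j)" for l j
    have "phase_induction p (dyson_term \<epsilon> V m s) (- k) i = - \<i> * (\<Sum>l\<in>UNIV. \<Sum>j\<in>UNIV. - cnj (of_real (k $ j) * T l j))"
      unfolding induction_term_def a Suc.IH T_def phase_amp_def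
      by (intro arg_cong[where f = "\<lambda>z. - \<i> * z"] sum.cong refl) (simp add: algebra_simps)
    also have "\<dots> = cnj (- \<i> * (\<Sum>l\<in>UNIV. \<Sum>j\<in>UNIV. of_real (k $ j) * T l j))"
      by (simp add: sum_negf)
    also have "\<dots> = cnj (phase_induction p (dyson_term \<epsilon> V m s) k i)"
      unfolding induction_term_def T_def phase_amp_def ..
    finally show ?thesis .
  qed
  then show ?case by (simp add: duhamel_def integral_cnj)
qed auto

text \<open>The induction term is a curl: the symmetric k_i k_j is contracted with an expression
  antisymmetric in i and j.\<close>

lemma induction_term_div: "(\<Sum>i\<in>UNIV. of_real (k $ i) * induction_term q A S c k i) = 0"
proof -
  have anti: "(\<Sum>i\<in>UNIV. \<Sum>j\<in>UNIV. of_real (k $ i) * (of_real (k $ j) * (a j * b i - a i * b j))) = (0 :: complex)" for a b :: "3 \<Rightarrow> complex"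
    by (simp add: sum_3 algebra_simps)
  have "(\<Sum>i\<in>UNIV. of_real (k $ i) * induction_term q A S c k i) = - \<i> * (\<Sum>l\<in>UNIV.
      (\<Sum>i\<in>UNIV. \<Sum>j\<in>UNIV. of_real (k $ i) * (of_real (k $ j) * (fourier_amp A S l j * c (k - shift q l) i - fourier_amp A S l i * c (k - shift q l) j)))
     + (\<Sum>i\<in>UNIV. \<Sum>j\<in>UNIV. of_real (k $ i) * (of_real (k $ j) * (cnj (fourier_amp A S l j) * c (k + shift q l) i - cnj (fourier_amp A S l i) * c (k + shift q l) j))))"
    unfolding induction_term_def sum_3 by (simp add: algebra_simps)
  also have "\<dots> = 0" unfolding anti by simp
  finally show ?thesis .
qed

lemma dyson_term_div:
  assumes "\<epsilon> > 0" "V \<ge> 0"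
  shows "(\<Sum>i\<in>UNIV. of_real (k $ i) * dyson_term \<epsilon> V m t k i) = 0"
proof (cases m)
  case 0
  then show ?thesis by (auto intro!: sum.neutral)
next
  case (Suc n)
  let ?g = "\<lambda>i s. phase_induction (phase_at s) (dyson_term \<epsilon> V n s) k i"
  let ?l = "\<epsilon> * (norm k)\<^sup>2"
  have i: "(\<lambda>s. exp (?l * s) *\<^sub>R ?g i s) integrable_on {0..t}" for i
  proof -
    obtain H where "\<forall>s\<in>{0..t}. norm (?g i s) \<le> H" using dyson_term_facts(2)[OF assms] by blast
    then show ?thesis by (intro duhamel_integrable[where H = H] measurable_phase_induction dyson_term_facts(1) assms) auto
  qed
  have "((\<lambda>s. \<Sum>i\<in>UNIV. of_real (k $ i) * (exp (?l * s) *\<^sub>R ?g i s)) has_integral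
     (\<Sum>i\<in>UNIV. of_real (k $ i) * integral {0..t} (\<lambda>s. exp (?l * s) *\<^sub>R ?g i s))) {0..t}"
    by (intro has_integral_sum has_integral_mult_right integrable_integral i) auto
  moreover have "(\<Sum>i\<in>UNIV. of_real (k $ i) * (exp (?l * s) *\<^sub>R ?g i s)) = exp (?l * s) *\<^sub>R (\<Sum>i\<in>UNIV. of_real (k $ i) * ?g i s)" for s
    by (simp add: scaleR_sum_right)
  ultimately have "((\<lambda>s. 0) has_integral (\<Sum>i\<in>UNIV. of_real (k $ i) * integral {0..t} (\<lambda>s. exp (?l * s) *\<^sub>R ?g i s))) {0..t}"
    unfolding induction_term_div by simp
  then have "(\<Sum>i\<in>UNIV. of_real (k $ i) * integral {0..t} (\<lambda>s. exp (?l * s) *\<^sub>R ?g i s)) = 0"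
    by (rule has_integral_unique[OF _ has_integral_0])
  moreover have "dyson_term \<epsilon> V m t k i = exp (- ?l * t) *\<^sub>R integral {0..t} (\<lambda>s. exp (?l * s) *\<^sub>R ?g i s)" for i
    by (simp only: Suc dyson_term.simps duhamel_def)
  moreover have "(\<Sum>i\<in>UNIV. of_real (k $ i) * (r *\<^sub>R I i)) = r *\<^sub>R (\<Sum>i\<in>UNIV. of_real (k $ i) * I i)" for r and I :: "3 \<Rightarrow> complex"
    by (simp add: scaleR_sum_right)
  ultimately show ?thesis by (simp only: scaleR_zero_right)
qed

lemma dyson_div:
  assumes "\<epsilon> > 0" "V \<ge> 0" "t \<ge> 0"
  shows "(\<Sum>i\<in>UNIV. of_real (k $ i) * dyson \<epsilon> V t k i) = 0"
proof -
  have "(\<lambda>m. \<Sum>i\<in>UNIV. of_real (k $ i) * dyson_term \<epsilon> V m t k i) sums (\<Sum>i\<in>UNIV. of_real (k $ i) * dyson \<epsilon> V t k i)"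
    by (intro sums_sum sums_mult dyson_sums assms)
  then show ?thesis unfolding dyson_term_div[OF assms(1,2)] by (rule sums_unique2[OF _ sums_zero])
qed

lemma dyson_cnj:
  assumes "\<epsilon> > 0" "V \<ge> 0" "t \<ge> 0"
  shows "dyson \<epsilon> V t (- k) i = cnj (dyson \<epsilon> V t k i)"
proof -
  have "(\<lambda>m. dyson_term \<epsilon> V m t (- k) i) sums cnj (dyson \<epsilon> V t k i)"
    unfolding dyson_term_cnj sums_cnj by (rule dyson_sums[OF assms])
  then show ?thesis by (rule sums_unique2[OF dyson_sums[OF assms]])
qed

section \<open>Summability over the integer lattice\<close>

definition lattice_enum :: "nat \<Rightarrow> real^3" where "lattice_enum = from_nat_into (Collect int_vec)"

definition int_triple :: "int \<times> int \<times> int \<Rightarrow> real^3" where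
  "int_triple = (\<lambda>(a, b, c). \<chi> j. if j = 1 then of_int a else if j = 2 then of_int b else of_int c)"

lemma range_int_triple: "range int_triple = Collect int_vec"
proof
  show "range int_triple \<subseteq> Collect int_vec" by (auto simp: int_triple_def int_vec_def)
  show "Collect int_vec \<subseteq> range int_triple"
  proof
    fix k assume "k \<in> Collect int_vec"
    then have "k $ 1 \<in> \<int>" "k $ 2 \<in> \<int>" "k $ 3 \<in> \<int>" by (auto simp: int_vec_def)
    then obtain a b c where "k $ 1 = of_int a" "k $ 2 = of_int b" "k $ 3 = of_int c" by (auto elim!: Ints_cases)
    then have "k = int_triple (a, b, c)" by (auto simp: int_triple_def vec_eq_iff forall_3)
    then show "k \<in> range int_triple" by blast
  qed
qed

lemma inj_int_triple: "inj int_triple"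
  by (auto simp: inj_on_def int_triple_def vec_eq_iff forall_3)

lemma bij_lattice_enum: "bij_betw lattice_enum UNIV (Collect int_vec)"
  unfolding lattice_enum_def
proof (rule bij_betw_from_nat_into)
  show "countable (Collect int_vec)" unfolding range_int_triple[symmetric] by (rule countable_image) simp
  show "infinite (Collect int_vec)" unfolding range_int_triple[symmetric]
    using inj_int_triple by (simp add: finite_image_iff infinite_UNIV_char_0 finite_prod)
qed

lemma int_vec_lattice_enum: "int_vec (lattice_enum n)"
  using bij_lattice_enum by (auto simp: bij_betw_def)

lemma weight_int_triple: "1 / weight (int_triple (a, b, c)) = 1 / (1 + (of_int a)\<^sup>2) * (1 / (1 + (of_int b)\<^sup>2) * (1 / (1 + (of_int c)\<^sup>2)))"
  by (simp add: weight_def int_triple_def)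

lemma int_sum_bound: "\<exists>S. \<forall>F :: int set. finite F \<longrightarrow> (\<Sum>a\<in>F. 1 / (1 + (of_int a :: real)\<^sup>2)) \<le> S"
proof -
  let ?h = "\<lambda>n::nat. 1 / (1 + (real n)\<^sup>2)"
  have sm: "summable ?h"
  proof (rule summable_comparison_test'[where N = 1])
    show "summable (\<lambda>n. inverse (real n ^ 2))" by (rule inverse_power_summable) simp
    show "norm (?h n) \<le> inverse (real n ^ 2)" if "1 \<le> n" for n
      using that by (auto simp: inverse_eq_divide intro!: frac_le)
  qed
  show ?thesis
  proof (intro exI allI impI)
    fix F :: "int set" assume F: "finite F"
    define M where "M = Suc (nat (Max (abs ` (insert 0 F))))"
    have "\<bar>a\<bar> \<le> Max (abs ` (insert 0 F))" if "a \<in> F" for a using F that by (intro Max_ge) auto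
    then have sub: "F \<subseteq> int ` {..<M} \<union> (\<lambda>n. - int n) ` {..<M}"
    proof -
      have "a \<in> int ` {..<M} \<union> (\<lambda>n. - int n) ` {..<M}" if "a \<in> F" for a
      proof -
        have "nat \<bar>a\<bar> < M" using \<open>\<And>a. a \<in> F \<Longrightarrow> \<bar>a\<bar> \<le> Max (abs ` (insert 0 F))\<close>[OF that] unfolding M_def by linarith
        moreover have "a = int (nat \<bar>a\<bar>) \<or> a = - int (nat \<bar>a\<bar>)" by linarith
        ultimately show ?thesis by blast
      qed
      then show ?thesis by blast
    qed
    let ?g = "\<lambda>a::int. 1 / (1 + (of_int a :: real)\<^sup>2)"
    have g0: "0 \<le> ?g a" for a by (simp add: add_nonneg_nonneg)
    have "sum ?g F \<le> sum ?g (int ` {..<M} \<union> (\<lambda>n. - int n) ` {..<M})"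
      by (rule sum_mono2[OF _ sub]) (auto simp: g0)
    also have "\<dots> \<le> sum ?g (int ` {..<M}) + sum ?g ((\<lambda>n. - int n) ` {..<M})"
    proof -
      have "sum ?g (int ` {..<M} \<union> (\<lambda>n. - int n) ` {..<M}) + sum ?g (int ` {..<M} \<inter> (\<lambda>n. - int n) ` {..<M})
         = sum ?g (int ` {..<M}) + sum ?g ((\<lambda>n. - int n) ` {..<M})" by (rule sum.union_inter) auto
      moreover have "0 \<le> sum ?g (int ` {..<M} \<inter> (\<lambda>n. - int n) ` {..<M})" by (intro sum_nonneg g0)
      ultimately show ?thesis by linarith
    qed
    also have "sum ?g (int ` {..<M}) = sum ?h {..<M}" by (subst sum.reindex) (auto simp: inj_on_def)
    also have "sum ?g ((\<lambda>n. - int n) ` {..<M}) = sum ?h {..<M}" by (subst sum.reindex) (auto simp: inj_on_def)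
    also have "sum ?h {..<M} + sum ?h {..<M} \<le> suminf ?h + suminf ?h"
      by (intro add_mono sum_le_suminf sm) (auto simp: add_nonneg_nonneg)
    finally show "sum ?g F \<le> suminf ?h + suminf ?h" .
  qed
qed

text \<open>A partial sum runs over a finite set of integer triples, which lies in the product of
  its three projections. There the sum of inverse weights factors into one-dimensional sums, each
  bounded by S.\<close>

lemma summable_weight: "summable (\<lambda>n. 1 / weight (lattice_enum n))"
proof -
  obtain S where S: "\<And>F :: int set. finite F \<Longrightarrow> (\<Sum>a\<in>F. 1 / (1 + (of_int a :: real)\<^sup>2)) \<le> S"
    using int_sum_bound by blast
  have S0: "S \<ge> 0" using S[of "{}"] by simp
  let ?g = "\<lambda>a::int. 1 / (1 + (of_int a :: real)\<^sup>2)"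
  have g0: "0 \<le> ?g a" for a by (simp add: add_nonneg_nonneg)
  show ?thesis
  proof (rule summableI_nonneg_bounded)
    show "0 \<le> 1 / weight (lattice_enum n)" for n using weight_pos[of "lattice_enum n"] by simp
    fix n
    define G where "G = int_triple -` (lattice_enum ` {..<n})"
    have finG: "finite G" unfolding G_def by (rule finite_vimageI[OF _ inj_int_triple]) simp
    have GI: "int_triple ` G = lattice_enum ` {..<n}"
      unfolding G_def using int_vec_lattice_enum range_int_triple by (auto simp: image_vimage_eq)
    define A where "A = fst ` G"
    define B where "B = (fst \<circ> snd) ` G"
    define D where "D = (snd \<circ> snd) ` G"
    have fin: "finite A" "finite B" "finite D" using finG by (auto simp: A_def B_def D_def)
    have sub: "G \<subseteq> A \<times> B \<times> D" by (force simp: A_def B_def D_def)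
    have "(\<Sum>i<n. 1 / weight (lattice_enum i)) = (\<Sum>k\<in>lattice_enum ` {..<n}. 1 / weight k)"
      using bij_lattice_enum by (subst sum.reindex) (auto simp: bij_betw_def intro: inj_on_subset)
    also have "\<dots> = (\<Sum>z\<in>G. 1 / weight (int_triple z))"
      unfolding GI[symmetric] by (subst sum.reindex) (auto intro: inj_on_subset[OF inj_int_triple])
    also have "\<dots> \<le> (\<Sum>z\<in>A \<times> B \<times> D. 1 / weight (int_triple z))"
      by (rule sum_mono2[OF _ sub]) (use fin in \<open>auto intro: less_imp_le[OF weight_pos]\<close>)
    also have "\<dots> = (\<Sum>a\<in>A. \<Sum>b\<in>B. \<Sum>c\<in>D. ?g a * (?g b * ?g c))"
      unfolding sum.cartesian_product by (rule sum.cong[OF refl]) (clarsimp simp only: weight_int_triple prod.case)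
    also have "\<dots> = sum ?g A * (sum ?g B * sum ?g D)"
      by (simp only: sum_distrib_left[symmetric] sum_distrib_right[symmetric])
    also have "\<dots> \<le> S * (S * S)"
      using S0 by (intro mult_mono S fin mult_nonneg_nonneg sum_nonneg g0) auto
    finally show "(\<Sum>i<n. 1 / weight (lattice_enum i)) \<le> S * (S * S)" .
  qed
qed

section \<open>Synthesis from Fourier coefficients\<close>

definition torus_vol :: real where "torus_vol = (2 * pi) ^ 3"

lemma torus_vol_pos: "torus_vol > 0" by (simp add: torus_vol_def)

text \<open>The decay gives absolute convergence; the second condition is the symmetry of the
  coefficients of a real field.\<close>

definition admissible :: "(real^3 \<Rightarrow> 3 \<Rightarrow> complex) \<Rightarrow> real \<Rightarrow> bool" where
  "admissible c C \<longleftrightarrow> (\<forall>k i. norm (c k i) \<le> C / weight k) \<and> (\<forall>k i. c (- k) i = cnj (c k i))"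

definition fourier_sum :: "(real^3 \<Rightarrow> 3 \<Rightarrow> complex) \<Rightarrow> 3 \<Rightarrow> real^3 \<Rightarrow> complex" where
  "fourier_sum c i x = (\<Sum>n. c (lattice_enum n) i * cis (lattice_enum n \<bullet> x))"

text \<open>\<open>fcoeff\<close> carries no normalising factor, hence the division by the volume
  here. Taking the real part gives a real field at once; the symmetry of c enters in
  \<open>fcoeff_synthesis\<close>.\<close>

definition synthesis :: "(real^3 \<Rightarrow> 3 \<Rightarrow> complex) \<Rightarrow> real^3 \<Rightarrow> real^3" where
  "synthesis c x = (\<chi> i. Re (fourier_sum c i x) / torus_vol)"

lemma summable_weight_scaled: "summable (\<lambda>n. C / weight (lattice_enum n))"
  using summable_mult[OF summable_weight, of C] by simp

lemma fourier_sum_continuous: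
  assumes "admissible c C"
  shows "continuous_on UNIV (fourier_sum c i)"
  unfolding fourier_sum_def
proof (rule continuous_on_suminf[where M = "\<lambda>n. C / weight (lattice_enum n)"])
  show "norm (c (lattice_enum n) i * cis (lattice_enum n \<bullet> x)) \<le> C / weight (lattice_enum n)" for n x
    using assms by (simp add: admissible_def norm_mult)
qed (intro continuous_intros summable_weight_scaled)+

lemma fourier_sum_bound:
  assumes "admissible c C"
  shows "norm (fourier_sum c i x) \<le> (\<Sum>n. C / weight (lattice_enum n))"
  unfolding fourier_sum_def
  by (rule norm_suminf_le[OF _ summable_weight_scaled]) (use assms in \<open>simp add: admissible_def norm_mult\<close>)

lemma synthesis_measurable:
  assumes "admissible c C"
  shows "synthesis c \<in> borel_measurable borel"
proof -
  have "continuous_on UNIV (synthesis c)"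
    unfolding synthesis_def using fourier_sum_continuous[OF assms] by (intro continuous_intros) (use torus_vol_pos in \<open>auto intro: continuous_on_Re\<close>)
  then show ?thesis by (rule borel_measurable_continuous_onI)
qed

lemma norm_le_sum3: "norm (v :: real^3) \<le> \<bar>v $ 1\<bar> + \<bar>v $ 2\<bar> + \<bar>v $ 3\<bar>"
  using norm_le_l1_cart[of v] by (simp add: sum_3)

lemma L2_field_bounded:
  assumes "periodic3 f" "f \<in> borel_measurable borel" "\<And>x. norm (f x) \<le> M"
  shows "L2_field f"
  unfolding L2_field_def
proof (intro conjI)
  show "f \<in> borel_measurable lborel" using assms(2) by simp
  show "set_integrable lborel torus_box (\<lambda>x. (norm (f x))\<^sup>2)"
    by (rule set_integrable_torus_bounded[where C = "M\<^sup>2"]) (use assms in \<open>auto intro!: power_mono\<close>)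
qed (rule assms)

lemma periodic_synthesis: "periodic3 (synthesis c)"
proof -
  have "cis (lattice_enum n \<bullet> (x + (2 * pi) *\<^sub>R axis i 1)) = cis (lattice_enum n \<bullet> x)" for n x i
  proof -
    have "lattice_enum n $ i \<in> \<int>" using int_vec_lattice_enum[of n] by (simp add: int_vec_def)
    then have "cis (2 * pi * lattice_enum n $ i) = 1" by (rule cis_multiple_2pi)
    then show ?thesis by (simp add: inner_add_right inner_axis cis_mult[symmetric] mult_ac)
  qed
  then show ?thesis by (simp add: periodic3_def synthesis_def fourier_sum_def)
qed

lemma synthesis_bounded:
  assumes "admissible c C"
  shows "norm (synthesis c x) \<le> 3 * ((\<Sum>n. C / weight (lattice_enum n)) / torus_vol)"
proof -
  have "\<bar>synthesis c x $ i\<bar> \<le> (\<Sum>n. C / weight (lattice_enum n)) / torus_vol" for i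
    using order_trans[OF abs_Re_le_cmod fourier_sum_bound[OF assms, of i x]] torus_vol_pos
    by (simp add: synthesis_def abs_divide divide_right_mono)
  from this[of 1] this[of 2] this[of 3] show ?thesis using norm_le_sum3[of "synthesis c x"] by argo
qed

lemma L2_field_synthesis:
  assumes "admissible c C"
  shows "L2_field (synthesis c)"
  by (rule L2_field_bounded[OF periodic_synthesis synthesis_measurable[OF assms] synthesis_bounded[OF assms]])

lemma int_vec_minus: "int_vec k \<Longrightarrow> int_vec (- k)" by (auto simp: int_vec_def)
lemma int_vec_diff: "int_vec k \<Longrightarrow> int_vec l \<Longrightarrow> int_vec (k - l)" by (auto simp: int_vec_def)

text \<open>Absolute convergence permits termwise integration, and orthogonality keeps the one index
  n with \<open>lattice_enum n\<close> = k.\<close>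

lemma fourier_sum_coeff:
  assumes a: "admissible c C" and k: "int_vec k"
  shows "(LINT x:torus_box|lborel. fourier_sum c i x * cis (- (k \<bullet> x))) = of_real torus_vol * c k i"
proof -
  let ?f = "\<lambda>n x. indicator torus_box x *\<^sub>R (c (lattice_enum n) i * cis (lattice_enum n \<bullet> x) * cis (- (k \<bullet> x)))"
  have nb: "norm (c (lattice_enum n) i) \<le> C / weight (lattice_enum n)" for n using a by (simp add: admissible_def)
  have int: "integrable lborel (?f n)" for n
    using set_integrable_torus_bounded[of "\<lambda>x. c (lattice_enum n) i * cis (lattice_enum n \<bullet> x) * cis (- (k \<bullet> x))" "norm (c (lattice_enum n) i)"]
    by (simp add: set_integrable_def norm_mult)
  have "(LINT x:torus_box|lborel. fourier_sum c i x * cis (- (k \<bullet> x))) = (LINT x|lborel. (\<Sum>n. ?f n x))"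
    unfolding set_lebesgue_integral_def
  proof (rule Bochner_Integration.integral_cong[OF refl])
    fix x
    have s: "summable (\<lambda>n. c (lattice_enum n) i * cis (lattice_enum n \<bullet> x))"
      by (rule summable_comparison_test'[OF summable_weight_scaled[of C]]) (use nb in \<open>simp add: norm_mult\<close>)
    show "indicator torus_box x *\<^sub>R (fourier_sum c i x * cis (- (k \<bullet> x))) = (\<Sum>n. ?f n x)"
      unfolding fourier_sum_def using s
      by (simp add: suminf_mult2 suminf_scaleR_right[symmetric] summable_mult2)
  qed
  also have "\<dots> = (\<Sum>n. LINT x|lborel. ?f n x)"
  proof (rule integral_suminf[OF int])
    show "AE x in lborel. summable (\<lambda>n. norm (?f n x))"
    proof (intro always_eventually allI)
      fix x
      show "summable (\<lambda>n. norm (?f n x))"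
      proof (rule summable_comparison_test'[OF summable_weight_scaled[of C]])
        show "norm (norm (?f n x)) \<le> C / weight (lattice_enum n)" for n
          using nb[of n] order_trans[OF norm_ge_zero nb[of n]] by (cases "x \<in> torus_box") (simp_all add: norm_mult)
      qed
    qed
    have "(LINT x|lborel. norm (?f n x)) = norm (c (lattice_enum n) i) * torus_vol" for n
    proof -
      have "(LINT x|lborel. norm (?f n x)) = (LINT x|lborel. norm (c (lattice_enum n) i) * indicator torus_box x)"
        by (rule Bochner_Integration.integral_cong[OF refl]) (simp add: norm_mult)
      also have "\<dots> = norm (c (lattice_enum n) i) * torus_vol"
        by (simp add: measure_def emeasure_torus_box torus_vol_def)
      finally show ?thesis .
    qed
    moreover have "summable (\<lambda>n. norm (c (lattice_enum n) i) * torus_vol)"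
      by (rule summable_mult2, rule summable_comparison_test'[OF summable_weight_scaled[of C]]) (use nb in simp)
    ultimately show "summable (\<lambda>n. LINT x|lborel. norm (?f n x))" by simp
  qed
  also have "\<dots> = (\<Sum>n. if lattice_enum n = k then of_real torus_vol * c k i else 0)"
  proof (rule suminf_cong)
    fix n
    have "(LINT x|lborel. ?f n x) = (LINT x:torus_box|lborel. c (lattice_enum n) i * cis ((lattice_enum n - k) \<bullet> x))"
      unfolding set_lebesgue_integral_def
      by (rule Bochner_Integration.integral_cong[OF refl]) (simp add: cis_mult inner_diff_left mult.assoc)
    also have "\<dots> = c (lattice_enum n) i * (LINT x:torus_box|lborel. cis ((lattice_enum n - k) \<bullet> x))" by simp
    also have "\<dots> = (if lattice_enum n = k then of_real torus_vol * c k i else 0)"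
      unfolding integral_torus_cis[OF int_vec_diff[OF int_vec_lattice_enum k]] by (simp add: torus_vol_def)
    finally show "(LINT x|lborel. ?f n x) = (if lattice_enum n = k then of_real torus_vol * c k i else 0)" .
  qed
  also have "\<dots> = of_real torus_vol * c k i"
  proof -
    have "k \<in> range lattice_enum" using bij_lattice_enum k by (simp add: bij_betw_def)
    then obtain n0 where n0: "lattice_enum n0 = k" by auto
    have "lattice_enum n = k \<longleftrightarrow> n = n0" for n using bij_lattice_enum n0 by (auto simp: bij_betw_def inj_on_def)
    then have "(\<lambda>n. if lattice_enum n = k then of_real torus_vol * c k i else 0) = (\<lambda>n. if n = n0 then of_real torus_vol * c k i else 0)" by simp
    then show ?thesis using sums_single[of n0 "\<lambda>_. of_real torus_vol * c k i"] by (simp add: sums_iff)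
  qed
  finally show ?thesis .
qed

text \<open>Re z = (z + cnj z)/2, and the conjugate half contributes cnj (c (-k)), which equals c k
  by symmetry.\<close>

lemma fcoeff_synthesis:
  assumes a: "admissible c C" and k: "int_vec k"
  shows "fcoeff (\<lambda>x. synthesis c x $ i) k = c k i"
proof -
  let ?I = "\<lambda>k. LINT x:torus_box|lborel. fourier_sum c i x * cis (- (k \<bullet> x))"
  have meas: "fourier_sum c i \<in> borel_measurable borel" by (rule borel_measurable_continuous_onI[OF fourier_sum_continuous[OF a]])
  have int: "set_integrable lborel torus_box (\<lambda>x. fourier_sum c i x * cis (- (k \<bullet> x)))" for k
    by (rule set_integrable_torus_bounded[where C = "\<Sum>n. C / weight (lattice_enum n)"])
       (use meas fourier_sum_bound[OF a] in \<open>auto simp: norm_mult\<close>)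
  have cj: "(LINT x:torus_box|lborel. cnj (fourier_sum c i x) * cis (- (k \<bullet> x))) = cnj (?I (- k))"
    unfolding set_lebesgue_integral_def Bochner_Integration.integral_cnj[symmetric]
    by (rule Bochner_Integration.integral_cong[OF refl]) (simp add: cis_cnj)
  have mc: "(\<lambda>x. cnj (fourier_sum c i x)) \<in> borel_measurable borel"
    by (rule borel_measurable_continuous_onI, intro continuous_intros fourier_sum_continuous[OF a])
  have intc: "set_integrable lborel torus_box (\<lambda>x. cnj (fourier_sum c i x) * cis (- (k \<bullet> x)))"
    by (rule set_integrable_torus_bounded[where C = "\<Sum>n. C / weight (lattice_enum n)"])
       (use mc fourier_sum_bound[OF a] in \<open>auto simp: norm_mult\<close>)
  have "fcoeff (\<lambda>x. synthesis c x $ i) k = (LINT x:torus_box|lborel.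
     (fourier_sum c i x * cis (- (k \<bullet> x)) + cnj (fourier_sum c i x) * cis (- (k \<bullet> x))) / of_real (2 * torus_vol))"
    unfolding fcoeff_def
  proof (rule set_lebesgue_integral_cong)
    have "of_real (Re z / torus_vol) = (z + cnj z) / of_real (2 * torus_vol)" for z
      using torus_vol_pos by (simp add: complex_add_cnj)
    then show "\<forall>x. x \<in> torus_box \<longrightarrow> complex_of_real (synthesis c x $ i) * cis (- (k \<bullet> x)) =
       (fourier_sum c i x * cis (- (k \<bullet> x)) + cnj (fourier_sum c i x) * cis (- (k \<bullet> x))) / complex_of_real (2 * torus_vol)"
      by (simp add: synthesis_def algebra_simps del: of_real_divide)
  qed simp
  also have "\<dots> = (?I k + cnj (?I (- k))) / of_real (2 * torus_vol)"
    using int[of k] intc by (simp add: set_integral_add(2) cj)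
  also have "\<dots> = (of_real torus_vol * c k i + cnj (of_real torus_vol * c (- k) i)) / of_real (2 * torus_vol)"
    unfolding fourier_sum_coeff[OF a k] fourier_sum_coeff[OF a int_vec_minus[OF k]] ..
  also have "\<dots> = c k i"
    using a torus_vol_pos by (simp add: admissible_def)
  finally show ?thesis .
qed

text \<open>The sine is a cosine shifted by pi/2, so the divergence test is
  \<open>test_fcoeff\<close> with a = k; two values of \<theta> give the real and imaginary
  parts.\<close>

lemma div_free_iff:
  assumes "L2_field f"
  shows "div_free f \<longleftrightarrow> (\<forall>k. int_vec k \<longrightarrow> (\<Sum>i\<in>UNIV. of_real (k $ i) * fcoeff (\<lambda>x. f x $ i) k) = 0)"
proof -
  have e: "(LINT x:torus_box|lborel. (f x \<bullet> k) * sin (k \<bullet> x + \<theta>)) =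
     Re (cis (- (\<theta> - pi / 2)) * (\<Sum>i\<in>UNIV. of_real (k $ i) * fcoeff (\<lambda>x. f x $ i) k))" for k \<theta>
    unfolding test_fcoeff[OF assms, symmetric]
  proof (rule set_lebesgue_integral_cong)
    have "sin (y + \<theta>) = cos (y + (\<theta> - pi / 2))" for y
      by (simp add: sin_add cos_add cos_diff sin_diff)
    then show "\<forall>x. x \<in> torus_box \<longrightarrow> (f x \<bullet> k) * sin (k \<bullet> x + \<theta>) = f x \<bullet> (cos (k \<bullet> x + (\<theta> - pi / 2)) *\<^sub>R k)"
      by simp
  qed simp
  show ?thesis
  proof
    assume d: "div_free f"
    show "\<forall>k. int_vec k \<longrightarrow> (\<Sum>i\<in>UNIV. of_real (k $ i) * fcoeff (\<lambda>x. f x $ i) k) = 0"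
    proof (intro allI impI)
      fix k assume "int_vec k"
      then have z: "Re (cis (- (\<theta> - pi / 2)) * (\<Sum>i\<in>UNIV. of_real (k $ i) * fcoeff (\<lambda>x. f x $ i) k)) = 0" for \<theta>
        using d unfolding div_free_def e by blast
      have cq: "cis (pi / 2) = \<i>" by (simp add: complex_eq_iff)
      show "(\<Sum>i\<in>UNIV. of_real (k $ i) * fcoeff (\<lambda>x. f x $ i) k) = 0"
        by (rule complex_eqI) (use z[of "pi / 2"] z[of 0] in \<open>simp_all add: cq del: Re_sum Im_sum\<close>)
    qed
  next
    assume "\<forall>k. int_vec k \<longrightarrow> (\<Sum>i\<in>UNIV. of_real (k $ i) * fcoeff (\<lambda>x. f x $ i) k) = 0"
    then show "div_free f" unfolding div_free_def e by simp
  qed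
qed

lemma L2norm_le_sup:
  assumes "L2_field f" "\<And>x. norm (f x) \<le> M"
  shows "L2norm f \<le> sqrt torus_vol * M"
proof -
  have M: "M \<ge> 0" using order_trans[OF norm_ge_zero assms(2)] .
  have "(LINT x:torus_box|lborel. (norm (f x))\<^sup>2) \<le> (LINT x:torus_box|lborel. M\<^sup>2)"
  proof (rule set_integral_mono)
    show "set_integrable lborel torus_box (\<lambda>x. (norm (f x))\<^sup>2)" using assms(1) by (simp add: L2_field_def)
    show "set_integrable lborel torus_box (\<lambda>x. M\<^sup>2)" by (rule set_integrable_torus_bounded[where C = "M\<^sup>2"]) auto
  qed (intro power_mono assms(2) norm_ge_zero)
  also have "\<dots> = torus_vol * M\<^sup>2"
    by (simp add: set_lebesgue_integral_def measure_def emeasure_torus_box torus_vol_def)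
  finally show ?thesis unfolding L2norm_def using M
    by (metis abs_of_nonneg real_sqrt_abs real_sqrt_le_iff real_sqrt_mult)
qed

lemma synthesis_diff_bound:
  assumes a: "admissible c C" "admissible d C'"
  shows "norm (synthesis c x - synthesis d x) \<le> (\<Sum>i\<in>UNIV. (\<Sum>n. norm (c (lattice_enum n) i - d (lattice_enum n) i))) / torus_vol"
proof -
  have s: "summable (\<lambda>n. c (lattice_enum n) i * cis (lattice_enum n \<bullet> x))" if "admissible c C" for c C i
    by (rule summable_comparison_test'[OF summable_weight_scaled[of C]]) (use that in \<open>simp add: norm_mult admissible_def\<close>)
  have sd: "summable (\<lambda>n. norm (c (lattice_enum n) i - d (lattice_enum n) i))" for i
  proof (rule summable_comparison_test'[OF summable_add[OF summable_weight_scaled[of C] summable_weight_scaled[of C']]])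
    show "norm (norm (c (lattice_enum n) i - d (lattice_enum n) i)) \<le> C / weight (lattice_enum n) + C' / weight (lattice_enum n)" for n
    proof -
      have "norm (c (lattice_enum n) i) \<le> C / weight (lattice_enum n)" "norm (d (lattice_enum n) i) \<le> C' / weight (lattice_enum n)"
        using a by (auto simp: admissible_def)
      then show ?thesis using norm_triangle_ineq4[of "c (lattice_enum n) i" "d (lattice_enum n) i"] by simp
    qed
  qed
  have c: "\<bar>(synthesis c x - synthesis d x) $ i\<bar> \<le> (\<Sum>n. norm (c (lattice_enum n) i - d (lattice_enum n) i)) / torus_vol" for i
  proof -
    have "fourier_sum c i x - fourier_sum d i x = (\<Sum>n. (c (lattice_enum n) i - d (lattice_enum n) i) * cis (lattice_enum n \<bullet> x))"
      unfolding fourier_sum_def using suminf_diff[OF s[OF a(1), of i] s[OF a(2), of i]] by (simp add: algebra_simps)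
    also have "norm \<dots> \<le> (\<Sum>n. norm (c (lattice_enum n) i - d (lattice_enum n) i))"
      by (rule norm_suminf_le[OF _ sd]) (simp add: norm_mult)
    finally have "\<bar>Re (fourier_sum c i x - fourier_sum d i x)\<bar> \<le> (\<Sum>n. norm (c (lattice_enum n) i - d (lattice_enum n) i))"
      using abs_Re_le_cmod order_trans by blast
    then show ?thesis using torus_vol_pos by (simp add: synthesis_def diff_divide_distrib[symmetric] abs_divide divide_right_mono)
  qed
  show ?thesis using norm_le_sum3[of "synthesis c x - synthesis d x"] c[of 1] c[of 2] c[of 3]
    by (simp add: sum_3 add_divide_distrib)
qed

text \<open>The L2 distance is at most a constant times the sum over all modes of the coefficient
  differences. On bounded intervals this series of continuous functions has a summable majorant, so
  it is continuous in t, and it vanishes at t0.\<close>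

lemma synthesis_time_continuous:
  fixes c :: "real \<Rightarrow> real^3 \<Rightarrow> 3 \<Rightarrow> complex"
  assumes admissible: "\<And>T. \<exists>C. \<forall>t\<in>{0..T}. admissible (c t) C"
    and cont: "\<And>k i. continuous_on {0..} (\<lambda>t. c t k i)" and t0: "t0 \<ge> 0"
  shows "((\<lambda>t. L2norm (\<lambda>x. synthesis (c t) x - synthesis (c t0) x)) \<longlongrightarrow> 0) (at t0 within {0..})"
proof -
  define D where "D t = sqrt torus_vol * ((\<Sum>i\<in>(UNIV::3 set). (\<Sum>n. norm (c t (lattice_enum n) i - c t0 (lattice_enum n) i))) / torus_vol)" for t
  have "continuous_on {0..} D"
  proof (rule continuous_on_halfline)
    fix T
    obtain C where C: "\<forall>t\<in>{0..max T t0}. admissible (c t) C" using admissible by blast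
    have "continuous_on {0..T} (\<lambda>t. \<Sum>n. norm (c t (lattice_enum n) i - c t0 (lattice_enum n) i))" for i
    proof (rule continuous_on_suminf)
      show "continuous_on {0..T} (\<lambda>t. norm (c t (lattice_enum n) i - c t0 (lattice_enum n) i))" for n
        by (intro continuous_intros continuous_on_subset[OF cont]) auto
      show "norm (norm (c t (lattice_enum n) i - c t0 (lattice_enum n) i)) \<le> 2 * C / weight (lattice_enum n)" if "t \<in> {0..T}" for n t
      proof -
        have "norm (c t (lattice_enum n) i) \<le> C / weight (lattice_enum n)" "norm (c t0 (lattice_enum n) i) \<le> C / weight (lattice_enum n)"
          using C that t0 by (auto simp: admissible_def)
        then show ?thesis using norm_triangle_ineq4[of "c t (lattice_enum n) i" "c t0 (lattice_enum n) i"] by simp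
      qed
      show "summable (\<lambda>n. 2 * C / weight (lattice_enum n))" by (rule summable_weight_scaled)
    qed
    then show "continuous_on {0..T} D" unfolding D_def by (intro continuous_intros) (use torus_vol_pos in auto)
  qed
  then have "(D \<longlongrightarrow> D t0) (at t0 within {0..})" using t0 by (auto simp: continuous_on_def)
  moreover have "D t0 = 0" by (simp add: D_def)
  ultimately have lim: "(D \<longlongrightarrow> 0) (at t0 within {0..})" by simp
  have le: "L2norm (\<lambda>x. synthesis (c t) x - synthesis (c t0) x) \<le> D t" if "t \<ge> 0" for t
  proof -
    obtain C where C: "\<forall>s\<in>{0..max t t0}. admissible (c s) C" using admissible by blast
    have a: "admissible (c t) C" "admissible (c t0) C" using C that t0 by auto
    show ?thesis unfolding D_def
      by (rule L2norm_le_sup[OF L2_field_diff[OF L2_field_synthesis[OF a(1)] L2_field_synthesis[OF a(2)]] synthesis_diff_bound[OF a]])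
  qed
  show ?thesis
    by (rule tendsto_sandwich[OF _ _ tendsto_const lim]) (auto simp: eventually_at_filter le)
qed

section \<open>The fast dynamo\<close>

definition dynamo_vel :: "real \<Rightarrow> real^3 \<Rightarrow> real^3" where
  "dynamo_vel t = shear_vel (wave (phase_at t)) (cosamp (phase_at t)) (sinamp (phase_at t))"

section \<open>Regularity and solenoidality of the velocity\<close>

lemma shear_vel_periodic:
  assumes "q \<in> \<int>"
  shows "periodic3 (shear_vel q A S)"
  unfolding periodic3_def
proof (intro allI)
  fix x and i :: 3
  have c: "cis (q * (x + (2 * pi) *\<^sub>R axis i 1) $ l) = cis (q * x $ l)" for l
  proof (cases "l = i")
    case True
    have "cis (2 * pi * q) = 1" using assms by (rule cis_multiple_2pi)
    then show ?thesis using True by (simp add: axis_def distrib_left cis_mult[symmetric] mult_ac)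
  qed (simp add: axis_def)
  have "cos (q * (x + (2 * pi) *\<^sub>R axis i 1) $ l) = cos (q * x $ l)"
    "sin (q * (x + (2 * pi) *\<^sub>R axis i 1) $ l) = sin (q * x $ l)" for l
    using c[of l] by (metis cis.simps(1)) (use c[of l] in \<open>metis cis.simps(2)\<close>)
  then show "shear_vel q A S (x + (2 * pi) *\<^sub>R axis i 1) = shear_vel q A S x"
    by (simp only: shear_vel_def)
qed

lemma continuous_shear_vel: "continuous_on UNIV (shear_vel q A S)"
  unfolding shear_vel_def by (intro continuous_intros)

lemma norm_fourier_amp_le: "norm (cosamp p l) \<le> 3" "norm (sinamp p l) \<le> 3"
  using norm_le_sum3[of "cosamp p l"] abs_fourier_amp_le(1)[of p l 1] abs_fourier_amp_le(1)[of p l 2] abs_fourier_amp_le(1)[of p l 3]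
    norm_le_sum3[of "sinamp p l"] abs_fourier_amp_le(2)[of p l 1] abs_fourier_amp_le(2)[of p l 2] abs_fourier_amp_le(2)[of p l 3]
  by linarith+

text \<open>Every component of an amplitude is at most the inverse of its wave number; this makes
  the Lipschitz constant the same for all phases.\<close>

lemma wave_fourier_amp_le: "\<bar>wave p\<bar> * norm (cosamp p l) \<le> 3" "\<bar>wave p\<bar> * norm (sinamp p l) \<le> 3"
proof -
  have m: "scale_inv > 0" by (simp add: scale_inv_def)
  have "\<bar>wave p\<bar> * \<bar>cosamp p l $ j\<bar> \<le> 1" "\<bar>wave p\<bar> * \<bar>sinamp p l $ j\<bar> \<le> 1" for j
    using m del_bounds by (cases p; auto simp: axis_def abs_mult)+
  note * = this
  have "\<bar>wave p\<bar> * norm (cosamp p l) \<le> \<bar>wave p\<bar> * (\<bar>cosamp p l $ 1\<bar> + \<bar>cosamp p l $ 2\<bar> + \<bar>cosamp p l $ 3\<bar>)"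
    "\<bar>wave p\<bar> * norm (sinamp p l) \<le> \<bar>wave p\<bar> * (\<bar>sinamp p l $ 1\<bar> + \<bar>sinamp p l $ 2\<bar> + \<bar>sinamp p l $ 3\<bar>)"
    by (intro mult_left_mono norm_le_sum3 abs_ge_zero)+
  then show "\<bar>wave p\<bar> * norm (cosamp p l) \<le> 3" "\<bar>wave p\<bar> * norm (sinamp p l) \<le> 3"
    using *(1)[of 1] *(1)[of 2] *(1)[of 3] *(2)[of 1] *(2)[of 2] *(2)[of 3]
    unfolding distrib_left by linarith+
qed

lemma dynamo_vel_bounded: "norm (dynamo_vel t x) \<le> 18"
proof -
  define p where "p = phase_at t"
  have "norm (cos (wave p * x $ l) *\<^sub>R cosamp p l + sin (wave p * x $ l) *\<^sub>R sinamp p l) \<le> 6" for l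
  proof -
    have "norm (cos (wave p * x $ l) *\<^sub>R cosamp p l) \<le> 1 * 3" "norm (sin (wave p * x $ l) *\<^sub>R sinamp p l) \<le> 1 * 3"
      unfolding norm_scaleR by (intro mult_mono norm_fourier_amp_le; simp)+
    then show ?thesis using norm_triangle_ineq[of "cos (wave p * x $ l) *\<^sub>R cosamp p l" "sin (wave p * x $ l) *\<^sub>R sinamp p l"] by linarith
  qed
  then have "norm (shear_vel (wave p) (cosamp p) (sinamp p) x) \<le> (\<Sum>l\<in>(UNIV::3 set). 6)"
    unfolding shear_vel_def by (intro sum_norm_le)
  then show ?thesis by (simp add: dynamo_vel_def p_def)
qed

lemma abs_cos_diff_le: "\<bar>cos x - cos y\<bar> \<le> \<bar>x - y\<bar>" for x y :: real
proof -
  have "norm (cos x - cos y) \<le> 1 * norm (x - y)"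
    by (rule field_differentiable_bound[of UNIV cos "\<lambda>x. - sin x"]) (auto intro!: derivative_eq_intros)
  then show ?thesis by simp
qed

lemma abs_sin_diff_le: "\<bar>sin x - sin y\<bar> \<le> \<bar>x - y\<bar>" for x y :: real
proof -
  have "norm (sin x - sin y) \<le> 1 * norm (x - y)"
    by (rule field_differentiable_bound[of UNIV sin cos]) (auto intro!: derivative_eq_intros)
  then show ?thesis by simp
qed

lemma dynamo_vel_lipschitz: "norm (dynamo_vel t x - dynamo_vel t y) \<le> 18 * norm (x - y)"
proof -
  define p where "p = phase_at t"
  have b: "norm ((f (wave p * x $ l) - f (wave p * y $ l)) *\<^sub>R A) \<le> 3 * norm (x - y)"
    if f: "\<And>a b. \<bar>f a - f b\<bar> \<le> \<bar>a - b\<bar>" and A: "\<bar>wave p\<bar> * norm A \<le> 3" for f :: "real \<Rightarrow> real" and A :: "real^3" and l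
  proof -
    have "\<bar>f (wave p * x $ l) - f (wave p * y $ l)\<bar> \<le> \<bar>wave p\<bar> * \<bar>(x - y) $ l\<bar>"
      using f[of "wave p * x $ l" "wave p * y $ l"] by (simp add: right_diff_distrib[symmetric] abs_mult)
    also have "\<dots> \<le> \<bar>wave p\<bar> * norm (x - y)" by (intro mult_left_mono component_le_norm_cart) simp
    finally have "norm ((f (wave p * x $ l) - f (wave p * y $ l)) *\<^sub>R A) \<le> \<bar>wave p\<bar> * norm (x - y) * norm A"
      unfolding norm_scaleR by (intro mult_right_mono) auto
    also have "\<dots> = (\<bar>wave p\<bar> * norm A) * norm (x - y)" by simp
    also have "\<dots> \<le> 3 * norm (x - y)" by (intro mult_right_mono A) simp
    finally show ?thesis .
  qed
  have "shear_vel (wave p) (cosamp p) (sinamp p) x - shear_vel (wave p) (cosamp p) (sinamp p) y =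
    (\<Sum>l\<in>UNIV. (cos (wave p * x $ l) - cos (wave p * y $ l)) *\<^sub>R cosamp p l + (sin (wave p * x $ l) - sin (wave p * y $ l)) *\<^sub>R sinamp p l)"
    unfolding shear_vel_def sum_subtractf[symmetric] by (simp add: algebra_simps)
  also have "norm \<dots> \<le> (\<Sum>l\<in>(UNIV::3 set). 6 * norm (x - y))"
  proof (rule sum_norm_le)
    fix l :: 3
    show "norm ((cos (wave p * x $ l) - cos (wave p * y $ l)) *\<^sub>R cosamp p l + (sin (wave p * x $ l) - sin (wave p * y $ l)) *\<^sub>R sinamp p l)
       \<le> 6 * norm (x - y)"
      using norm_triangle_ineq[of "(cos (wave p * x $ l) - cos (wave p * y $ l)) *\<^sub>R cosamp p l" "(sin (wave p * x $ l) - sin (wave p * y $ l)) *\<^sub>R sinamp p l"]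
        b[of cos "cosamp p l" l, OF abs_cos_diff_le wave_fourier_amp_le(1)] b[of sin "sinamp p l" l, OF abs_sin_diff_le wave_fourier_amp_le(2)]
      by linarith
  qed
  also have "\<dots> = 18 * norm (x - y)" by simp
  finally show ?thesis by (simp add: dynamo_vel_def p_def)
qed

text \<open>Each wave is transverse to the direction in which it varies.\<close>

lemma phase_amp_diag: "phase_amp p l l = 0"
  by (cases p) (auto simp: phase_amp_def fourier_amp_def complex_eq_iff axis_def)

lemma L2_field_shear:
  assumes "q \<in> \<int>" "\<And>x. norm (shear_vel q A S x) \<le> M"
  shows "L2_field (shear_vel q A S)"
  using assms by (intro L2_field_bounded shear_vel_periodic borel_measurable_continuous_onI continuous_shear_vel)

text \<open>The coefficient at k receives a contribution from direction l only if k = +- q e_l, and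
  there k selects component l of the amplitude, which is 0 by \<open>phase_amp_diag\<close>.\<close>

lemma div_free_dynamo_vel: "div_free (dynamo_vel t)"
proof -
  define p where "p = phase_at t"
  have L: "L2_field (dynamo_vel t)"
    unfolding dynamo_vel_def using dynamo_vel_bounded[of t]
    by (intro L2_field_shear wave_Ints) (auto simp: dynamo_vel_def)
  have Z: "(LINT x:torus_box|lborel. cis (- (k \<bullet> x))) = (if k = 0 then of_real torus_vol else 0)" if "int_vec k" for k
    using integral_torus_cis[OF int_vec_minus[OF that]] by (simp add: torus_vol_def)
  have I: "set_integrable lborel torus_box (\<lambda>x. c * cis (- (k \<bullet> x)))" for k and c :: complex
    by (rule set_integrable_torus_bounded[where C = "norm c"]) (auto simp: norm_mult)
  show ?thesis
    unfolding div_free_iff[OF L]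
  proof (intro allI impI)
    fix k assume k: "int_vec k"
    define E where "E l = (if k = shift (wave p) l then complex_of_real torus_vol else 0)" for l
    define F where "F l = (if k = - shift (wave p) l then complex_of_real torus_vol else 0)" for l
    have f: "fcoeff (\<lambda>x. dynamo_vel t x $ i) k = (\<Sum>l\<in>UNIV. phase_amp p l i * E l + cnj (phase_amp p l i) * F l)" for i
    proof -
      have "fcoeff (\<lambda>x. dynamo_vel t x $ i) k = (LINT x:torus_box|lborel.
         (\<Sum>l\<in>UNIV. phase_amp p l i * cis (- ((k - shift (wave p) l) \<bullet> x)) + cnj (phase_amp p l i) * cis (- ((k + shift (wave p) l) \<bullet> x))))"
        unfolding fcoeff_def dynamo_vel_def shear_vel_fourier p_def[symmetric] phase_amp_def ..
      also have "\<dots> = (\<Sum>l\<in>UNIV. phase_amp p l i * (LINT x:torus_box|lborel. cis (- ((k - shift (wave p) l) \<bullet> x)))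
         + cnj (phase_amp p l i) * (LINT x:torus_box|lborel. cis (- ((k + shift (wave p) l) \<bullet> x))))"
      proof -
        define e where "e k x = indicator torus_box x *\<^sub>R cis (- (k \<bullet> x))" for k x :: "real^3"
        have hb: "has_bochner_integral lborel (e k) (LINT x:torus_box|lborel. cis (- (k \<bullet> x)))" for k
          using I[of 1 k] unfolding has_bochner_integral_iff e_def set_integrable_def set_lebesgue_integral_def by simp
        have "has_bochner_integral lborel (\<lambda>x. \<Sum>l\<in>UNIV. phase_amp p l i * e (k - shift (wave p) l) x + cnj (phase_amp p l i) * e (k + shift (wave p) l) x)
          (\<Sum>l\<in>UNIV. phase_amp p l i * (LINT x:torus_box|lborel. cis (- ((k - shift (wave p) l) \<bullet> x)))
         + cnj (phase_amp p l i) * (LINT x:torus_box|lborel. cis (- ((k + shift (wave p) l) \<bullet> x))))"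
          by (intro has_bochner_integral_sum has_bochner_integral_add has_bochner_integral_mult_right hb)
        moreover have "(\<Sum>l\<in>UNIV. phase_amp p l i * e (k - shift (wave p) l) x + cnj (phase_amp p l i) * e (k + shift (wave p) l) x) =
          indicator torus_box x *\<^sub>R (\<Sum>l\<in>UNIV. phase_amp p l i * cis (- ((k - shift (wave p) l) \<bullet> x)) + cnj (phase_amp p l i) * cis (- ((k + shift (wave p) l) \<bullet> x)))" for x
          by (cases "x \<in> torus_box") (simp_all add: e_def)
        ultimately show ?thesis unfolding set_lebesgue_integral_def by (simp only: has_bochner_integral_iff)
      qed
      also have "\<dots> = (\<Sum>l\<in>UNIV. phase_amp p l i * E l + cnj (phase_amp p l i) * F l)"
        unfolding Z[OF int_vec_shift(1)[OF k]] Z[OF int_vec_shift(2)[OF k]] E_def F_def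
        by (simp add: eq_neg_iff_add_eq_0)
      finally show ?thesis .
    qed
    have kE: "of_real (k $ i) * (phase_amp p l i * E l) = 0" for i l
      by (cases "l = i") (auto simp: E_def phase_amp_diag shift_def axis_def)
    have kF: "of_real (k $ i) * (cnj (phase_amp p l i) * F l) = 0" for i l
      by (cases "l = i") (auto simp: F_def phase_amp_diag shift_def axis_def)
    show "(\<Sum>i\<in>UNIV. of_real (k $ i) * fcoeff (\<lambda>x. dynamo_vel t x $ i) k) = 0"
      unfolding f sum_distrib_left distrib_left kE kF by simp
  qed
qed

lemma velocity_field_dynamo_vel: "velocity_field dynamo_vel"
  unfolding velocity_field_def
proof (intro conjI)
  have "(\<lambda>z::real \<times> (real^3). phase_at (fst z)) \<in> borel \<rightarrow>\<^sub>M count_space UNIV"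
    by (rule measurable_compose[OF _ measurable_phase_at]) (intro borel_measurable_continuous_onI continuous_intros)
  moreover have "(\<lambda>z::real \<times> (real^3). shear_vel (wave p) (cosamp p) (sinamp p) (snd z)) \<in> borel_measurable borel" for p
    by (intro borel_measurable_continuous_onI continuous_on_compose2[OF continuous_shear_vel] continuous_intros) auto
  ultimately show "(\<lambda>p. dynamo_vel (fst p) (snd p)) \<in> borel_measurable borel"
    unfolding dynamo_vel_def
    by (intro measurable_compose_countable[where f = "\<lambda>p z. shear_vel (wave p) (cosamp p) (sinamp p) (snd z)" and g = "\<lambda>z. phase_at (fst z)"])
  show "\<exists>M. \<forall>t>0. \<forall>x. norm (dynamo_vel t x) \<le> M" using dynamo_vel_bounded by blast
  show "\<exists>L. \<forall>t>0. \<forall>x y. norm (dynamo_vel t x - dynamo_vel t y) \<le> L * norm (x - y)" using dynamo_vel_lipschitz by blast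
  show "\<forall>t>0. periodic3 (dynamo_vel t) \<and> div_free (dynamo_vel t)"
    using div_free_dynamo_vel shear_vel_periodic[OF wave_Ints] by (simp add: dynamo_vel_def)
qed

text \<open>One datum for all \<epsilon>. It consists of the conserved mean alone, so every epoch
  finds the same amplitude.\<close>

definition seed_field :: "real^3 \<Rightarrow> real^3" where "seed_field x = axis 3 1"

lemma L2_field_seed: "L2_field seed_field"
proof -
  have "seed_field = (\<lambda>_. axis 3 1)" by (rule ext) (simp add: seed_field_def)
  moreover have "L2_field (\<lambda>_::real^3. axis 3 1)"
    by (rule L2_field_bounded[where M = 1]) (auto simp: periodic3_def)
  ultimately show ?thesis by simp
qed

lemma fcoeff_seed:
  assumes "int_vec k"
  shows "fcoeff (\<lambda>x. seed_field x $ i) k = (if k = 0 \<and> i = 3 then of_real torus_vol else 0)"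
proof -
  have "(LINT x:torus_box|lborel. cis (- (k \<bullet> x))) = (if k = 0 then of_real torus_vol else 0)"
    using integral_torus_cis[OF int_vec_minus[OF assms]] by (simp add: torus_vol_def)
  then show ?thesis by (simp add: fcoeff_def seed_field_def axis_def)
qed

section \<open>Existence of a weak solution\<close>

lemma phase_rhs_dynamo: "mode_rhs \<epsilon> (wave p) (cosamp p) (sinamp p) = phase_rhs \<epsilon> p" by (simp add: phase_rhs_def)

lemma dynamo_solution_exists:
  assumes \<epsilon>: "\<epsilon> > 0"
  shows "\<exists>B. dynamo_solution dynamo_vel \<epsilon> seed_field B"
proof -
  define c where "c = dyson \<epsilon> torus_vol"
  have V: "torus_vol \<ge> 0" using torus_vol_pos by simp
  define B where "B t = synthesis (c t)" for t
  have admissible: "\<exists>C. \<forall>t\<in>{0..T}. admissible (c t) C" for T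
  proof -
    obtain C where "\<forall>t\<in>{0..T}. \<forall>k i. norm (c t k i) \<le> C / weight k" using dyson_bound[OF \<epsilon> V] unfolding c_def by blast
    then show ?thesis using dyson_cnj[OF \<epsilon> V] by (auto simp: admissible_def c_def)
  qed
  have adm': "\<exists>C. admissible (c t) C" if "t \<ge> 0" for t using admissible[of t] that by auto
  have L2: "L2_field (B t)" if "t \<ge> 0" for t using adm'[OF that] L2_field_synthesis unfolding B_def by blast
  have co: "field_coeffs B t k i = c t k i" if "t \<ge> 0" "int_vec k" for t k i
    using adm'[OF that(1)] fcoeff_synthesis that(2) unfolding field_coeffs_def B_def by blast
  have shift: "dynamo_vel s = shear_vel (wave (phase_at s)) (cosamp (phase_at s)) (sinamp (phase_at s))" for s
    by (simp add: dynamo_vel_def)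
  have prc: "phase_rhs \<epsilon> p (field_coeffs B s) k i = phase_rhs \<epsilon> p (c s) k i" if "s \<ge> 0" "int_vec k" for p s k i
    unfolding phase_rhs_def mode_rhs_def induction_term_def using that by (simp add: co int_vec_shift)
  have cont: "continuous_on {0..} (\<lambda>t. c t k i)" for k i unfolding c_def by (rule dyson_continuous[OF \<epsilon> V])
  have "dynamo_solution dynamo_vel \<epsilon> seed_field B"
    unfolding dynamo_solution_def
  proof (intro conjI allI impI)
    fix t :: real assume t: "t \<ge> 0"
    show "L2_field (B t)" by (rule L2[OF t])
    show "div_free (B t)"
      unfolding div_free_iff[OF L2[OF t]] using co[OF t] dyson_div[OF \<epsilon> V t] by (simp add: field_coeffs_def c_def)
  next
    fix t0 :: real assume "t0 \<ge> 0"
    then show "((\<lambda>t. L2norm (\<lambda>x. B t x - B t0 x)) \<longlongrightarrow> 0) (at t0 within {0..})"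
      unfolding B_def by (intro synthesis_time_continuous admissible cont)
  next
    fix t :: real and k a \<theta> assume t: "t \<ge> 0" and k: "int_vec k"
    have int: "set_integrable lborel {0..t} (\<lambda>s. phase_rhs \<epsilon> (phase_at s) (field_coeffs B s) k i)"
      and val: "(LINT s:{0..t}|lborel. phase_rhs \<epsilon> (phase_at s) (field_coeffs B s) k i) = c t k i - c 0 k i" for i
    proof -
      \<comment> \<open>The series solves the equation for t \<ge> 0; freezing it at its initial
        value for negative times gives a function continuous on the whole line, the setting of
        \<open>measurable_phase_induction\<close>.\<close>
      define c' where "c' s = c (max 0 s)" for s
      have cc: "continuous_on UNIV (\<lambda>s. c' s k i)" for k i
        unfolding c'_def by (rule continuous_on_compose2[OF cont]) (auto intro!: continuous_intros)
      obtain C where C: "\<forall>s\<in>{0..t}. \<forall>k i. norm (c s k i) \<le> C / weight k" using dyson_bound[OF \<epsilon> V] unfolding c_def by blast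
      have C1: "norm (c s k' j) \<le> \<bar>C\<bar>" if "s \<in> {0..t}" for s k' j
      proof -
        have "norm (c s k' j) \<le> C / weight k'" using C that by blast
        also have "\<dots> \<le> \<bar>C\<bar> / 1" using weight_ge_1[of k'] by (intro frac_le) auto
        finally show ?thesis by simp
      qed
      have meas: "(\<lambda>s. phase_rhs \<epsilon> (phase_at s) (c' s) k i) \<in> borel_measurable borel"
      proof -
        have [measurable]: "(\<lambda>s. c' s k i) \<in> borel_measurable borel" by (rule borel_measurable_continuous_onI[OF cc])
        have [measurable]: "(\<lambda>s. phase_induction (phase_at s) (c' s) k i) \<in> borel_measurable borel" by (rule measurable_phase_induction[OF cc])
        show ?thesis unfolding phase_rhs_def mode_rhs_def by measurable
      qed
      have i': "set_integrable lborel {0..t} (\<lambda>s. phase_rhs \<epsilon> (phase_at s) (c' s) k i)"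
      proof (rule set_integrable_bounded_Icc[OF meas])
        fix s assume s: "s \<in> {0..t}"
        have "c' s = c s" using s by (simp add: c'_def max_def)
        have "norm (phase_induction (phase_at s) (c s) k i) \<le> 36 * norm k * \<bar>C\<bar>"
          by (rule norm_induction_term) (use C1[OF s] in auto)
        moreover have "norm (of_real (\<epsilon> * (norm k)\<^sup>2) * c s k i) \<le> \<epsilon> * (norm k)\<^sup>2 * \<bar>C\<bar>"
          unfolding norm_mult norm_of_real using C1[OF s, of k i] \<epsilon> by (simp add: mult_left_mono)
        ultimately show "norm (phase_rhs \<epsilon> (phase_at s) (c' s) k i) \<le> 36 * norm k * \<bar>C\<bar> + \<epsilon> * (norm k)\<^sup>2 * \<bar>C\<bar>"
          unfolding phase_rhs_def mode_rhs_def \<open>c' s = c s\<close>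
          using norm_triangle_ineq4[of "phase_induction (phase_at s) (c s) k i" "of_real (\<epsilon> * (norm k)\<^sup>2) * c s k i"] by linarith
      qed
      have e: "phase_rhs \<epsilon> (phase_at s) (c' s) k i = phase_rhs \<epsilon> (phase_at s) (field_coeffs B s) k i" if "s \<in> {0..t}" for s
        using that k by (simp add: prc c'_def max_def)
      show "set_integrable lborel {0..t} (\<lambda>s. phase_rhs \<epsilon> (phase_at s) (field_coeffs B s) k i)"
        by (rule set_integrable_cong[THEN iffD1, OF refl refl _ i']) (use e in auto)
      then have "(LINT s:{0..t}|lborel. phase_rhs \<epsilon> (phase_at s) (field_coeffs B s) k i) = integral {0..t} (\<lambda>s. phase_rhs \<epsilon> (phase_at s) (field_coeffs B s) k i)"
        by (rule set_borel_integral_eq_integral(2))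
      also have "\<dots> = integral {0..t} (\<lambda>s. phase_rhs \<epsilon> (phase_at s) (c s) k i)"
        by (rule Henstock_Kurzweil_Integration.integral_cong) (use k in \<open>simp add: prc\<close>)
      also have "\<dots> = c t k i - c 0 k i"
        unfolding c_def by (rule integral_unique[OF dyson_mode_eq[OF \<epsilon> V t]])
      finally show "(LINT s:{0..t}|lborel. phase_rhs \<epsilon> (phase_at s) (field_coeffs B s) k i) = c t k i - c 0 k i" .
    qed
    have c0: "c 0 k i = fcoeff (\<lambda>x. seed_field x $ i) k" for i
      unfolding fcoeff_seed[OF k] c_def by (rule dyson_0[OF \<epsilon> V])
    have "set_integrable lborel {0..t} (dynamo_flux dynamo_vel \<epsilon> B k a \<theta>) \<and>
        (LINT x:torus_box|lborel. B t x \<bullet> (cos (k \<bullet> x + \<theta>) *\<^sub>R a))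
          - (LINT x:torus_box|lborel. seed_field x \<bullet> (cos (k \<bullet> x + \<theta>) *\<^sub>R a))
        = (LINT s:{0..t}|lborel. dynamo_flux dynamo_vel \<epsilon> B k a \<theta> s)"
      by (rule coeff_imp_weak_form[OF L2 L2_field_seed t shift])
         (use int val co[OF t k] c0 in \<open>simp_all add: phase_rhs_dynamo\<close>)
    then show "set_integrable lborel {0..t} (dynamo_flux dynamo_vel \<epsilon> B k a \<theta>)"
      "(LINT x:torus_box|lborel. B t x \<bullet> (cos (k \<bullet> x + \<theta>) *\<^sub>R a))
          - (LINT x:torus_box|lborel. seed_field x \<bullet> (cos (k \<bullet> x + \<theta>) *\<^sub>R a))
        = (LINT s:{0..t}|lborel. dynamo_flux dynamo_vel \<epsilon> B k a \<theta> s)"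
      by blast+
  qed
  then show ?thesis by blast
qed

section \<open>Every weak solution satisfies the mode equations\<close>

lemma fcoeff_diff:
  assumes "L2_field f" "L2_field g"
  shows "fcoeff (\<lambda>x. (f x - g x) $ i) k = fcoeff (\<lambda>x. f x $ i) k - fcoeff (\<lambda>x. g x $ i) k"
proof -
  note h = has_bochner_integral_diff[OF has_bochner_integral_fcoeff[OF assms(1), of i k] has_bochner_integral_fcoeff[OF assms(2), of i k]]
  have "(\<lambda>x. indicator torus_box x *\<^sub>R (complex_of_real (f x $ i) * cis (- (k \<bullet> x))) - indicator torus_box x *\<^sub>R (complex_of_real (g x $ i) * cis (- (k \<bullet> x))))
     = (\<lambda>x. indicator torus_box x *\<^sub>R (complex_of_real ((f x - g x) $ i) * cis (- (k \<bullet> x))))"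
    by (auto simp: algebra_simps)
  then show ?thesis using h unfolding fcoeff_def set_lebesgue_integral_def by (simp add: has_bochner_integral_iff)
qed

text \<open>A squared triangle inequality; the factors 2 are harmless because only local boundedness
  in time is drawn from it.\<close>

lemma L2norm_sq_le:
  assumes "L2_field f" "L2_field g"
  shows "(L2norm f)\<^sup>2 \<le> 2 * (L2norm (\<lambda>x. f x - g x))\<^sup>2 + 2 * (L2norm g)\<^sup>2"
proof -
  have sq: "(L2norm h)\<^sup>2 = (LINT x:torus_box|lborel. (norm (h x))\<^sup>2)" for h :: "real^3 \<Rightarrow> real^3"
  proof -
    have "0 \<le> (LINT x:torus_box|lborel. (norm (h x))\<^sup>2)"
      unfolding set_lebesgue_integral_def by (intro Bochner_Integration.integral_nonneg) auto
    then show ?thesis by (simp add: L2norm_def)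
  qed
  have i: "set_integrable lborel torus_box (\<lambda>x. (norm (f x))\<^sup>2)" "set_integrable lborel torus_box (\<lambda>x. (norm (g x))\<^sup>2)"
    "set_integrable lborel torus_box (\<lambda>x. (norm (f x - g x))\<^sup>2)"
    using assms L2_field_diff[OF assms] by (auto simp: L2_field_def)
  have "(LINT x:torus_box|lborel. (norm (f x))\<^sup>2) \<le> (LINT x:torus_box|lborel. 2 * (norm (f x - g x))\<^sup>2 + 2 * (norm (g x))\<^sup>2)"
  proof (rule set_integral_mono[OF i(1)])
    show "set_integrable lborel torus_box (\<lambda>x. 2 * (norm (f x - g x))\<^sup>2 + 2 * (norm (g x))\<^sup>2)"
      using i by (intro set_integral_add set_integrable_mult_right) auto
    fix x
    have "norm (f x) \<le> norm (f x - g x) + norm (g x)" using norm_triangle_ineq[of "f x - g x" "g x"] by simp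
    then have "(norm (f x))\<^sup>2 \<le> (norm (f x - g x) + norm (g x))\<^sup>2" by (intro power_mono) auto
    also have "\<dots> \<le> 2 * (norm (f x - g x))\<^sup>2 + 2 * (norm (g x))\<^sup>2"
      using zero_le_power2[of "norm (f x - g x) - norm (g x)"] by (simp add: power2_eq_square algebra_simps)
    finally show "(norm (f x))\<^sup>2 \<le> 2 * (norm (f x - g x))\<^sup>2 + 2 * (norm (g x))\<^sup>2" .
  qed
  also have "\<dots> = 2 * (LINT x:torus_box|lborel. (norm (f x - g x))\<^sup>2) + 2 * (LINT x:torus_box|lborel. (norm (g x))\<^sup>2)"
    using i by (subst set_integral_add(2)) auto
  finally show ?thesis unfolding sq .
qed

lemma locally_bounded_imp_bounded:
  fixes f :: "real \<Rightarrow> real"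
  assumes "\<And>x. x \<in> {0..T} \<Longrightarrow> \<exists>C d. d > 0 \<and> (\<forall>y\<in>{0..T}. dist y x < d \<longrightarrow> f y \<le> C)"
  shows "\<exists>C. \<forall>y\<in>{0..T}. f y \<le> C"
proof -
  obtain C d where Cd: "\<And>x. x \<in> {0..T} \<Longrightarrow> d x > 0 \<and> (\<forall>y\<in>{0..T}. dist y x < d x \<longrightarrow> f y \<le> C x)"
    using assms by metis
  obtain F where F: "F \<subseteq> {0..T}" "finite F" "{0..T} \<subseteq> (\<Union>x\<in>F. ball x (d x))"
  proof (rule compactE_image[of "{0..T}" "{0..T}" "\<lambda>x. ball x (d x)"])
    show "{0..T} \<subseteq> (\<Union>x\<in>{0..T}. ball x (d x))" using Cd by auto
  qed auto
  have "f y \<le> Max (insert 0 (C ` F))" if y: "y \<in> {0..T}" for y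
  proof -
    obtain x where x: "x \<in> F" "y \<in> ball x (d x)" using F(3) y by blast
    then have "f y \<le> C x" using Cd[of x] F(1) y by (auto simp: dist_commute)
    also have "C x \<le> Max (insert 0 (C ` F))" using x F(2) by (intro Max_ge) auto
    finally show ?thesis .
  qed
  then show ?thesis by blast
qed

lemma norm_field_coeffs_le:
  assumes "L2_field (B t)"
  shows "norm (field_coeffs B t k i) \<le> sqrt torus_vol * L2norm (B t)"
  using norm_fcoeff_le[OF assms] by (simp add: field_coeffs_def torus_vol_def)

text \<open>Coefficients are controlled by the L2 norm uniformly in k. Continuity in L2 therefore
  passes to every coefficient, and compactness of [0, T] yields a common bound for all
  modes.\<close>

lemma dynamo_solution_mode_sol:
  assumes sol: "dynamo_solution dynamo_vel \<epsilon> seed_field B"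
  shows "mode_sol \<epsilon> (field_coeffs B)" "int_vec k \<Longrightarrow> field_coeffs B 0 k i = (if k = 0 \<and> i = 3 then of_real torus_vol else 0)"
proof -
  have L2: "L2_field (B t)" and df: "div_free (B t)" if "t \<ge> 0" for t
    using sol that by (auto simp: dynamo_solution_def)
  have lim: "((\<lambda>t. L2norm (\<lambda>x. B t x - B t0 x)) \<longlongrightarrow> 0) (at t0 within {0..})" if "t0 \<ge> 0" for t0
    using sol that by (auto simp: dynamo_solution_def)
  have shift: "dynamo_vel s = shear_vel (wave (phase_at s)) (cosamp (phase_at s)) (sinamp (phase_at s))" for s
    by (simp add: dynamo_vel_def)
  have wk: "set_integrable lborel {0..t} (\<lambda>s. phase_rhs \<epsilon> (phase_at s) (field_coeffs B s) k i)"
      "field_coeffs B t k i - fcoeff (\<lambda>x. seed_field x $ i) k = (LINT s:{0..t}|lborel. phase_rhs \<epsilon> (phase_at s) (field_coeffs B s) k i)"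
    if t: "t \<ge> 0" and k: "int_vec k" for t k i
  proof -
    have w: "set_integrable lborel {0..t} (dynamo_flux dynamo_vel \<epsilon> B k a \<theta>) \<and>
        (LINT x:torus_box|lborel. B t x \<bullet> (cos (k \<bullet> x + \<theta>) *\<^sub>R a))
          - (LINT x:torus_box|lborel. seed_field x \<bullet> (cos (k \<bullet> x + \<theta>) *\<^sub>R a))
        = (LINT s:{0..t}|lborel. dynamo_flux dynamo_vel \<epsilon> B k a \<theta> s)" for a \<theta>
      using sol t k unfolding dynamo_solution_def by blast
    have L2': "L2_field (B s)" if "s \<in> {0..t}" for s using L2 that by simp
    show "set_integrable lborel {0..t} (\<lambda>s. phase_rhs \<epsilon> (phase_at s) (field_coeffs B s) k i)"
      using weak_form_imp_coeff(1)[OF L2' L2_field_seed t shift w, of i] by (simp only: phase_rhs_dynamo)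
    show "field_coeffs B t k i - fcoeff (\<lambda>x. seed_field x $ i) k = (LINT s:{0..t}|lborel. phase_rhs \<epsilon> (phase_at s) (field_coeffs B s) k i)"
      using weak_form_imp_coeff(2)[OF L2' L2_field_seed t shift w, of i] by (simp only: phase_rhs_dynamo)
  qed
  have HK: "((\<lambda>s. phase_rhs \<epsilon> (phase_at s) (field_coeffs B s) k i) has_integral (field_coeffs B t k i - fcoeff (\<lambda>x. seed_field x $ i) k)) {0..t}"
    if "t \<ge> 0" "int_vec k" for t k i
    using set_borel_integral_eq_integral[OF wk(1)[OF that]] wk(2)[OF that] by (simp add: has_integral_iff)
  \<comment> \<open>The definition of a solution imposes the initial datum through the weak identity
    alone; at t = 0 its time integral vanishes.\<close>
  have init: "field_coeffs B 0 k i = fcoeff (\<lambda>x. seed_field x $ i) k" if "int_vec k" for k i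
  proof -
    have "((\<lambda>s. phase_rhs \<epsilon> (phase_at s) (field_coeffs B s) k i) has_integral 0) {0..0}" by (simp add: has_integral_refl(2)[of _ "0::real", simplified])
    then have "field_coeffs B 0 k i - fcoeff (\<lambda>x. seed_field x $ i) k = 0" using HK[OF order_refl that] has_integral_unique by blast
    then show ?thesis by simp
  qed
  show "field_coeffs B 0 k i = (if k = 0 \<and> i = 3 then of_real torus_vol else 0)" if "int_vec k"
    using init[OF that] fcoeff_seed[OF that] by simp
  have cdiff: "norm (field_coeffs B t k i - field_coeffs B t0 k i) \<le> sqrt torus_vol * L2norm (\<lambda>x. B t x - B t0 x)" if "t \<ge> 0" "t0 \<ge> 0" for t t0 k i
    using norm_fcoeff_le[OF L2_field_diff[OF L2[OF that(1)] L2[OF that(2)]], of i k]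
    unfolding fcoeff_diff[OF L2[OF that(1)] L2[OF that(2)]] by (simp add: field_coeffs_def torus_vol_def)
  have cont: "continuous_on {0..} (\<lambda>t. field_coeffs B t k i)" for k i
    unfolding continuous_on_def
  proof
    fix t0 :: real assume t0: "t0 \<in> {0..}"
    have "((\<lambda>t. sqrt torus_vol * L2norm (\<lambda>x. B t x - B t0 x)) \<longlongrightarrow> sqrt torus_vol * 0) (at t0 within {0..})"
      using t0 by (intro tendsto_mult_left lim) simp
    then have "((\<lambda>t. sqrt torus_vol * L2norm (\<lambda>x. B t x - B t0 x)) \<longlongrightarrow> 0) (at t0 within {0..})" by simp
    moreover have "\<forall>\<^sub>F t in at t0 within {0..}. norm (field_coeffs B t k i - field_coeffs B t0 k i) \<le> sqrt torus_vol * L2norm (\<lambda>x. B t x - B t0 x)"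
      using cdiff t0 by (auto simp: eventually_at_filter)
    ultimately have "((\<lambda>t. field_coeffs B t k i - field_coeffs B t0 k i) \<longlongrightarrow> 0) (at t0 within {0..})"
      by (rule Lim_null_comparison[rotated])
    then show "((\<lambda>t. field_coeffs B t k i) \<longlongrightarrow> field_coeffs B t0 k i) (at t0 within {0..})" by (simp add: LIM_zero_iff)
  qed
  have bdd: "\<exists>C. \<forall>t\<in>{0..T}. \<forall>k i. int_vec k \<longrightarrow> norm (field_coeffs B t k i) \<le> C" for T
  proof -
    have "\<exists>C. \<forall>t\<in>{0..T}. (L2norm (B t))\<^sup>2 \<le> C"
    proof (rule locally_bounded_imp_bounded)
      fix x assume x: "x \<in> {0..T}"
      then have x0: "x \<ge> 0" by simp
      have "\<forall>\<^sub>F t in at x within {0..}. L2norm (\<lambda>z. B t z - B x z) < 1"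
        using order_tendstoD(2)[OF lim[OF x0]] by simp
      then obtain d where d: "d > 0" "\<forall>t\<in>{0..}. t \<noteq> x \<and> dist t x < d \<longrightarrow> L2norm (\<lambda>z. B t z - B x z) < 1"
        unfolding eventually_at by blast
      have "(L2norm (B t))\<^sup>2 \<le> 2 + 2 * (L2norm (B x))\<^sup>2" if "t \<in> {0..T}" "dist t x < d" for t
      proof (cases "t = x")
        case True
        then show ?thesis using zero_le_power2[of "L2norm (B x)"] by simp
      next
        case False
        have "L2norm (\<lambda>z. B t z - B x z) \<le> 1" using d(2)[rule_format, of t] that False by simp
        then have "(L2norm (\<lambda>z. B t z - B x z))\<^sup>2 \<le> 1" by (simp add: power_le_one)
        then show ?thesis using L2norm_sq_le[OF L2 L2[OF x0], of t] that by simp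
      qed
      then show "\<exists>C d. d > 0 \<and> (\<forall>y\<in>{0..T}. dist y x < d \<longrightarrow> (L2norm (B y))\<^sup>2 \<le> C)" using d(1) by blast
    qed
    then obtain C where C: "\<forall>t\<in>{0..T}. (L2norm (B t))\<^sup>2 \<le> C" by blast
    have "norm (field_coeffs B t k i) \<le> sqrt torus_vol * sqrt C" if "t \<in> {0..T}" for t k i
    proof -
      have "L2norm (B t) \<le> sqrt C" using C that by (simp add: real_le_rsqrt)
      then have "sqrt torus_vol * L2norm (B t) \<le> sqrt torus_vol * sqrt C" using torus_vol_pos by (intro mult_left_mono) auto
      moreover have "norm (field_coeffs B t k i) \<le> sqrt torus_vol * L2norm (B t)"
        by (rule norm_field_coeffs_le[OF L2]) (use that in simp)
      ultimately show ?thesis by linarith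
    qed
    then show ?thesis by blast
  qed
  show "mode_sol \<epsilon> (field_coeffs B)"
    unfolding mode_sol_def
  proof (intro conjI allI impI)
    show "(\<Sum>i\<in>UNIV. of_real (k $ i) * field_coeffs B t k i) = 0" if "t \<ge> 0" "int_vec k" for t k
      using df[OF that(1)] that(2) unfolding div_free_iff[OF L2[OF that(1)]] field_coeffs_def by blast
    show "((\<lambda>s. phase_rhs \<epsilon> (phase_at s) (field_coeffs B s) k i) has_integral field_coeffs B t k i - field_coeffs B 0 k i) {0..t}"
      if "int_vec k" "t \<ge> 0" for k i t
      unfolding init[OF that(1)] by (rule HK[OF that(2,1)])
  qed (rule cont bdd)+
qed

section \<open>From growth over epochs to the growth rate\<close>

definition rate :: real where "rate = ln (1 + kap * del\<^sup>2 / 4)"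

lemma rate_pos: "rate > 0"
  unfolding rate_def using kap_bounds del_bounds by (intro ln_gt_zero) simp

text \<open>The 3 (\<open>rest_end n\<close> + 1) growth steps make up 3/4 of the time at the end of
  the epoch, by \<open>epoch_start_Suc\<close>. A coefficient is at most sqrt
  \<open>torus_vol\<close> times the L2 norm and the conserved mean has size
  \<open>torus_vol\<close>, which leaves sqrt \<open>torus_vol\<close> / 40.\<close>

lemma growth_at_epoch:
  assumes \<epsilon>: "\<epsilon> > 0" and sol: "dynamo_solution dynamo_vel \<epsilon> seed_field B"
    and \<eta>: "\<epsilon> * (real (epoch_scale n) * scale_inv)\<^sup>2 \<in> {1..2}"
    and small: "exp (crude_rate \<epsilon> * real (epoch_start n) - \<epsilon> * (real (Suc n) * real (epoch_start n)) + crude_rate \<epsilon>) \<le> del"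
  shows "L2norm (B (real (epoch_start (Suc n)))) > 0"
    and "ln (L2norm (B (real (epoch_start (Suc n))))) \<ge> 3 / 4 * real (epoch_start (Suc n)) * rate + ln (sqrt torus_vol / 40)"
proof -
  define T where "T = real (epoch_start (Suc n))"
  note cs = dynamo_solution_mode_sol[OF sol]
  have c0: "norm (field_coeffs B 0 k i) \<le> torus_vol" if "int_vec k" for k i using cs(2)[OF that, of i] torus_vol_pos by simp
  have m0: "field_coeffs B 0 0 3 = of_real torus_vol" using cs(2)[of 0 3] by (simp add: int_vec_def)
  from epoch_growth[OF \<epsilon> cs(1) torus_vol_pos c0 m0 \<eta> small]
  obtain k i where ki: "int_vec k" "(1 + kap * del\<^sup>2 / 4) ^ (3 * (rest_end n + 1)) * (torus_vol / 40) \<le> norm (field_coeffs B T k i)"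
    unfolding T_def by blast
  have L2: "L2_field (B T)" using sol by (auto simp: dynamo_solution_def T_def)
  have q: "1 + kap * del\<^sup>2 / 4 > 0" using kap_bounds by (simp add: add_pos_nonneg)
  define G where "G = (1 + kap * del\<^sup>2 / 4) ^ (3 * (rest_end n + 1))"
  have G: "G > 0" using q by (simp add: G_def)
  have sv: "sqrt torus_vol > 0" "sqrt torus_vol * sqrt torus_vol = torus_vol" using torus_vol_pos by auto
  have "G * (torus_vol / 40) \<le> sqrt torus_vol * L2norm (B T)" using ki(2) norm_field_coeffs_le[of B T k i, OF L2] by (simp add: G_def)
  then have "sqrt torus_vol * (G * (sqrt torus_vol / 40)) \<le> sqrt torus_vol * L2norm (B T)" using sv by (simp add: mult_ac)
  then have le: "G * (sqrt torus_vol / 40) \<le> L2norm (B T)" using sv by simp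
  have p: "G * (sqrt torus_vol / 40) > 0" using G sv by simp
  show "L2norm (B (real (epoch_start (Suc n)))) > 0" using le p by (simp add: T_def)
  have J: "real (3 * (rest_end n + 1)) = 3 / 4 * T" by (simp add: T_def epoch_start_Suc)
  have "ln (G * (sqrt torus_vol / 40)) = ln G + ln (sqrt torus_vol / 40)" by (rule ln_mult_pos) (use G sv in auto)
  also have "ln G = 3 / 4 * T * rate" unfolding G_def using q by (subst ln_realpow) (simp_all only: J rate_def)
  finally have "3 / 4 * T * rate + ln (sqrt torus_vol / 40) = ln (G * (sqrt torus_vol / 40))" by simp
  also have "\<dots> \<le> ln (L2norm (B T))" using le p by (subst ln_le_cancel_iff) auto
  finally show "ln (L2norm (B (real (epoch_start (Suc n))))) \<ge> 3 / 4 * real (epoch_start (Suc n)) * rate + ln (sqrt torus_vol / 40)"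
    by (simp add: T_def)
qed

text \<open>The exact solution y of \<epsilon> (y \<open>scale_inv\<close>)^2 = 1 is rounded up. The
  smallness of \<epsilon> means y \<ge> 3, so rounding multiplies y by at most 4/3, and 16/9 \<le>
  2.\<close>

lemma scale_exists:
  assumes "0 < \<epsilon>" "\<epsilon> \<le> 1 / (9 * scale_inv\<^sup>2)"
  shows "\<exists>N>0. \<epsilon> * (real N * scale_inv)\<^sup>2 \<in> {1..2}"
proof -
  have m: "scale_inv > 0" by (simp add: scale_inv_def)
  define y where "y = 1 / (scale_inv * sqrt \<epsilon>)"
  have se: "sqrt \<epsilon> > 0" "sqrt \<epsilon> * sqrt \<epsilon> = \<epsilon>" using assms by auto
  have y1: "\<epsilon> * (y * scale_inv)\<^sup>2 = 1" using m se(1) assms(1) by (simp add: y_def power2_eq_square field_simps)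
  have y: "y \<ge> 3"
  proof -
    have "9 \<le> 1 / (scale_inv\<^sup>2 * \<epsilon>)" using assms m by (simp add: field_simps)
    also have "\<dots> = y\<^sup>2" using assms by (simp add: y_def power_divide power_mult_distrib)
    finally have "3\<^sup>2 \<le> y\<^sup>2" by simp
    moreover have "y \<ge> 0" using m se by (simp add: y_def)
    ultimately show ?thesis by (rule power2_le_imp_le)
  qed
  define N where "N = nat \<lceil>y\<rceil>"
  have N: "y \<le> real N" "real N \<le> y + 1" using y unfolding N_def by linarith+
  have "real N > 0" using N y by linarith
  have e: "\<epsilon> * (real N * scale_inv)\<^sup>2 = (\<epsilon> * (y * scale_inv)\<^sup>2) * (real N / y)\<^sup>2"
    using y by (simp add: power_mult_distrib power_divide)
  have r: "1 \<le> real N / y" "real N / y \<le> 4 / 3" using N y by (auto simp: field_simps)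
  have "1 \<le> (real N / y)\<^sup>2" using r by simp
  moreover have "(real N / y)\<^sup>2 \<le> 2"
  proof -
    have "(real N / y)\<^sup>2 \<le> (4 / 3)\<^sup>2" using r by (intro power_mono) auto
    also have "(4 / 3)\<^sup>2 \<le> (2 :: real)" by (simp add: power2_eq_square)
    finally show ?thesis .
  qed
  ultimately have "\<epsilon> * (real N * scale_inv)\<^sup>2 \<in> {1..2}" unfolding e y1 by simp
  then show ?thesis using \<open>real N > 0\<close> by auto
qed

text \<open>At the end of a suitable epoch the exponent is 3/4 \<open>rate\<close>, of which at most
  1/4 \<open>rate\<close> goes to the additive constant. Such epochs occur arbitrarily late, so the
  limsup is at least half of \<open>rate\<close>.\<close>

lemma growth_rate_ge:
  assumes \<epsilon>: "0 < \<epsilon>" "\<epsilon> \<le> 1 / (9 * scale_inv\<^sup>2)" and sol: "dynamo_solution dynamo_vel \<epsilon> seed_field B"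
  shows "growth_rate B \<ge> ereal (rate / 2)"
proof (rule ccontr)
  assume "\<not> ?thesis"
  then have "growth_rate B < ereal (rate / 2)" by simp
  then have "\<forall>\<^sub>F t in at_top. (if L2norm (B t) = 0 then - \<infinity> else ereal (ln (L2norm (B t)) / t)) < ereal (rate / 2)"
    unfolding growth_rate_def by (rule Limsup_lessD)
  then obtain t0 where t0: "\<And>t. t \<ge> t0 \<Longrightarrow> (if L2norm (B t) = 0 then - \<infinity> else ereal (ln (L2norm (B t)) / t)) < ereal (rate / 2)"
    unfolding eventually_at_top_linorder by blast
  obtain N where N: "N > 0" "\<epsilon> * (real N * scale_inv)\<^sup>2 \<in> {1..2}" using scale_exists[OF \<epsilon>] by blast
  define b where "b = \<bar>ln (sqrt torus_vol / 40)\<bar>"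
  \<comment> \<open>The three lower bounds ensure that the final time exceeds t0, that the additive
    constant costs at most a quarter of \<open>rate\<close> times that time, and that the rest in
    the epoch beats the crude growth.\<close>
  obtain m where m: "real m \<ge> max (max t0 (4 * b / rate)) ((2 * crude_rate \<epsilon> + \<bar>ln del\<bar>) / \<epsilon>)"
    using real_arch_simple by blast
  \<comment> \<open>The pairing supplies epochs of the prescribed scale N with index at least m; N -
    1 undoes the successor in \<open>epoch_scale\<close>.\<close>
  define n where "n = prod_encode (N - 1, m)"
  have epoch_scale: "epoch_scale n = N" using N by (simp add: epoch_scale_def n_def)
  have nm: "real m \<le> real n" unfolding n_def using le_prod_encode_2 by simp
  define T where "T = real (epoch_start (Suc n))"
  have Tn: "T > real n" using epoch_start_ge[of "Suc n"] by (simp add: T_def)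
  have small: "exp (crude_rate \<epsilon> * real (epoch_start n) - \<epsilon> * (real (Suc n) * real (epoch_start n)) + crude_rate \<epsilon>) \<le> del"
  proof -
    have L: "crude_rate \<epsilon> > 0" using \<epsilon> by (simp add: crude_rate_def)
    have tn: "real (epoch_start n) \<ge> 1" using epoch_start_ge[of n] by simp
    have "(2 * crude_rate \<epsilon> + \<bar>ln del\<bar>) / \<epsilon> \<le> real (Suc n)" using m nm by simp
    then have a: "2 * crude_rate \<epsilon> + \<bar>ln del\<bar> \<le> \<epsilon> * real (Suc n)" using \<epsilon> by (simp add: pos_divide_le_eq mult.commute)
    have "crude_rate \<epsilon> * 1 \<le> crude_rate \<epsilon> * real (epoch_start n)" using L tn by (intro mult_left_mono) auto
    then have "crude_rate \<epsilon> * real (epoch_start n) - \<epsilon> * (real (Suc n) * real (epoch_start n)) + crude_rate \<epsilon> \<le> (2 * crude_rate \<epsilon> - \<epsilon> * real (Suc n)) * real (epoch_start n)"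
      by (simp add: algebra_simps)
    also have "\<dots> \<le> (- \<bar>ln del\<bar>) * real (epoch_start n)" using a by (intro mult_right_mono) auto
    also have "\<dots> \<le> (- \<bar>ln del\<bar>) * 1" using tn by (intro mult_left_mono_neg) auto
    also have "\<dots> \<le> ln del" by simp
    finally have "exp (crude_rate \<epsilon> * real (epoch_start n) - \<epsilon> * (real (Suc n) * real (epoch_start n)) + crude_rate \<epsilon>) \<le> exp (ln del)"
      by (rule exp_le_cancel_iff[THEN iffD2])
    then show ?thesis using del_bounds by simp
  qed
  have \<eta>: "\<epsilon> * (real (epoch_scale n) * scale_inv)\<^sup>2 \<in> {1..2}" using N epoch_scale by simp
  note g = growth_at_epoch[OF \<epsilon>(1) sol \<eta> small, folded T_def]
  have T: "T > 0" "T \<ge> t0" using Tn nm m by auto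
  have "4 * b / rate \<le> T" using Tn nm m by simp
  then have "4 * b \<le> T * rate" using rate_pos by (simp add: pos_divide_le_eq)
  then have "b \<le> 1 / 4 * T * rate" by simp
  moreover have "ln (sqrt torus_vol / 40) \<ge> - b" by (simp add: b_def)
  ultimately have "ln (L2norm (B T)) \<ge> 1 / 2 * T * rate" using g(2) by argo
  then have "rate / 2 \<le> ln (L2norm (B T)) / T" using T by (simp add: field_simps)
  then show False using t0[OF T(2)] g(1) by auto
qed

theorem theorem1p1:
  shows "\<exists>u. velocity_field u \<and>
    (\<exists>Bin :: real \<Rightarrow> real^3 \<Rightarrow> real^3.
       (\<forall>\<epsilon>\<in>{0<..<1}. L2_field (Bin \<epsilon>)) \<and>
       (\<forall>\<epsilon>\<in>{0<..<1}. \<exists>B. dynamo_solution u \<epsilon> (Bin \<epsilon>) B) \<and>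
       (\<forall>B :: real \<Rightarrow> real \<Rightarrow> real^3 \<Rightarrow> real^3.
          (\<forall>\<epsilon>\<in>{0<..<1}. dynamo_solution u \<epsilon> (Bin \<epsilon>) (B \<epsilon>)) \<longrightarrow>
          Liminf (at_right 0) (\<lambda>\<epsilon>. growth_rate (B \<epsilon>)) > 0))"
proof (rule exI[of _ dynamo_vel], rule conjI[OF _ exI[of _ "\<lambda>_. seed_field"]], goal_cases)
  case 1
  show ?case by (rule velocity_field_dynamo_vel)
next
  case 2
  show ?case
  proof (intro conjI ballI allI impI)
    show "L2_field seed_field" by (rule L2_field_seed)
    show "\<exists>B. dynamo_solution dynamo_vel \<epsilon> seed_field B" if "\<epsilon> \<in> {0<..<1}" for \<epsilon>
      using that by (intro dynamo_solution_exists) simp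
    fix B :: "real \<Rightarrow> real \<Rightarrow> real^3 \<Rightarrow> real^3"
    assume B: "\<forall>\<epsilon>\<in>{0<..<1}. dynamo_solution dynamo_vel \<epsilon> seed_field (B \<epsilon>)"
    have e0: "0 < 1 / (9 * scale_inv\<^sup>2)" "1 / (9 * scale_inv\<^sup>2) < 1" by (simp_all add: scale_inv_def)
    have "\<forall>\<^sub>F \<epsilon> in at_right 0. ereal (rate / 2) \<le> growth_rate (B \<epsilon>)"
      unfolding eventually_at_right_field
    proof (intro exI[of _ "1 / (9 * scale_inv\<^sup>2)"] conjI allI impI)
      fix \<epsilon> :: real assume \<epsilon>: "0 < \<epsilon>" "\<epsilon> < 1 / (9 * scale_inv\<^sup>2)"
      then have "\<epsilon> \<in> {0<..<1}" using less_trans[OF \<epsilon>(2) e0(2)] by simp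
      then have "dynamo_solution dynamo_vel \<epsilon> seed_field (B \<epsilon>)" using B by blast
      then show "ereal (rate / 2) \<le> growth_rate (B \<epsilon>)"
        using \<epsilon> by (intro growth_rate_ge) auto
    qed (rule e0)
    then have "ereal (rate / 2) \<le> Liminf (at_right 0) (\<lambda>\<epsilon>. growth_rate (B \<epsilon>))" by (rule Liminf_bounded)
    moreover have "0 < ereal (rate / 2)" using rate_pos by simp
    ultimately show "Liminf (at_right 0) (\<lambda>\<epsilon>. growth_rate (B \<epsilon>)) > 0" by (rule less_le_trans[rotated])
  qed
qed

end
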